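(* Let $L(v)$ be either the Hill operator with a potential $v\in H^{-1}_{per}$, or the one-dimensional Dirac operator with a potential $v=\begin{pmatrix}0&P\\Q&0\end{pmatrix}$, $P,Q\in L^2([0,\pi],\mathbb{C})$. Suppose that there is an infinite set $\Delta$ of even (if $bc=Per^+$) or odd (if $bc=Per^-$) integers (with $\Delta\subset\mathbb{N}$ in the Hill case and $\Delta\subset\mathbb{Z}$ in the Dirac case) and a sequence of positive numbers $\eta_n\to0$ such that for $n\in\Delta$ $$\beta_n^-(z_n^* )\ne0,\qquad\beta_n^+(z_n^* )\ne0,$$ $$\beta_n^\pm(z)=\beta_n^\pm(z_n^* )(1+O(\eta_n))\quad\text{if}\quad z\in D_n:=\{z:|z-z_n^*|\le\rho_n\},\qquad\rho_n:=2\left(|\beta_n^-(z_n^* )|+|\beta_n^+(z_n^* )|\right)$$ (the constant in $O(\cdot)$ being independent of $n$ and $z$). Then, for $n\in\Delta$ with $|n|$ sufficiently large, there are analytic branches $\sqrt{\beta_n^-(z)}$ and $\sqrt{\beta_n^+(z)}$ of $[\beta_n^-(z)]^{1/2}$ and $[\beta_n^+(z)]^{1/2}$, defined in a neighborhood of $D_n$, such that $z_n^+$ and $z_n^-$ are, respectively, the only roots of the equations $$z-\alpha_n(z)=\sqrt{\beta_n^-(z)}\sqrt{\beta_n^+(z)},\quad z\in D_n,$$ $$z-\alpha_n(z)=-\sqrt{\beta_n^-(z)}\sqrt{\beta_n^+(z)},\quad z\in D_n.$$ Moreover, with these branches, $$\gamma_n\sim2\sqrt{\beta_n^-(z_n^*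 )}\sqrt{\beta_n^+(z_n^* )},\qquad n\in\Delta.$$
   Context: Here $f(n)\sim g(n)$, $n\in\Delta$, means $f(n)/g(n)\to1$ as $|n|\to\infty$, $n\in\Delta$. Hill operator: $v\in H^{-1}_{per}(\mathbb{R})$ is a complex-valued $\pi$-periodic distribution $v=C+q'$ with $C\in\mathbb{C}$ and $q\in L^2_{loc}(\mathbb{R})$ $\pi$-periodic. $Ly=-y''+v(x)y$ on $[0,\pi]$ is understood as $Ly=-(y'-qy)'-qy'+Cy$ for $y\in W^1_2([0,\pi])$ with $y'-qy\in W^1_1([0,\pi])$, $Ly\in L^2([0,\pi])$. Boundary conditions $Per^\pm$: $y(\pi)=\pm y(0)$, $(y'-qy)(\pi)=\pm(y'-qy)(0)$ (for $v\in L^2$ this is $y'(\pi)=\pm y'(0)$). Dirac operator: $Ly=i\begin{pmatrix}1&0\\0&-1\end{pmatrix}\frac{dy}{dx}+v(x)y$, $y=\begin{pmatrix}y_1\\ y_2\end{pmatrix}$ on $[0,\pi]$. $Per^\pm$: $y_1(\pi)=\pm y_1(0)$, $y_2(\pi)=\pm y_2(0)$. Eigenvalues: indices are $n\in\mathbb{N}$, $\lambda_n^0=n^2$ (Hill), $n\in\mathbb{Z}$, $\lambda^0_n=n$ (Dirac). For large enough $|n|$ the disc $|\lambda-\lambda_n^0|<n/4$ (Hill), resp. $|\lambda-\lambda_n^0|<1/2$ (Dirac), contains exactly two eigenvalues $\lambda_n^-,\lambda_n^+$ (counted with multiplicity) of $L$ with condition $Per^+$ if $n$ is even, $Per^-$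 if $n$ is odd. $\lambda_n^+$ is the one with larger real part (larger imaginary part if the real parts are equal). Put $\gamma_n=\lambda_n^+-\lambda_n^-$, $z_n^\pm=\lambda_n^\pm-\lambda_n^0$, $z_n^*=\frac12(z_n^++z_n^-)$. Functionals $\alpha_n(z),\beta_n^\pm(z)$ (depending on $v$; analytic in $z$, defined for large $|n|$ and $|z|\le n/4$ (Hill), $|z|\le 1/2$ (Dirac)). Hill: with $v=\sum_{m\in2\mathbb{Z}}V(m)e^{imx}$, and all sums over $j_1,\dots,j_k\in(n+2\mathbb{Z})\setminus\{\pm n\}$, $$\alpha_n(z)=V(0)+\sum_{k\ge1}\sum_{j_1,\dots,j_k}\frac{V(-n-j_1)V(j_1-j_2)\cdots V(j_{k-1}-j_k)V(j_k+n)}{\prod_{i=1}^k(n^2-j_i^2+z)},$$ $$\beta_n^\pm(z)=V(\pm2n)+\sum_{k\ge1}\sum_{j_1,\dots,j_k}\frac{V(\pm n-j_1)V(j_1-j_2)\cdots V(j_{k-1}-j_k)V(j_k\pm n)}{\prod_{i=1}^k(n^2-j_i^2+z)}.$$ Dirac: with $P=\sum_{m\in2\mathbb{Z}}p(m)e^{imx}$, $Q=\sum_{m\in2\mathbb{Z}}q(m)e^{imx}$, and all sums over $j_1,\dots,j_k\in(n+2\mathbb{Z})\setminus\{n\}$, $$\alpha_n(z)=\sum_{k\ge1\text{ odd}}\sum_{j_1,\dots,j_k}\frac{p(-n-j_1)q(j_1+j_2)p(-j_2-j_3)\cdots q(j_k+n)}{\prod_{i=1}^k(n-j_i+z)},$$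 $$\beta_n^-(z)=p(-2n)+\sum_{k\ge2\text{ even}}\sum_{j_1,\dots,j_k}\frac{p(-n-j_1)q(j_1+j_2)p(-j_2-j_3)\cdots p(-j_k-n)}{\prod_{i=1}^k(n-j_i+z)},$$ $$\beta_n^+(z)=q(2n)+\sum_{k\ge2\text{ even}}\sum_{j_1,\dots,j_k}\frac{q(n+j_1)p(-j_1-j_2)q(j_2+j_3)\cdots q(j_k+n)}{\prod_{i=1}^k(n-j_i+z)}.$$ Known property: $\lambda_n^0+z$, with $|z|\le n/4$ (resp. $|z|\le1/2$), is a periodic ($n$ even) or antiperiodic ($n$ odd) eigenvalue of $L$ if and only if $(z-\alpha_n(z))^2=\beta_n^-(z)\beta_n^+(z)$, and $z_n^\pm$ are the only solutions. *)

theory Defs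
  imports "HOL-Complex_Analysis.Complex_Analysis" "HOL-Library.Function_Algebras"
begin

subsection \<open>Operators with periodic and antiperiodic boundary conditions\<close>

text \<open>
  \<open>Hill C q\<close> stands for the potential \<open>v = C + q'\<close> in the sense of distributions, and
  \<open>Dirac P Q\<close> for the matrix potential with zero diagonal and off-diagonal entries
  \<open>P\<close> (upper right) and \<open>Q\<close> (lower left).
\<close>

datatype potential =
    Hill complex "real \<Rightarrow> complex"
  | Dirac "real \<Rightarrow> complex" "real \<Rightarrow> complex"

datatype bc = Per_plus | Per_minus

fun bc_sign :: "bc \<Rightarrow> complex" where
  "bc_sign Per_plus = 1"
| "bc_sign Per_minus = -1"

definition bc_of :: "int \<Rightarrow> bc" where
  "bc_of n = (if even n then Per_plus else Per_minus)"

definition L1 :: "(real \<Rightarrow> complex) \<Rightarrow> bool" where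
  "L1 f \<longleftrightarrow> set_integrable lebesgue {0..pi} f"

definition L2 :: "(real \<Rightarrow> complex) \<Rightarrow> bool" where
  "L2 f \<longleftrightarrow> set_borel_measurable lebesgue {0..pi} f
          \<and> set_integrable lebesgue {0..pi} (\<lambda>x. (cmod (f x))\<^sup>2)"

fun valid_potential :: "potential \<Rightarrow> bool" where
  "valid_potential (Hill C q) \<longleftrightarrow> (\<forall>x. q (x + pi) = q x) \<and> L2 q"
| "valid_potential (Dirac P Q) \<longleftrightarrow> L2 P \<and> L2 Q"

text \<open>
  \<open>y\<close> is absolutely continuous on \<open>[0, \<pi>]\<close> with derivative \<open>g\<close>. Thus \<open>y\<close> lies in
  \<open>W\<^sup>1\<^sub>1\<close> iff such a \<open>g\<close> exists, and in \<open>W\<^sup>1\<^sub>2\<close> iff moreover \<open>L2 g\<close>.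
\<close>

definition has_AC_deriv :: "(real \<Rightarrow> complex) \<Rightarrow> (real \<Rightarrow> complex) \<Rightarrow> bool" where
  "has_AC_deriv y g \<longleftrightarrow> L1 g \<and> (\<forall>x\<in>{0..pi}. y x = y 0 + (LINT t:{0..x}|lebesgue. g t))"

text \<open>
  \<open>hill_op C q b y f\<close>: \<open>y\<close> belongs to the domain of the operator and \<open>L y = f\<close> almost everywhere.
  The function \<open>u\<close> is the absolutely continuous representative of the quasi-derivative
  \<open>y' - q y\<close>; it is the one whose boundary values are meaningful.
\<close>

definition hill_op ::
  "complex \<Rightarrow> (real \<Rightarrow> complex) \<Rightarrow> bc \<Rightarrow> (real \<Rightarrow> complex) \<Rightarrow> (real \<Rightarrow> complex) \<Rightarrow> bool" where
  "hill_op C q b y f \<longleftrightarrow>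
     (\<exists>y' u u'. has_AC_deriv y y' \<and> L2 y' \<and> has_AC_deriv u u'
        \<and> (AE x in lebesgue. x \<in> {0..pi} \<longrightarrow> u x = y' x - q x * y x)
        \<and> (AE x in lebesgue. x \<in> {0..pi} \<longrightarrow> f x = - u' x - q x * y' x + C * y x)
        \<and> L2 f
        \<and> y pi = bc_sign b * y 0 \<and> u pi = bc_sign b * u 0)"

definition dirac_op ::
  "(real \<Rightarrow> complex) \<Rightarrow> (real \<Rightarrow> complex) \<Rightarrow> bc
     \<Rightarrow> (real \<Rightarrow> complex \<times> complex) \<Rightarrow> (real \<Rightarrow> complex \<times> complex) \<Rightarrow> bool" where
  "dirac_op P Q b y f \<longleftrightarrow>
     (\<exists>g1 g2. has_AC_deriv (\<lambda>x. fst (y x)) g1 \<and> L2 g1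
        \<and> has_AC_deriv (\<lambda>x. snd (y x)) g2 \<and> L2 g2
        \<and> (AE x in lebesgue. x \<in> {0..pi} \<longrightarrow>
             fst (f x) = \<i> * g1 x + P x * snd (y x) \<and>
             snd (f x) = - \<i> * g2 x + Q x * fst (y x))
        \<and> fst (y pi) = bc_sign b * fst (y 0) \<and> snd (y pi) = bc_sign b * snd (y 0))"


subsection \<open>Eigenvalues and algebraic multiplicities\<close>

text \<open>
  Below, \<open>R y f\<close> is one of the relations \<open>L y = f\<close> above and \<open>sc\<close> is the scalar multiplication on
  the values of \<open>y\<close>. The relations only see the values on \<open>[0, \<pi>]\<close>, so functions are normalised
  to vanish elsewhere; \<open>gen_ker sc R \<mu> k\<close> is then the kernel of \<open>(L - \<mu>)\<^sup>k\<close>.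
\<close>

definition is_eigenvalue ::
  "(complex \<Rightarrow> 'b::ab_group_add \<Rightarrow> 'b) \<Rightarrow> ((real \<Rightarrow> 'b) \<Rightarrow> (real \<Rightarrow> 'b) \<Rightarrow> bool) \<Rightarrow> complex
     \<Rightarrow> bool" where
  "is_eigenvalue sc R \<mu> \<longleftrightarrow> (\<exists>y. (\<exists>x\<in>{0..pi}. y x \<noteq> 0) \<and> R y (\<lambda>x. sc \<mu> (y x)))"

fun gen_ker ::
  "(complex \<Rightarrow> 'b::ab_group_add \<Rightarrow> 'b) \<Rightarrow> ((real \<Rightarrow> 'b) \<Rightarrow> (real \<Rightarrow> 'b) \<Rightarrow> bool) \<Rightarrow> complex
     \<Rightarrow> nat \<Rightarrow> (real \<Rightarrow> 'b) set" where
  "gen_ker sc R \<mu> 0 = {\<lambda>x. 0}"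
| "gen_ker sc R \<mu> (Suc k) =
     {y. (\<forall>x. x \<notin> {0..pi} \<longrightarrow> y x = 0) \<and>
         (\<exists>w\<in>gen_ker sc R \<mu> k. R y (\<lambda>x. sc \<mu> (y x) + w x))}"

definition alg_mult ::
  "(complex \<Rightarrow> 'b::ab_group_add \<Rightarrow> 'b) \<Rightarrow> ((real \<Rightarrow> 'b) \<Rightarrow> (real \<Rightarrow> 'b) \<Rightarrow> bool) \<Rightarrow> complex
     \<Rightarrow> nat" where
  "alg_mult sc R \<mu> = vector_space.dim (\<lambda>c y x. sc c (y x)) (\<Union>k. gen_ker sc R \<mu> k)"

definition scale2 :: "complex \<Rightarrow> complex \<times> complex \<Rightarrow> complex \<times> complex" where
  "scale2 c u = (c * fst u, c * snd u)"

fun eigenvalue :: "potential \<Rightarrow> bc \<Rightarrow> complex \<Rightarrow> bool" where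
  "eigenvalue (Hill C q) b \<mu> = is_eigenvalue (*) (hill_op C q b) \<mu>"
| "eigenvalue (Dirac P Q) b \<mu> = is_eigenvalue scale2 (dirac_op P Q b) \<mu>"

fun multiplicity_of :: "potential \<Rightarrow> bc \<Rightarrow> complex \<Rightarrow> nat" where
  "multiplicity_of (Hill C q) b \<mu> = alg_mult (*) (hill_op C q b) \<mu>"
| "multiplicity_of (Dirac P Q) b \<mu> = alg_mult scale2 (dirac_op P Q b) \<mu>"

fun indices :: "potential \<Rightarrow> int set" where
  "indices (Hill C q) = {1..}"
| "indices (Dirac P Q) = UNIV"

fun lambda0 :: "potential \<Rightarrow> int \<Rightarrow> complex" where
  "lambda0 (Hill C q) n = of_int (n\<^sup>2)"
| "lambda0 (Dirac P Q) n = of_int n"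

fun disc_radius :: "potential \<Rightarrow> int \<Rightarrow> real" where
  "disc_radius (Hill C q) n = of_int n / 4"
| "disc_radius (Dirac P Q) n = 1 / 2"

text \<open>
  \<open>lm\<close> and \<open>lp\<close> are the two eigenvalues, counted with algebraic multiplicity, in the open disc
  around the \<open>n\<close>-th unperturbed eigenvalue, and \<open>lp\<close> is the one with larger real part
  (larger imaginary part if the real parts agree). These conditions determine \<open>lm\<close> and \<open>lp\<close>.
\<close>

definition eigenvalue_pair :: "potential \<Rightarrow> int \<Rightarrow> complex \<Rightarrow> complex \<Rightarrow> bool" where
  "eigenvalue_pair v n lm lp \<longleftrightarrow>
     {\<mu>. cmod (\<mu> - lambda0 v n) < disc_radius v n \<and> eigenvalue v (bc_of n) \<mu>} = {lm, lp}
     \<and> (\<forall>\<mu>\<in>{lm, lp}. multiplicity_of v (bc_of n) \<mu> = count {#lm, lp#} \<mu>)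
     \<and> (Re lm < Re lp \<or> (Re lm = Re lp \<and> Im lm \<le> Im lp))"


subsection \<open>The functionals alpha and beta\<close>

definition fourier_coeff :: "(real \<Rightarrow> complex) \<Rightarrow> int \<Rightarrow> complex" where
  "fourier_coeff f m =
     (LINT x:{0..pi}|lebesgue. f x * exp (- (\<i> * of_int m * of_real x))) / of_real pi"

definition hill_coeff :: "complex \<Rightarrow> (real \<Rightarrow> complex) \<Rightarrow> int \<Rightarrow> complex" where
  "hill_coeff C q m = (if m = 0 then C else \<i> * of_int m * fourier_coeff q m)"

text \<open>\<open>V(a - j\<^sub>1) V(j\<^sub>1 - j\<^sub>2) \<dots> V(j\<^sub>k - b)\<close>\<close>

fun hill_chain :: "(int \<Rightarrow> complex) \<Rightarrow> int \<Rightarrow> int list \<Rightarrow> int \<Rightarrow> complex" where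
  "hill_chain V a [] b = V (a - b)"
| "hill_chain V a (j # js) b = V (a - j) * hill_chain V j js b"

text \<open>
  The common form of the three Hill functionals: \<open>(a, b) = (-n, -n)\<close> for \<open>\<alpha>\<close>,
  \<open>(n, -n)\<close> for \<open>\<beta>\<^sup>+\<close> and \<open>(-n, n)\<close> for \<open>\<beta>\<^sup>-\<close>.
\<close>

definition hill_series ::
  "(int \<Rightarrow> complex) \<Rightarrow> int \<Rightarrow> complex \<Rightarrow> int \<Rightarrow> int \<Rightarrow> complex" where
  "hill_series V n z a b =
     V (a - b) +
     (\<Sum>k. \<Sum>\<^sub>\<infinity>js\<in>{js. length js = k + 1 \<and> set js \<subseteq> {j. even (j - n) \<and> j \<noteq> n \<and> j \<noteq> - n}}.
        hill_chain V a js b / prod_list (map (\<lambda>j. of_int (n\<^sup>2 - j\<^sup>2) + z) js))"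

text \<open>
  \<open>f(a + j\<^sub>1) g(j\<^sub>1 + j\<^sub>2) f(j\<^sub>2 + j\<^sub>3) \<dots>\<close>, the last argument being \<open>j\<^sub>k + b\<close>.
  It is used with \<open>{f, g} = {\<lambda>m. p (- m), q}\<close>.
\<close>

fun dirac_chain ::
  "(int \<Rightarrow> complex) \<Rightarrow> (int \<Rightarrow> complex) \<Rightarrow> int \<Rightarrow> int list \<Rightarrow> int \<Rightarrow> complex" where
  "dirac_chain f g a [] b = f (a + b)"
| "dirac_chain f g a (j # js) b = f (a + j) * dirac_chain g f j js b"

definition dirac_sum ::
  "(int \<Rightarrow> complex) \<Rightarrow> (int \<Rightarrow> complex) \<Rightarrow> int \<Rightarrow> complex \<Rightarrow> nat \<Rightarrow> complex" where
  "dirac_sum f g n z k =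
     (\<Sum>\<^sub>\<infinity>js\<in>{js. length js = k \<and> set js \<subseteq> {j. even (j - n) \<and> j \<noteq> n}}.
        dirac_chain f g n js n / prod_list (map (\<lambda>j. of_int (n - j) + z) js))"

fun alpha :: "potential \<Rightarrow> int \<Rightarrow> complex \<Rightarrow> complex" where
  "alpha (Hill C q) n z = hill_series (hill_coeff C q) n z (- n) (- n)"
| "alpha (Dirac P Q) n z =
     (\<Sum>i. dirac_sum (\<lambda>m. fourier_coeff P (- m)) (fourier_coeff Q) n z (2 * i + 1))"

fun beta_minus :: "potential \<Rightarrow> int \<Rightarrow> complex \<Rightarrow> complex" where
  "beta_minus (Hill C q) n z = hill_series (hill_coeff C q) n z (- n) n"
| "beta_minus (Dirac P Q) n z =
     fourier_coeff P (- 2 * n) +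
     (\<Sum>i. dirac_sum (\<lambda>m. fourier_coeff P (- m)) (fourier_coeff Q) n z (2 * i + 2))"

fun beta_plus :: "potential \<Rightarrow> int \<Rightarrow> complex \<Rightarrow> complex" where
  "beta_plus (Hill C q) n z = hill_series (hill_coeff C q) n z n (- n)"
| "beta_plus (Dirac P Q) n z =
     fourier_coeff Q (2 * n) +
     (\<Sum>i. dirac_sum (fourier_coeff Q) (\<lambda>m. fourier_coeff P (- m)) n z (2 * i + 2))"


subsection \<open>Limits along an index set\<close>

text \<open>The filter describing \<open>|n| \<rightarrow> \<infinity>\<close> with \<open>n \<in> \<Delta>\<close>.\<close>

definition at_infinity_in :: "int set \<Rightarrow> int filter" where
  "at_infinity_in \<Delta> = inf (filtercomap abs at_top) (principal \<Delta>)"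

lemma eventually_at_infinity_in:
  "eventually P (at_infinity_in \<Delta>) \<longleftrightarrow> (\<exists>N. \<forall>n\<in>\<Delta>. \<bar>n\<bar> \<ge> N \<longrightarrow> P n)"
  unfolding at_infinity_in_def eventually_inf_principal eventually_filtercomap_at_top_linorder
  by blast

end

theory Submission
  imports Defs
begin

text \<open>
  In terms of Fourier coefficients, \<open>\<lambda>\<^sub>n\<^sup>0 + z\<close> is an eigenvalue if and only if an infinite system
  \<open>(d i + z) * x i = (\<Sum>j. A i j * x j)\<close> has a nontrivial solution. Only two of the diagonal entries
  \<open>d i\<close> vanish, the others are bounded below by a weight \<open>h i\<close>, and the Hilbert--Schmidt norm of
  \<open>A i j / sqrt (h i * h j)\<close> tends to zero as \<open>|n|\<close> tends to infinity. Eliminating the nonresonant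
  unknowns by a Neumann series leaves a system of two equations with coefficients \<open>\<alpha>\<^sub>n(z)\<close> and
  \<open>\<beta>\<^sub>n\<^sup>\<plusminus>(z)\<close>, whose determinant gives the equation \<open>(z - \<alpha>\<^sub>n(z))\<^sup>2 = \<beta>\<^sub>n\<^sup>-(z) \<beta>\<^sub>n\<^sup>+(z)\<close>.

  The same estimates show that \<open>\<alpha>\<^sub>n\<close> and \<open>\<beta>\<^sub>n\<^sup>\<plusminus>\<close> have small Lipschitz constants. On \<open>D\<^sub>n\<close> the ratios
  \<open>\<beta>\<^sub>n\<^sup>\<plusminus>(z) / \<beta>\<^sub>n\<^sup>\<plusminus>(z\<^sub>n\<^sup>*)\<close> are close to 1, so the principal square root provides analytic branches whose
  product \<open>s\<close> also has a small Lipschitz constant near the roots. Hence each of the equations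
  \<open>z - \<alpha>\<^sub>n(z) = \<plusminus> s(z)\<close> has at most one root in \<open>D\<^sub>n\<close>. Since both are solvable there, \<open>z\<^sub>n\<^sup>+\<close> and
  \<open>z\<^sub>n\<^sup>-\<close> are distinct and solve one equation each; subtracting the two equations yields the
  asymptotics of \<open>\<gamma>\<^sub>n\<close>.
\<close>

subsection \<open>Fourier coefficients on the interval from 0 to pi\<close>

text \<open>The equivalence of the eigenvalue problem with (z - \<alpha>)^2 = \<beta>^- \<beta>^+ is
  derived from the definition of the operator. This requires Fourier analysis on [0, pi], where the
  frequencies of one parity form a complete orthogonal system and the parity encodes the boundary
  condition. The obstacle in the Hill case is that v is only a distribution: V(m) is m times a
  square summable sequence, so the matrix need not be bounded, and smallness appears only after
  division by the weights. Hence every interchange of infinite sums rests on weighted row and column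
  norms.

  The parameter \<theta> that measures the smallness of the functionals is kept arbitrary: the value
  1/100 suffices to separate the roots, but the asymptotics of the gap needs errors of order
  \<theta> + \<eta>_n with \<theta> as small as desired. The order of the two eigenvalues, defined
  by real and imaginary parts, is unrelated to the principal square root; a sign depending on n, put
  into one of the branches, reconciles the two.\<close>

abbreviation leb :: "real measure" where "leb \<equiv> lebesgue_on {0..pi}"

lemma L1_iff: "L1 f \<longleftrightarrow> integrable leb f"
  unfolding L1_def set_integrable_def by (subst integrable_restrict_space) auto

lemma L2_iff: "L2 f \<longleftrightarrow> f \<in> borel_measurable leb \<and> integrable leb (\<lambda>x. (cmod (f x))\<^sup>2)"
  unfolding L2_def set_integrable_def set_borel_measurable_def
  by (subst integrable_restrict_space) (auto simp: borel_measurable_restrict_space_iff)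

lemma set_integral_eq_leb:
  fixes f :: "real \<Rightarrow> complex"
  shows "(LINT x:{0..pi}|lebesgue. f x) = (LINT x|leb. f x)"
  unfolding set_lebesgue_integral_def by (simp add: integral_restrict_space)

lemma fourier_coeff_eq:
  "fourier_coeff f m = (LINT x|leb. f x * cis (- (of_int m * x))) / pi"
  unfolding fourier_coeff_def set_integral_eq_leb
  by (simp add: cis_conv_exp mult_ac)

interpretation leb: finite_measure leb
  by (rule finite_measure_lebesgue_on) auto

lemma continuous_borel_measurable_leb:
  "continuous_on {0..pi} f \<Longrightarrow> f \<in> borel_measurable leb"
  by (rule continuous_imp_measurable_on_sets_lebesgue) auto

lemma continuous_integrable_leb:
  fixes f :: "real \<Rightarrow> complex"
  assumes "continuous_on {0..pi} f" shows "integrable leb f"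
  using absolutely_integrable_continuous_real[OF assms] L1_iff by (simp add: L1_def)

lemma integrable_mult_bounded:
  fixes f u :: "real \<Rightarrow> complex"
  assumes f: "integrable leb f" and u: "u \<in> borel_measurable leb"
    and B: "\<And>x. x \<in> {0..pi} \<Longrightarrow> cmod (u x) \<le> B"
  shows "integrable leb (\<lambda>x. f x * u x)"
proof (rule Bochner_Integration.integrable_bound)
  show "integrable leb (\<lambda>x. B * cmod (f x))" using f by simp
  show "(\<lambda>x. f x * u x) \<in> borel_measurable leb" using f u by measurable
  show "AE x in leb. cmod (f x * u x) \<le> norm (B * cmod (f x))"
  proof (rule AE_I2)
    fix x assume "x \<in> space leb"
    then have "cmod (u x) \<le> \<bar>B\<bar>" using B[of x] by auto
    then show "cmod (f x * u x) \<le> norm (B * cmod (f x))"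
      using mult_right_mono[of "cmod (u x)" "\<bar>B\<bar>" "cmod (f x)"] by (simp add: norm_mult abs_mult mult.commute)
  qed
qed

lemma continuous_on_cis_mult [continuous_intros]: "continuous_on S (\<lambda>x. cis (a * x))"
  by (intro continuous_intros)

lemma integrable_mult_cis:
  fixes f :: "real \<Rightarrow> complex"
  assumes "integrable leb f" shows "integrable leb (\<lambda>x. f x * cis (a * x))"
  by (rule integrable_mult_bounded[OF assms, where B = 1])
    (auto intro!: continuous_borel_measurable_leb continuous_intros)

section \<open>Completeness of the exponentials with even frequencies\<close>

definition annihilates :: "(real \<Rightarrow> complex) \<Rightarrow> bool" where
  "annihilates f \<longleftrightarrow> integrable leb f \<and> (\<forall>k. even k \<longrightarrow> (LINT x|leb. f x * cis (of_int k * x)) = 0)"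

lemma annihilates_cis:
  assumes "annihilates f" "even m" shows "annihilates (\<lambda>x. f x * cis (of_int m * x))"
proof -
  have "f x * cis (of_int m * x) * cis (of_int k * x) = f x * cis (of_int (m + k) * x)" for k x
    by (simp add: mult.assoc cis_mult distrib_right)
  note eq = this
  show ?thesis
    unfolding annihilates_def eq
  proof (intro conjI allI impI)
    show "integrable leb (\<lambda>x. f x * cis (of_int m * x))"
      using assms by (simp add: annihilates_def integrable_mult_cis)
    show "(LINT x|leb. f x * cis (of_int (m + k) * x)) = 0" if "even k" for k
      using assms that unfolding annihilates_def by (metis even_add)
  qed
qed

lemma annihilates_add:
  assumes "annihilates f" "annihilates g" shows "annihilates (\<lambda>x. f x + g x)"
  using assms by (auto simp: annihilates_def integrable_mult_cis distrib_right)

lemma annihilates_cmult: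
  assumes "annihilates f" shows "annihilates (\<lambda>x. c * f x)"
  using assms by (auto simp: annihilates_def mult.assoc)

text \<open>
  Multiplication by a trigonometric polynomial preserves the annihilator of all of them, so no
  normal form of trigonometric polynomials is needed.
\<close>

lemma annihilates_polynomial:
  assumes "real_polynomial_function p"
  shows "annihilates f \<Longrightarrow> annihilates (\<lambda>x. f x * of_real (p (cis (2 * x))))"
  using assms
proof (induction arbitrary: f)
  case (linear p)
  interpret bounded_linear p by fact
  have p_eq: "p w = Re w * p 1 + Im w * p \<i>" for w
  proof -
    have "w = Re w *\<^sub>R 1 + Im w *\<^sub>R \<i>" by (simp add: complex_eq_iff)
    then have "p w = p (Re w *\<^sub>R 1 + Im w *\<^sub>R \<i>)" by simp
    then show ?thesis by (simp only: add scaleR) simp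
  qed
  \<comment> \<open>\<open>Re w\<close> and \<open>Im w\<close> are combinations of \<open>w\<close>
    and \<open>cnj w\<close>, and for \<open>w = cis (2 * x)\<close> these are the exponentials of
    frequencies 2 and -2.\<close>
  have "f x * of_real (p (cis (2 * x)))
      = ((p 1 - \<i> * p \<i>) / 2) * (f x * cis (of_int 2 * x)) + ((p 1 + \<i> * p \<i>) / 2) * (f x * cis (of_int (-2) * x))"
    for x
  proof -
    have c2: "cis (of_int 2 * x) = cis (2 * x)" "cis (of_int (-2) * x) = cnj (cis (2 * x))"
      by (simp_all add: cis_cnj)
    have p2: "of_real (p (cis (2 * x)))
        = (cis (2 * x) + cnj (cis (2 * x))) / 2 * p 1 + (cis (2 * x) - cnj (cis (2 * x))) / (2 * \<i>) * p \<i>"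
      unfolding p_eq[of "cis (2 * x)"] by (simp add: complex_eq_iff)
    show ?thesis unfolding c2 p2 by (simp add: divide_simps) (simp add: algebra_simps)
  qed
  moreover have "annihilates (\<lambda>x. ((p 1 - \<i> * p \<i>) / 2) * (f x * cis (of_int 2 * x)) +
      ((p 1 + \<i> * p \<i>) / 2) * (f x * cis (of_int (-2) * x)))"
    by (intro annihilates_add annihilates_cmult annihilates_cis linear.prems) auto
  ultimately show ?case by simp
next
  case (const c)
  then show ?case using annihilates_cmult[of f c] by (simp add: mult.commute)
next
  case (add p q)
  then show ?case using annihilates_add by (simp add: distrib_left)
next
  case (mult p q)
  from mult.IH(2)[OF mult.IH(1)[OF mult.prems]] show ?case by (simp add: mult.assoc)
qed

text \<open>The map \<open>cis (2 * x)\<close> wraps [0, pi] around the unit circle, where the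
  Stone--Weierstrass theorem approximates \<Phi> uniformly by real polynomials; each of these gives
  integral 0.\<close>

lemma annihilates_continuous:
  fixes \<Phi> :: "complex \<Rightarrow> real"
  assumes f: "annihilates f" and \<Phi>: "continuous_on (sphere 0 1) \<Phi>"
  shows "(LINT x|leb. f x * of_real (\<Phi> (cis (2 * x)))) = 0"
proof -
  have fi: "integrable leb f" using f by (simp add: annihilates_def)
  have c\<Phi>: "continuous_on {0..pi} (\<lambda>x. \<Phi> (cis (2 * x)))"
    by (rule continuous_on_compose2[OF \<Phi>]) (auto intro!: continuous_intros)
  have "compact ((\<lambda>x. \<Phi> (cis (2 * x))) ` {0..pi})"
    by (rule compact_continuous_image[OF c\<Phi>]) auto
  then obtain B where B: "\<And>x. x \<in> {0..pi} \<Longrightarrow> \<bar>\<Phi> (cis (2 * x))\<bar> \<le> B"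
    using compact_imp_bounded bounded_iff by (metis imageI real_norm_def)
  have int\<Phi>: "integrable leb (\<lambda>x. f x * of_real (\<Phi> (cis (2 * x))))"
    by (rule integrable_mult_bounded[OF fi, where B = B])
      (use B c\<Phi> in \<open>auto intro!: continuous_borel_measurable_leb continuous_intros\<close>)
  define A where "A = (LINT x|leb. cmod (f x))"
  have A0: "0 \<le> A" unfolding A_def by simp
  have "cmod (LINT x|leb. f x * of_real (\<Phi> (cis (2 * x)))) \<le> e" if e: "e > 0" for e
  proof -
    \<comment> \<open>The summand 1 prevents a division by zero when f vanishes almost
      everywhere.\<close>
    have "e / (A + 1) > 0" using e A0 by simp
    from Stone_Weierstrass_real_polynomial_function[OF compact_sphere \<Phi> this]
    obtain p where p: "real_polynomial_function p"
      and le: "\<And>z. z \<in> sphere 0 1 \<Longrightarrow> \<bar>\<Phi> z - p z\<bar> < e / (A + 1)" by blast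
    have "annihilates (\<lambda>x. f x * of_real (p (cis (2 * x))))"
      by (rule annihilates_polynomial[OF p f])
    then have intp: "integrable leb (\<lambda>x. f x * of_real (p (cis (2 * x))))"
      and "(LINT x|leb. f x * of_real (p (cis (2 * x))) * cis (of_int 0 * x)) = 0"
      unfolding annihilates_def by blast+
    then have "(LINT x|leb. f x * of_real (p (cis (2 * x)))) = 0" by simp
    then have "(LINT x|leb. f x * of_real (\<Phi> (cis (2 * x))))
        = (LINT x|leb. f x * of_real (\<Phi> (cis (2 * x))) - f x * of_real (p (cis (2 * x))))"
      using int\<Phi> intp by simp
    also have "cmod \<dots> \<le> (LINT x|leb. (e / (A + 1)) * cmod (f x))"
    proof (rule Bochner_Integration.integral_norm_bound_integral)
      fix x
      have "f x * of_real (\<Phi> (cis (2 * x))) - f x * of_real (p (cis (2 * x)))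
          = f x * of_real (\<Phi> (cis (2 * x)) - p (cis (2 * x)))"
        by (simp add: right_diff_distrib)
      then have "cmod (f x * of_real (\<Phi> (cis (2 * x))) - f x * of_real (p (cis (2 * x))))
          = cmod (f x) * \<bar>\<Phi> (cis (2 * x)) - p (cis (2 * x))\<bar>"
        by (simp only: norm_mult norm_of_real)
      also have "\<dots> \<le> cmod (f x) * (e / (A + 1))"
        using le[of "cis (2 * x)"] by (intro mult_left_mono) auto
      finally show "cmod (f x * of_real (\<Phi> (cis (2 * x))) - f x * of_real (p (cis (2 * x))))
          \<le> (e / (A + 1)) * cmod (f x)" by (simp only: mult.commute)
    qed (use fi intp int\<Phi> in auto)
    also have "\<dots> = e * (A / (A + 1))" by (simp add: A_def)
    also have "\<dots> \<le> e * 1" using A0 e by (intro mult_left_mono) auto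
    finally show ?thesis by simp
  qed
  then show ?thesis using field_le_epsilon[of "cmod (LINT x|leb. f x * of_real (\<Phi> (cis (2 * x))))" 0] by simp
qed

text \<open>On [0, pi] the map \<open>cis (2 * x)\<close> identifies 0 with pi and nothing else.
  With \<open>y\<close> in the open interval this exception cannot occur, which is why the compact
  sets below are taken inside the open interval.\<close>

lemma cis_double_inj:
  assumes "x \<in> {0..pi}" "y \<in> {0<..<pi}" "cis (2 * x) = cis (2 * y)"
  shows "x = y"
proof -
  have "cis (2 * x - 2 * y) = cis (2 * x) / cis (2 * y)" by (rule cis_divide[symmetric])
  then have "cis (2 * x - 2 * y) = 1" using assms(3) by simp
  then obtain k :: int where "2 * x - 2 * y = 2 * pi * k"
    by (auto simp: complex_eq_iff cos_one_2pi_int)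
  then have k: "x - y = pi * k" by simp
  then have "\<bar>pi * of_int k\<bar> < pi * 1" using assms by auto
  then have "\<bar>real_of_int k\<bar> < 1" by (simp add: abs_mult)
  then have "k = 0" by linarith
  with k show ?thesis by simp
qed

lemma compact_in_sets_leb:
  assumes "compact C" "C \<subseteq> {0<..<pi}" shows "C \<in> sets leb"
proof -
  have "C \<in> sets lebesgue" by (rule fmeasurableD[OF lmeasurable_compact[OF assms(1)]])
  moreover have "C \<subseteq> {0..pi}" using assms(2) by force
  ultimately show ?thesis by (simp add: sets_restrict_space_iff)
qed

text \<open>The indicator of \<open>C\<close> is a pointwise limit of continuous functions of
  \<open>cis (2 * x)\<close> bounded by 1, so dominated convergence reduces the claim to
  \<open>annihilates_continuous\<close>.\<close>

lemma annihilates_compact: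
  assumes f: "annihilates f" and C: "compact C" "C \<subseteq> {0<..<pi}"
  shows "(LINT x|leb. f x * indicator C x) = 0"
proof (cases "C = {}")
  case False
  define K where "K = (\<lambda>x. cis (2 * x)) ` C"
  have fi: "integrable leb f" using f by (simp add: annihilates_def)
  have K: "compact K" "K \<noteq> {}"
    unfolding K_def using False C by (auto intro!: compact_continuous_image continuous_intros)
  have inK: "cis (2 * x) \<in> K \<longleftrightarrow> x \<in> C" if "x \<in> {0..pi}" for x
    unfolding K_def using cis_double_inj[OF that] C(2) by auto
  \<comment> \<open>Distances are measured on the circle, so that \<open>\<Phi> m\<close> is
    continuous there; it is 1 on \<open>K\<close> and, for m > 0, vanishes at distance at least
    1/m.\<close>
  define \<Phi> :: "nat \<Rightarrow> complex \<Rightarrow> real" where "\<Phi> m z = max 0 (1 - m * infdist z K)" for m z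
  have \<Phi>c: "continuous_on S (\<Phi> m)" for m S
    unfolding \<Phi>_def by (intro continuous_intros)
  have lim: "(\<lambda>m. \<Phi> m (cis (2 * x))) \<longlonglongrightarrow> indicator C x" if x: "x \<in> {0..pi}" for x
  proof (cases "x \<in> C")
    case True
    then have "infdist (cis (2 * x)) K = 0" using inK[OF x] K by (simp add: in_closed_iff_infdist_zero compact_imp_closed)
    then show ?thesis using True by (simp add: \<Phi>_def)
  next
    case False
    then have "infdist (cis (2 * x)) K \<noteq> 0"
      using inK[OF x] K in_closed_iff_infdist_zero[OF compact_imp_closed[OF K(1)] K(2)] by simp
    then have pos: "infdist (cis (2 * x)) K > 0" using infdist_nonneg[of "cis (2 * x)" K] by linarith
    obtain N :: nat where N: "1 / infdist (cis (2 * x)) K \<le> N" using real_arch_simple by blast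
    have "\<Phi> m (cis (2 * x)) = 0" if "m \<ge> N" for m
    proof -
      have "1 \<le> real N * infdist (cis (2 * x)) K" using N pos by (simp add: field_simps)
      also have "\<dots> \<le> real m * infdist (cis (2 * x)) K" using that pos by (intro mult_right_mono) auto
      finally show ?thesis by (simp add: \<Phi>_def)
    qed
    then show ?thesis using False
      by (intro tendsto_eventually) (auto simp: eventually_sequentially)
  qed
  have \<Phi>1: "\<bar>\<Phi> m z\<bar> \<le> 1" for m z using infdist_nonneg[of z K] by (auto simp: \<Phi>_def)
  have meas: "C \<in> sets leb"
    by (rule compact_in_sets_leb[OF C])
  have "(\<lambda>m. LINT x|leb. f x * of_real (\<Phi> m (cis (2 * x)))) \<longlonglongrightarrow> (LINT x|leb. f x * of_real (indicator C x))"
  proof (rule integral_dominated_convergence[where w = "\<lambda>x. cmod (f x)"])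
    show "(\<lambda>x. f x * of_real (indicator C x)) \<in> borel_measurable leb" using meas fi by measurable
    show "(\<lambda>x. f x * of_real (\<Phi> m (cis (2 * x)))) \<in> borel_measurable leb" for m
      by (intro borel_measurable_times borel_measurable_integrable[OF fi] continuous_borel_measurable_leb
          continuous_intros continuous_on_compose2[OF \<Phi>c[of UNIV]]) auto
    show "AE x in leb. (\<lambda>m. f x * of_real (\<Phi> m (cis (2 * x)))) \<longlonglongrightarrow> f x * of_real (indicator C x)"
      using lim by (intro AE_I2 tendsto_intros) auto
    show "AE x in leb. cmod (f x * of_real (\<Phi> m (cis (2 * x)))) \<le> cmod (f x)" for m
      using \<Phi>1 by (intro AE_I2) (simp add: norm_mult mult_left_le)
  qed (use fi in auto)
  moreover have "(LINT x|leb. f x * of_real (\<Phi> m (cis (2 * x)))) = 0" for m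
    by (rule annihilates_continuous[OF f \<Phi>c])
  ultimately have "(LINT x|leb. f x * of_real (indicator C x)) = 0"
    by (simp add: LIMSEQ_const_iff)
  moreover have "of_real (indicator C x) = (indicator C x :: complex)" for x by (simp add: indicator_def)
  ultimately show ?thesis by simp
qed simp

text \<open>It suffices that f has integral 0 over every measurable set. Up to a null set such a set
  is a countable union of compact subsets of the open interval, to which
  \<open>annihilates_compact\<close> applies.\<close>

lemma annihilates_imp_AE_zero:
  assumes f: "annihilates f" shows "AE x in leb. f x = 0"
proof (rule leb.density_zero)
  show fi: "integrable leb f" using f by (simp add: annihilates_def)
  fix A assume A: "A \<in> sets leb"
  then have "A \<in> sets lebesgue" "A \<subseteq> {0..pi}" by (auto simp: sets_restrict_space_iff)
  then have "A \<inter> {0<..<pi} \<in> sets lebesgue" by auto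
  then obtain S T where S: "fsigma S" and T: "T \<in> null_sets lebesgue"
    and ST: "S \<union> T = A \<inter> {0<..<pi}" and "disjnt S T"
    by (rule lebesgue_set_almost_fsigma)
  from S[unfolded fsigma_Union_compact]
  obtain F :: "nat \<Rightarrow> real set" where F1: "range F \<subseteq> Collect compact" and F2: "S = \<Union> (F ` UNIV)"
    by (elim exE conjE)
  have F: "compact (F n)" for n using subsetD[OF F1 rangeI[of F n]] by simp
  \<comment> \<open>Finite unions make the sequence of compact sets increasing, so that their
    indicators converge to that of \<open>S\<close>.\<close>
  define C where "C n = (\<Union>i\<le>n. F i)" for n
  have C: "compact (C n)" "C n \<subseteq> {0<..<pi}" for n
  proof -
    show "compact (C n)" unfolding C_def by (intro compact_UN finite_atMost ballI F)
    have "C n \<subseteq> S" unfolding C_def F2 by (rule UN_mono) auto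
    then show "C n \<subseteq> {0<..<pi}" using ST by auto
  qed
  have Csets: "C n \<in> sets leb" for n
    by (rule compact_in_sets_leb[OF C])
  have "S = (\<Union>n. C n)" unfolding F2 C_def by auto
  then have Ssets: "S \<in> sets leb" using Csets by (simp add: sets.countable_UN)
  have "(\<lambda>n. LINT x|leb. f x * indicator (C n) x) \<longlonglongrightarrow> (LINT x|leb. f x * indicator S x)"
  proof (rule integral_dominated_convergence[where w = "\<lambda>x. cmod (f x)"])
    show "(\<lambda>x. f x * indicator S x) \<in> borel_measurable leb" using fi Ssets by measurable
    show "(\<lambda>x. f x * indicator (C n) x) \<in> borel_measurable leb" for n using fi Csets by measurable
    show "AE x in leb. (\<lambda>n. f x * indicator (C n) x) \<longlonglongrightarrow> f x * indicator S x"
    proof (intro AE_I2 tendsto_intros)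
      fix x
      show "(\<lambda>n. indicator (C n) x :: complex) \<longlonglongrightarrow> indicator S x"
      proof (cases "x \<in> S")
        case True
        then obtain N where "x \<in> F N" using F2 by auto
        then have "indicator (C n) x = (1 :: complex)" if "n \<ge> N" for n
          using that by (auto simp: C_def indicator_def)
        then show ?thesis using True
          by (intro tendsto_eventually) (auto simp: eventually_sequentially)
      qed (simp add: F2 C_def)
    qed
  qed (use fi in \<open>auto simp: norm_mult indicator_def\<close>)
  moreover have "(LINT x|leb. f x * indicator (C n) x) = 0" for n
    by (rule annihilates_compact[OF f C])
  ultimately have S0: "(LINT x|leb. f x * indicator S x) = 0"
    by (simp add: LIMSEQ_const_iff)
  have "{0, pi} \<in> null_sets lebesgue"
    by (rule negligible_iff_null_sets[THEN iffD1, OF negligible_finite]) simp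
  then have "T \<union> {0, pi} \<in> null_sets lebesgue" by (rule null_sets.Un[OF T])
  then have "AE x in lebesgue. x \<notin> T \<union> {0, pi}" by (rule AE_not_in)
  have interval_sets: "{0..pi} \<inter> space lebesgue \<in> sets lebesgue" by simp
  from \<open>AE x in lebesgue. x \<notin> T \<union> {0, pi}\<close>
  have "AE x in lebesgue. x \<in> {0..pi} \<longrightarrow> x \<notin> T \<union> {0, pi}" by (rule eventually_mono) (rule impI)
  then have "AE x in leb. x \<notin> T \<union> {0, pi}"
    by (simp only: AE_restrict_space_iff[OF interval_sets])
  then have "AE x in leb. indicator A x *\<^sub>R f x = f x * indicator S x"
  proof (rule AE_mp, intro AE_I2 impI)
    fix x assume x: "x \<in> space leb" "x \<notin> T \<union> {0, pi}"
    then have "x \<in> {0<..<pi}" "x \<notin> T" by (simp_all add: less_le)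
    then have "x \<in> S \<longleftrightarrow> x \<in> A" using arg_cong[OF ST, of "\<lambda>B. x \<in> B"] by simp
    then show "indicator A x *\<^sub>R f x = f x * indicator S x" by (simp add: indicator_def)
  qed
  then have "(LINT x|leb. indicator A x *\<^sub>R f x) = (LINT x|leb. f x * indicator S x)"
  proof (rule integral_cong_AE[rotated 2])
    show "(\<lambda>x. indicator A x *\<^sub>R f x) \<in> borel_measurable leb"
      using A borel_measurable_integrable[OF fi] by measurable
    show "(\<lambda>x. f x * indicator S x) \<in> borel_measurable leb"
      using Ssets borel_measurable_integrable[OF fi] by measurable
  qed
  with S0 show "set_lebesgue_integral leb A f = 0" by (simp add: set_lebesgue_integral_def)
qed

text \<open>Multiplication by \<open>cis (- n x)\<close> shifts the frequencies of the parity of n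
  to even ones, which reduces the antiperiodic case to the periodic one.\<close>

theorem fourier_uniqueness:
  assumes f: "integrable leb f" and zero: "\<And>k. even (k - n) \<Longrightarrow> fourier_coeff f k = 0"
  shows "AE x in leb. f x = 0"
proof -
  have "annihilates (\<lambda>x. f x * cis (- of_int n * x))"
    unfolding annihilates_def
  proof (intro conjI allI impI)
    show "integrable leb (\<lambda>x. f x * cis (- of_int n * x))" by (rule integrable_mult_cis[OF f])
    fix k :: int assume "even k"
    then have "fourier_coeff f (n - k) = 0" by (intro zero) simp
    moreover have "cis (- of_int n * x) * cis (of_int k * x) = cis (- (of_int (n - k) * x))" for x
      by (simp add: cis_mult algebra_simps)
    ultimately show "(LINT x|leb. f x * cis (- of_int n * x) * cis (of_int k * x)) = 0"
      by (simp add: fourier_coeff_eq mult.assoc)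
  qed
  from annihilates_imp_AE_zero[OF this] show ?thesis by simp
qed

subsection \<open>Absolutely continuous functions\<close>

lemma LINT_eq_integral:
  fixes f :: "real \<Rightarrow> complex"
  assumes "integrable leb f" shows "(LINT x|leb. f x) = integral {0..pi} f"
  using has_integral_integral_lebesgue_on[OF assms] by (simp add: integral_unique)

lemma L1_subinterval:
  fixes g :: "real \<Rightarrow> complex"
  assumes "integrable leb g" "0 \<le> x" "x \<le> y" "y \<le> pi"
  shows "g absolutely_integrable_on {x..y}"
proof (rule set_integrable_subset)
  show "g absolutely_integrable_on {0..pi}" using assms(1) unfolding L1_iff[symmetric] L1_def .
qed (use assms in auto)

definition primitive :: "(real \<Rightarrow> complex) \<Rightarrow> real \<Rightarrow> complex" where
  "primitive g x = (LINT t:{0..x}|lebesgue. g t)"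

lemma primitive_eq_integral:
  assumes "integrable leb g" "x \<in> {0..pi}" shows "primitive g x = integral {0..x} g"
  unfolding primitive_def
  by (rule set_lebesgue_integral_eq_integral) (use L1_subinterval[OF assms(1), of 0 x] assms in auto)

lemma primitive_0 [simp]: "primitive g 0 = 0"
proof -
  have "(\<lambda>t. indicator {0::real} t *\<^sub>R g t) = (\<lambda>t. indicator {0} t *\<^sub>R g 0)"
    by (rule ext) (auto simp: indicator_def)
  then show ?thesis by (simp add: primitive_def set_lebesgue_integral_def)
qed

lemma primitive_continuous:
  assumes "integrable leb g" shows "continuous_on {0..pi} (primitive g)"
proof -
  have "continuous_on {0..pi} (\<lambda>x. integral {0..x} g)"
    using L1_subinterval[OF assms, of 0 pi]
    by (intro indefinite_integral_continuous_1 set_lebesgue_integral_eq_integral) auto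
  then show ?thesis
    by (rule continuous_on_eq) (simp add: primitive_eq_integral[OF assms])
qed

lemma primitive_diff:
  assumes g: "integrable leb g" and x: "0 \<le> x" "x \<le> y" "y \<le> pi"
  shows "primitive g y - primitive g x = integral {x..y} g"
proof -
  have "integral {0..x} g + integral {x..y} g = integral {0..y} g"
    using x L1_subinterval[OF g, of 0 y]
    by (intro Henstock_Kurzweil_Integration.integral_combine set_lebesgue_integral_eq_integral) auto
  then show ?thesis using x by (simp add: primitive_eq_integral[OF g] algebra_simps)
qed

lemma has_AC_deriv_iff:
  "has_AC_deriv y g \<longleftrightarrow> integrable leb g \<and> (\<forall>x\<in>{0..pi}. y x = y 0 + primitive g x)"
  by (simp add: has_AC_deriv_def L1_iff primitive_def)

lemma AC_continuous:
  assumes "has_AC_deriv y g" shows "continuous_on {0..pi} y"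
proof -
  have "continuous_on {0..pi} (\<lambda>x. y 0 + primitive g x)"
    using assms unfolding has_AC_deriv_iff by (intro continuous_intros primitive_continuous) (elim conjE)
  moreover have "y 0 + primitive g x = y x" if "x \<in> {0..pi}" for x
    using assms that unfolding has_AC_deriv_iff by metis
  ultimately show ?thesis by (rule continuous_on_eq)
qed

text \<open>
  Integration by parts for a merely integrable \<open>g\<close>: the difference of both sides over \<open>[x, y]\<close> is
  at most \<open>2 |a| (y - x) \<integral> |g|\<close>, hence has derivative zero everywhere.
\<close>

lemma integral_by_parts_cis:
  assumes g: "integrable leb g"
  shows "(LINT x|leb. g x * cis (a * x))
    = primitive g pi * cis (a * pi) - \<i> * a * (LINT x|leb. primitive g x * cis (a * x))"
proof -
  define \<phi> where "\<phi> x = cis (a * x)" for x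
  define \<phi>' where "\<phi>' x = \<i> * a * cis (a * x)" for x
  let ?G = "primitive g"
  define N where "N x = integral {0..x} (\<lambda>t. cmod (g t))" for x
  have d\<phi>: "(\<phi> has_vector_derivative \<phi>' x) (at x within S)" for x S
    unfolding \<phi>_def \<phi>'_def has_vector_derivative_def
    by (rule has_derivative_eq_rhs, rule derivative_eq_intros refl | simp)+
      (auto simp: scaleR_conv_of_real algebra_simps)
  have \<phi>c: "continuous_on S \<phi>" "continuous_on S \<phi>'" for S
    unfolding \<phi>_def \<phi>'_def by (intro continuous_intros)+
  have \<phi>'_le: "cmod (\<phi>' x) \<le> \<bar>a\<bar>" for x by (simp add: \<phi>'_def norm_mult)
  have \<phi>_int: "integral {x..y} \<phi>' = \<phi> y - \<phi> x" if "x \<le> y" for x y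
    using fundamental_theorem_of_calculus[OF that d\<phi>] by (simp add: integral_unique)
  have \<phi>_le: "cmod (\<phi> y - \<phi> x) \<le> \<bar>a\<bar> * (y - x)" if "x \<le> y" for x y
  proof -
    have "cmod (integral {x..y} \<phi>') \<le> integral {x..y} (\<lambda>_. \<bar>a\<bar>)"
      by (rule Henstock_Kurzweil_Integration.integral_norm_bound_integral)
        (auto intro!: integrable_continuous_interval \<phi>c \<phi>'_le)
    then show ?thesis using that by (simp add: \<phi>_int mult.commute)
  qed
  have Gc: "continuous_on {0..pi} ?G" by (rule primitive_continuous[OF g])
  have gi: "integrable leb (\<lambda>x. g x * \<phi> x)" unfolding \<phi>_def by (rule integrable_mult_cis[OF g])
  have Gi: "integrable leb (\<lambda>x. ?G x * \<phi>' x)"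
    by (intro continuous_integrable_leb continuous_intros Gc \<phi>c)
  have on: "f integrable_on {x..y}"
    if "integrable leb f" "0 \<le> x" "x \<le> y" "y \<le> pi" for f :: "real \<Rightarrow> complex" and x y
    by (rule set_lebesgue_integral_eq_integral[OF L1_subinterval[OF that]])
  have onn: "(\<lambda>t. cmod (g t)) integrable_on {x..y}" if "0 \<le> x" "x \<le> y" "y \<le> pi" for x y
    using L1_subinterval[OF g that] absolutely_integrable_on_def by blast
  have N_diff: "N y - N x = integral {x..y} (\<lambda>t. cmod (g t))" if "0 \<le> x" "x \<le> y" "y \<le> pi" for x y
    using Henstock_Kurzweil_Integration.integral_combine[OF that(1,2) onn[of 0 y]] that
    by (simp add: N_def algebra_simps)
  have G_le: "cmod (?G y - ?G x) \<le> N y - N x" if "0 \<le> x" "x \<le> y" "y \<le> pi" for x y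
    unfolding primitive_diff[OF g that] N_diff[OF that]
    by (rule Henstock_Kurzweil_Integration.integral_norm_bound_integral) (use on[OF g that] onn[OF that] in auto)
  have N_mono: "N x \<le> N y" if "0 \<le> x" "x \<le> y" "y \<le> pi" for x y
    using G_le[OF that] norm_ge_zero[of "?G y - ?G x"] by linarith
  \<comment> \<open>The defect of the formula as a function of the upper limit: it vanishes at 0,
    and \<open>D pi = 0\<close> is the claim.\<close>
  define D where "D x = primitive (\<lambda>x. g x * \<phi> x) x - ?G x * \<phi> x + primitive (\<lambda>x. ?G x * \<phi>' x) x" for x
  have D_le: "cmod (D y - D x) \<le> 2 * \<bar>a\<bar> * (y - x) * (N y - N x)" if xy: "0 \<le> x" "x \<le> y" "y \<le> pi" for x y
  proof -
    \<comment> \<open>Subtracting \<open>\<phi> y\<close> and \<open>?G x\<close> inside the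
      integrals makes both integrands small, and the correction terms add up exactly to the boundary
      terms of \<open>D y - D x\<close>.\<close>
    have "integral {x..y} (\<lambda>t. g t * (\<phi> t - \<phi> y))
        = integral {x..y} (\<lambda>t. g t * \<phi> t) - integral {x..y} (\<lambda>t. g t * \<phi> y)"
      unfolding right_diff_distrib
      by (intro Henstock_Kurzweil_Integration.integral_diff integrable_on_mult_left on gi g xy)
    then have E1: "integral {x..y} (\<lambda>t. g t * (\<phi> t - \<phi> y))
        = integral {x..y} (\<lambda>t. g t * \<phi> t) - (?G y - ?G x) * \<phi> y"
      by (simp add: primitive_diff[OF g xy])
    have "integral {x..y} (\<lambda>t. (?G t - ?G x) * \<phi>' t)
        = integral {x..y} (\<lambda>t. ?G t * \<phi>' t) - integral {x..y} (\<lambda>t. ?G x * \<phi>' t)"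
      unfolding left_diff_distrib
      by (rule Henstock_Kurzweil_Integration.integral_diff)
        (use on[OF Gi xy] in \<open>auto intro!: integrable_continuous_interval continuous_intros \<phi>c\<close>)
    then have E2: "integral {x..y} (\<lambda>t. (?G t - ?G x) * \<phi>' t)
        = integral {x..y} (\<lambda>t. ?G t * \<phi>' t) - ?G x * (\<phi> y - \<phi> x)"
      using xy by (simp add: \<phi>_int)
    have eq: "D y - D x = integral {x..y} (\<lambda>t. g t * (\<phi> t - \<phi> y)) + integral {x..y} (\<lambda>t. (?G t - ?G x) * \<phi>' t)"
      unfolding E1 E2 primitive_diff[OF gi xy, symmetric] primitive_diff[OF Gi xy, symmetric] D_def
      by (simp add: algebra_simps)
    have b1: "cmod (integral {x..y} (\<lambda>t. g t * (\<phi> t - \<phi> y)))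
        \<le> integral {x..y} (\<lambda>t. \<bar>a\<bar> * (y - x) * cmod (g t))"
    proof (rule Henstock_Kurzweil_Integration.integral_norm_bound_integral)
      show "(\<lambda>t. g t * (\<phi> t - \<phi> y)) integrable_on {x..y}"
        unfolding right_diff_distrib
        by (intro integrable_diff integrable_on_mult_left on gi g xy)
      show "(\<lambda>t. \<bar>a\<bar> * (y - x) * cmod (g t)) integrable_on {x..y}"
        by (intro integrable_on_mult_right onn xy)
      fix t assume t: "t \<in> {x..y}"
      have "cmod (\<phi> t - \<phi> y) \<le> \<bar>a\<bar> * (y - t)"
        using \<phi>_le[of t y] t by (simp add: norm_minus_commute)
      also have "\<dots> \<le> \<bar>a\<bar> * (y - x)" using t by (intro mult_left_mono) auto
      finally show "cmod (g t * (\<phi> t - \<phi> y)) \<le> \<bar>a\<bar> * (y - x) * cmod (g t)"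
        unfolding norm_mult by (subst mult.commute) (rule mult_right_mono, auto)
    qed
    have b2: "cmod (integral {x..y} (\<lambda>t. (?G t - ?G x) * \<phi>' t))
        \<le> integral {x..y} (\<lambda>t. (N y - N x) * \<bar>a\<bar>)"
    proof (rule Henstock_Kurzweil_Integration.integral_norm_bound_integral)
      show "(\<lambda>t. (?G t - ?G x) * \<phi>' t) integrable_on {x..y}"
        by (intro integrable_continuous_interval continuous_intros \<phi>c continuous_on_subset[OF Gc])
          (use xy in auto)
      fix t assume t: "t \<in> {x..y}"
      have "cmod (?G t - ?G x) \<le> N y - N x"
        using G_le[of x t] N_mono[of t y] t xy by auto
      then show "cmod ((?G t - ?G x) * \<phi>' t) \<le> (N y - N x) * \<bar>a\<bar>"
        unfolding norm_mult using \<phi>'_le N_mono[OF xy] by (intro mult_mono) auto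
    qed auto
    have "cmod (D y - D x) \<le> \<bar>a\<bar> * (y - x) * (N y - N x) + (y - x) * ((N y - N x) * \<bar>a\<bar>)"
      unfolding eq using b1 b2 xy by (intro norm_triangle_le add_mono) (simp_all add: N_diff mult_ac)
    then show ?thesis by (simp add: algebra_simps)
  qed
  have Nc: "continuous_on {0..pi} N"
    unfolding N_def by (rule indefinite_integral_continuous_1) (use onn[of 0 pi] in auto)
  have "(D has_derivative (\<lambda>h. 0)) (at x within {0..pi})" if x: "x \<in> {0..pi}" for x
    unfolding has_derivative_within_alt
  proof (intro conjI allI impI)
    fix e :: real assume e: "0 < e"
    have "e / (2 * \<bar>a\<bar> + 1) > 0" using e by (intro divide_pos_pos) auto
    then obtain d where d: "d > 0"
      "\<And>y. y \<in> {0..pi} \<Longrightarrow> dist y x < d \<Longrightarrow> dist (N y) (N x) < e / (2 * \<bar>a\<bar> + 1)"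
      using Nc x unfolding continuous_on_iff by meson
    show "\<exists>d>0. \<forall>y\<in>{0..pi}. norm (y - x) < d \<longrightarrow> norm (D y - D x - 0) \<le> e * norm (y - x)"
    proof (intro exI conjI ballI impI)
      fix y assume y: "y \<in> {0..pi}" "norm (y - x) < d"
      then have N: "\<bar>N y - N x\<bar> \<le> e / (2 * \<bar>a\<bar> + 1)"
        using d(2)[of y] by (auto simp: dist_real_def)
      have "cmod (D y - D x) \<le> 2 * \<bar>a\<bar> * \<bar>y - x\<bar> * \<bar>N y - N x\<bar>"
        using D_le[of x y] D_le[of y x] N_mono[of x y] N_mono[of y x] x y
        by (cases "x \<le> y") (auto simp: norm_minus_commute abs_real_def)
      also have "\<dots> \<le> (2 * \<bar>a\<bar> + 1) * \<bar>y - x\<bar> * (e / (2 * \<bar>a\<bar> + 1))"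
        by (intro mult_mono N) auto
      also have "\<dots> = e * \<bar>y - x\<bar>" by (simp add: field_simps)
      finally show "norm (D y - D x - 0) \<le> e * norm (y - x)" by simp
    qed (rule d(1))
  qed simp
  then obtain C where "\<And>x. x \<in> {0..pi} \<Longrightarrow> D x = C"
    using has_derivative_zero_constant[of "{0..pi}" D] by auto
  then have "D pi = D 0" by simp
  then have "primitive (\<lambda>x. g x * \<phi> x) pi - ?G pi * \<phi> pi + primitive (\<lambda>x. ?G x * \<phi>' x) pi = 0"
    by (simp add: D_def)
  moreover have "primitive f pi = (LINT x|leb. f x)" if "integrable leb f" for f
    using that by (simp add: primitive_eq_integral LINT_eq_integral)
  ultimately have "(LINT x|leb. g x * \<phi> x) = ?G pi * \<phi> pi - (LINT x|leb. ?G x * \<phi>' x)"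
    using gi Gi by (simp add: algebra_simps)
  moreover have "(LINT x|leb. ?G x * \<phi>' x) = \<i> * a * (LINT x|leb. ?G x * \<phi> x)"
    by (simp add: \<phi>'_def \<phi>_def mult_ac flip: integral_mult_right_zero)
  ultimately show ?thesis by (simp add: \<phi>_def)
qed

section \<open>Boundary conditions and Fourier coefficients of derivatives\<close>

lemma cis_2pi_int: "cis (2 * pi * of_int m) = 1"
  unfolding complex_eq_iff using cos_int_2pin[of m] sin_int_2pin[of m] by simp

lemma cis_parity:
  assumes "even (k - n)" shows "cis (- of_int k * pi) = bc_sign (bc_of n)"
proof (cases "even n")
  case True
  with assms have "even k" by simp
  then obtain m where "k = 2 * m" by (auto elim!: evenE)
  then have "- of_int k * pi = 2 * pi * of_int (- m)" by simp
  then show ?thesis using True by (simp only: cis_2pi_int) (simp add: bc_of_def)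
next
  case False
  with assms have "odd k" by simp
  then obtain m where "k = 2 * m + 1" by (auto elim!: oddE)
  then have "- of_int k * pi = - pi + 2 * pi * of_int (- m)" by (simp add: algebra_simps)
  then have "cis (- of_int k * pi) = cis (- pi)" by (simp only: cis_mult[symmetric] cis_2pi_int mult_1_right)
  then show ?thesis using False by (simp add: bc_of_def complex_eq_iff)
qed

lemma bc_sign_square [simp]: "bc_sign b * bc_sign b = 1"
  by (cases b) auto

text \<open>The boundary term of the integration by parts is
  \<open>cis (- k pi) * y pi - y 0\<close>. For k of the parity of n the exponential equals the sign
  in the boundary condition, and this sign squares to 1. As \<open>integral_by_parts_cis\<close>
  concerns primitives vanishing at 0, the constant \<open>y 0\<close> is treated separately.\<close>

lemma AC_fourier_coeff:
  assumes y: "has_AC_deriv y g" and bc: "y pi = bc_sign (bc_of n) * y 0" and k: "even (k - n)"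
  shows "fourier_coeff g k = \<i> * of_int k * fourier_coeff y k"
proof -
  have g: "integrable leb g" and yx: "\<And>x. x \<in> {0..pi} \<Longrightarrow> y x = y 0 + primitive g x"
    using y unfolding has_AC_deriv_iff by blast+
  let ?s = "bc_sign (bc_of n)"
  let ?c = "\<lambda>x. cis (- of_int k * x)"
  have Gi: "integrable leb (\<lambda>x. primitive g x * ?c x)"
    by (intro integrable_mult_cis continuous_integrable_leb primitive_continuous g)
  have ci: "integrable leb (\<lambda>x. c * ?c x)" for c
    by (intro continuous_integrable_leb continuous_intros)
  have "((\<lambda>x. (\<i> * of_int k) * ?c x) has_integral (- ?c pi - (- ?c 0))) {0..pi}"
    by (rule fundamental_theorem_of_calculus)
      (auto simp: has_vector_derivative_def scaleR_conv_of_real intro!: derivative_eq_intros)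
  then have "integral {0..pi} (\<lambda>x. (\<i> * of_int k) * ?c x) = - ?c pi - (- ?c 0)"
    by (rule integral_unique)
  moreover have "(\<i> * of_int k) * (LINT x|leb. ?c x) = (LINT x|leb. (\<i> * of_int k) * ?c x)"
    by (rule integral_mult_right_zero[symmetric])
  ultimately have "(\<i> * of_int k) * (LINT x|leb. ?c x) = - ?c pi - (- ?c 0)"
    using LINT_eq_integral[OF ci[of "\<i> * of_int k"]] by (rule trans[OF trans, rotated -1])
  then have I: "(\<i> * of_int k) * (LINT x|leb. ?c x) = 1 - ?s"
    by (simp only: cis_parity[OF k] mult_zero_right cis_zero) simp
  have "(LINT x|leb. y x * ?c x) = (LINT x|leb. y 0 * ?c x + primitive g x * ?c x)"
    by (intro Bochner_Integration.integral_cong refl, subst yx) (simp_all add: distrib_right)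
  also have "\<dots> = y 0 * (LINT x|leb. ?c x) + (LINT x|leb. primitive g x * ?c x)"
    using Gi ci by (subst Bochner_Integration.integral_add) auto
  finally have "(\<i> * of_int k) * (LINT x|leb. y x * ?c x)
      = y 0 * ((\<i> * of_int k) * (LINT x|leb. ?c x)) + (\<i> * of_int k) * (LINT x|leb. primitive g x * ?c x)"
    by (simp add: algebra_simps)
  also have "(\<i> * of_int k) * (LINT x|leb. primitive g x * ?c x) = (LINT x|leb. g x * ?c x) - primitive g pi * ?s"
    using integral_by_parts_cis[OF g, of "- of_int k"] cis_parity[OF k] by simp
  also have "primitive g pi = (?s - 1) * y 0"
    using yx[of pi] bc by (simp add: algebra_simps)
  also have "y 0 * ((\<i> * of_int k) * (LINT x|leb. ?c x)) + ((LINT x|leb. g x * ?c x) - (?s - 1) * y 0 * ?s)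
      = (LINT x|leb. g x * ?c x) + y 0 * (1 - ?s * ?s)"
    unfolding I by (simp add: algebra_simps)
  finally show ?thesis by (simp add: fourier_coeff_eq)
qed

text \<open>The converse of \<open>AC_fourier_coeff\<close>: it recovers regularity and the boundary
  condition from relations between coefficients. A primitive of f has the coefficients of g except
  possibly at k = 0, and after adjusting the constant \<open>fourier_uniqueness\<close> identifies
  the two functions.\<close>

theorem weak_derivative:
  assumes f: "integrable leb f" and g: "integrable leb g"
    and fg: "\<And>k. even (k - n) \<Longrightarrow> fourier_coeff f k = \<i> * of_int k * fourier_coeff g k"
  obtains u where "has_AC_deriv u f" "u pi = bc_sign (bc_of n) * u 0" "AE x in leb. u x = g x"
proof -
  \<comment> \<open>For even n the hypothesis at k = 0 says that f has mean 0, so every primitive is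
    periodic; the constant is free and is used to match the mean of g. For odd n the boundary
    condition determines the constant.\<close>
  define c where "c = (if even n then fourier_coeff g 0 - fourier_coeff (primitive f) 0 else - primitive f pi / 2)"
  define u where "u x = primitive f x + c" for x
  have u: "has_AC_deriv u f" using f by (simp add: has_AC_deriv_iff u_def)
  have bc: "u pi = bc_sign (bc_of n) * u 0"
  proof (cases "even n")
    case True
    have "fourier_coeff f 0 = 0" using fg[of 0] True by simp
    then have "(LINT x|leb. f x) = 0" by (simp add: fourier_coeff_eq)
    then have "primitive f pi = 0" using f by (simp add: primitive_eq_integral LINT_eq_integral)
    then show ?thesis using True by (simp add: u_def bc_of_def)
  qed (simp add: u_def c_def bc_of_def)
  have ui: "integrable leb u" by (rule continuous_integrable_leb[OF AC_continuous[OF u]])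
  have pi': "integrable leb (\<lambda>x. primitive f x * cis (- (of_int k * x)))" for k :: int
    using integrable_mult_cis[OF continuous_integrable_leb[OF primitive_continuous[OF f]], of "- of_int k"] by simp
  have "fourier_coeff (\<lambda>x. u x - g x) k = 0" if k: "even (k - n)" for k
  proof -
    have diff: "fourier_coeff (\<lambda>x. u x - g x) k = fourier_coeff u k - fourier_coeff g k"
      using integrable_mult_cis[OF ui, of "- of_int k"] integrable_mult_cis[OF g, of "- of_int k"]
      by (simp add: fourier_coeff_eq left_diff_distrib diff_divide_distrib)
    show ?thesis
    proof (cases "k = 0")
      case False
      then show ?thesis using AC_fourier_coeff[OF u bc k] fg[OF k] diff by simp
    next
      case True
      then have "even n" using k by simp
      then have "c = fourier_coeff g 0 - fourier_coeff (primitive f) 0" by (simp add: c_def)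
      moreover have "fourier_coeff u 0 = fourier_coeff (primitive f) 0 + c"
        using pi'[of 0] by (simp add: fourier_coeff_eq u_def add_divide_distrib measure_restrict_space
            scaleR_conv_of_real)
      ultimately show ?thesis using diff True by simp
    qed
  qed
  then have "AE x in leb. u x - g x = 0" using ui g by (intro fourier_uniqueness) auto
  then have "AE x in leb. u x = g x" by simp
  with u bc show ?thesis by (rule that)
qed

subsection \<open>Square integrable functions and their Fourier series\<close>

lemma L2_measurable: "L2 f \<Longrightarrow> f \<in> borel_measurable leb"
  and L2_square_integrable: "L2 f \<Longrightarrow> integrable leb (\<lambda>x. (cmod (f x))\<^sup>2)"
  by (auto simp: L2_iff)

lemma L2_product_integrable:
  assumes "L2 f" "L2 g" shows "integrable leb (\<lambda>x. f x * g x)"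
proof (rule Bochner_Integration.integrable_bound)
  show "integrable leb (\<lambda>x. (cmod (f x))\<^sup>2 + (cmod (g x))\<^sup>2)"
    using assms by (intro Bochner_Integration.integrable_add L2_square_integrable)
  show "(\<lambda>x. f x * g x) \<in> borel_measurable leb"
    using assms by (intro borel_measurable_times L2_measurable)
  show "AE x in leb. cmod (f x * g x) \<le> norm ((cmod (f x))\<^sup>2 + (cmod (g x))\<^sup>2)"
  proof (rule AE_I2)
    fix x
    have "2 * (cmod (f x) * cmod (g x)) \<le> (cmod (f x))\<^sup>2 + (cmod (g x))\<^sup>2"
      using sum_squares_bound[of "cmod (f x)" "cmod (g x)"] by (simp add: mult.assoc)
    moreover have "0 \<le> cmod (f x) * cmod (g x)" by simp
    ultimately show "cmod (f x * g x) \<le> norm ((cmod (f x))\<^sup>2 + (cmod (g x))\<^sup>2)"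
      unfolding norm_mult real_norm_def by linarith
  qed
qed

lemma L2_bounded:
  fixes f :: "real \<Rightarrow> complex"
  assumes "f \<in> borel_measurable leb" and "\<And>x. x \<in> {0..pi} \<Longrightarrow> cmod (f x) \<le> B"
  shows "L2 f"
  unfolding L2_iff
proof (intro conjI assms)
  show "integrable leb (\<lambda>x. (cmod (f x))\<^sup>2)"
  proof (rule Bochner_Integration.integrable_bound[where f = "\<lambda>_. B\<^sup>2"])
    show "AE x in leb. norm ((cmod (f x))\<^sup>2) \<le> norm (B\<^sup>2)"
      using assms(2) by (intro AE_I2) (auto intro!: power_mono)
  qed (use assms(1) in measurable)
qed

lemma L2_continuous: "continuous_on {0..pi} f \<Longrightarrow> L2 f"
proof -
  assume c: "continuous_on {0..pi} f"
  have "compact (f ` {0..pi})" by (rule compact_continuous_image[OF c]) simp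
  then obtain B where "\<forall>z\<in>f ` {0..pi}. cmod z \<le> B"
    using compact_imp_bounded bounded_iff by metis
  then show "L2 f" by (intro L2_bounded[where B = B] continuous_borel_measurable_leb c) auto
qed

lemma L2_integrable: "L2 f \<Longrightarrow> integrable leb f"
  using L2_product_integrable[of f "\<lambda>_. 1"] L2_continuous[of "\<lambda>_. 1"] by simp

lemma L2_add: assumes "L2 f" "L2 g" shows "L2 (\<lambda>x. f x + g x)"
  unfolding L2_iff
proof
  show m: "(\<lambda>x. f x + g x) \<in> borel_measurable leb"
    using assms by (intro borel_measurable_add L2_measurable)
  show "integrable leb (\<lambda>x. (cmod (f x + g x))\<^sup>2)"
  proof (rule Bochner_Integration.integrable_bound)
    show "integrable leb (\<lambda>x. 2 * (cmod (f x))\<^sup>2 + 2 * (cmod (g x))\<^sup>2)"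
      using assms by (intro Bochner_Integration.integrable_add integrable_mult_right L2_square_integrable)
    show "AE x in leb. norm ((cmod (f x + g x))\<^sup>2) \<le> norm (2 * (cmod (f x))\<^sup>2 + 2 * (cmod (g x))\<^sup>2)"
    proof (rule AE_I2)
      fix x
      have "(cmod (f x + g x))\<^sup>2 \<le> (cmod (f x) + cmod (g x))\<^sup>2"
        by (intro power_mono norm_triangle_ineq) auto
      also have "\<dots> \<le> 2 * (cmod (f x))\<^sup>2 + 2 * (cmod (g x))\<^sup>2"
        using sum_squares_bound[of "cmod (f x)" "cmod (g x)"] by (simp add: power2_sum)
      finally show "norm ((cmod (f x + g x))\<^sup>2) \<le> norm (2 * (cmod (f x))\<^sup>2 + 2 * (cmod (g x))\<^sup>2)"
        by simp
    qed
  qed (use m in measurable)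
qed

lemma L2_mult_bounded:
  assumes f: "L2 f" and u: "u \<in> borel_measurable leb" "\<And>x. x \<in> {0..pi} \<Longrightarrow> cmod (u x) \<le> B"
  shows "L2 (\<lambda>x. f x * u x)"
  unfolding L2_iff
proof
  show m: "(\<lambda>x. f x * u x) \<in> borel_measurable leb"
    by (intro borel_measurable_times L2_measurable f u)
  show "integrable leb (\<lambda>x. (cmod (f x * u x))\<^sup>2)"
  proof (rule Bochner_Integration.integrable_bound)
    show "integrable leb (\<lambda>x. B\<^sup>2 * (cmod (f x))\<^sup>2)"
      using f by (intro integrable_mult_right L2_square_integrable)
    show "AE x in leb. norm ((cmod (f x * u x))\<^sup>2) \<le> norm (B\<^sup>2 * (cmod (f x))\<^sup>2)"
    proof (rule AE_I2)
      fix x assume "x \<in> space leb"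
      then have "(cmod (u x))\<^sup>2 \<le> B\<^sup>2" using u(2)[of x] by (intro power_mono) auto
      then show "norm ((cmod (f x * u x))\<^sup>2) \<le> norm (B\<^sup>2 * (cmod (f x))\<^sup>2)"
        using mult_left_mono[of "(cmod (u x))\<^sup>2" "B\<^sup>2" "(cmod (f x))\<^sup>2"]
        by (simp add: norm_mult power_mult_distrib mult.commute)
    qed
  qed (use m in measurable)
qed

lemma L2_mult_continuous:
  assumes "L2 f" "continuous_on {0..pi} u" shows "L2 (\<lambda>x. f x * u x)"
proof -
  have "compact (u ` {0..pi})" by (rule compact_continuous_image[OF assms(2)]) simp
  then obtain B where "\<forall>z\<in>u ` {0..pi}. cmod z \<le> B"
    using compact_imp_bounded bounded_iff by metis
  then show ?thesis
    by (intro L2_mult_bounded[where B = B] continuous_borel_measurable_leb assms) auto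
qed

lemma L2_cmult: "L2 f \<Longrightarrow> L2 (\<lambda>x. c * f x)"
  using L2_mult_continuous[of f "\<lambda>_. c"] by (simp add: mult.commute)

lemma L2_diff: "L2 f \<Longrightarrow> L2 g \<Longrightarrow> L2 (\<lambda>x. f x - g x)"
  using L2_add[of f "\<lambda>x. -1 * g x"] L2_cmult[of g "-1"] by simp

section \<open>Trigonometric polynomials and Bessel's inequality\<close>

definition trig :: "(int \<Rightarrow> complex) \<Rightarrow> int set \<Rightarrow> real \<Rightarrow> complex" where
  "trig a F x = (\<Sum>k\<in>F. a k * cis (of_int k * x))"

abbreviation parity_class :: "int \<Rightarrow> int set" where
  "parity_class n \<equiv> {j. even (j - n)}"

lemma trig_continuous: "continuous_on S (trig a F)"
  unfolding trig_def by (intro continuous_intros)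

lemma L2_trig: "L2 (trig a F)"
  by (rule L2_continuous[OF trig_continuous])

text \<open>Orthogonality of the exponentials, obtained from \<open>AC_fourier_coeff\<close>: the
  derivative of a constant is 0, so k times its k-th coefficient vanishes.\<close>

lemma fourier_coeff_const:
  assumes "even k" shows "fourier_coeff (\<lambda>_. c) k = (if k = 0 then c else 0)"
proof (cases "k = 0")
  case True
  then show ?thesis by (simp add: fourier_coeff_eq measure_restrict_space scaleR_conv_of_real)
next
  case False
  have "has_AC_deriv (\<lambda>_. c) (\<lambda>_. 0)" by (simp add: has_AC_deriv_iff primitive_def set_lebesgue_integral_def)
  from AC_fourier_coeff[OF this, of 0 k] show ?thesis
    using assms False by (simp add: bc_of_def fourier_coeff_eq)
qed

lemma fourier_coeff_trig:
  assumes F: "finite F" "F \<subseteq> parity_class n" and k: "even (k - n)"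
  shows "fourier_coeff (trig a F) k = (if k \<in> F then a k else 0)"
proof -
  have "fourier_coeff (trig a F) k = (LINT x|leb. (\<Sum>l\<in>F. a l * cis (- (of_int (k - l) * x)))) / pi"
    by (simp add: fourier_coeff_eq trig_def sum_distrib_right mult.assoc cis_mult left_diff_distrib)
  also have "\<dots> = (\<Sum>l\<in>F. fourier_coeff (\<lambda>_. a l) (k - l))"
  proof (subst Bochner_Integration.integral_sum)
    fix l
    show "integrable leb (\<lambda>x. a l * cis (- (of_int (k - l) * x)))"
      by (intro continuous_integrable_leb continuous_intros)
  qed (simp add: fourier_coeff_eq sum_divide_distrib)
  also have "\<dots> = (\<Sum>l\<in>F. if l = k then a k else 0)"
  proof (rule sum.cong)
    fix l assume "l \<in> F"
    then have "even (l - n)" using F by auto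
    then have "even (k - l)" using k by simp
    then show "fourier_coeff (\<lambda>_. a l) (k - l) = (if l = k then a k else 0)"
      by (simp add: fourier_coeff_const)
  qed simp
  finally show ?thesis using F by simp
qed

lemma trig_inner:
  assumes f: "integrable leb f" and F: "finite F"
  shows "(LINT x|leb. f x * cnj (trig a F x)) = pi * (\<Sum>k\<in>F. fourier_coeff f k * cnj (a k))"
proof -
  have "(LINT x|leb. f x * cnj (trig a F x)) = (LINT x|leb. (\<Sum>k\<in>F. cnj (a k) * (f x * cis (- of_int k * x))))"
    by (simp add: trig_def sum_distrib_left cis_cnj mult_ac)
  also have "\<dots> = (\<Sum>k\<in>F. cnj (a k) * (LINT x|leb. f x * cis (- of_int k * x)))"
    by (subst Bochner_Integration.integral_sum)
      (intro integrable_mult_right integrable_mult_cis f, simp)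
  finally show ?thesis by (simp add: fourier_coeff_eq sum_distrib_left mult_ac)
qed

lemma trig_norm:
  assumes "finite F" "F \<subseteq> parity_class n"
  shows "(LINT x|leb. (cmod (trig a F x))\<^sup>2) = pi * (\<Sum>k\<in>F. (cmod (a k))\<^sup>2)"
proof -
  have "complex_of_real (LINT x|leb. (cmod (trig a F x))\<^sup>2) = (LINT x|leb. trig a F x * cnj (trig a F x))"
    by (simp only: complex_norm_square[symmetric] integral_complex_of_real)
  also have "\<dots> = pi * (\<Sum>k\<in>F. fourier_coeff (trig a F) k * cnj (a k))"
    by (rule trig_inner) (use assms L2_trig L2_integrable in auto)
  also have "\<dots> = pi * (\<Sum>k\<in>F. a k * cnj (a k))"
    using assms by (intro arg_cong2[where f = "(*)"] sum.cong refl)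
      (auto simp: fourier_coeff_trig[OF assms])
  also have "\<dots> = complex_of_real (pi * (\<Sum>k\<in>F. (cmod (a k))\<^sup>2))"
    by (simp only: complex_norm_square[symmetric] of_real_sum of_real_mult)
  finally show ?thesis by (simp only: of_real_eq_iff)
qed

lemma norm_diff_trig:
  assumes f: "L2 f" and F: "finite F" "F \<subseteq> parity_class n"
  shows "(LINT x|leb. (cmod (f x - trig a F x))\<^sup>2) = (LINT x|leb. (cmod (f x))\<^sup>2)
    + pi * (\<Sum>k\<in>F. (cmod (a k))\<^sup>2) - 2 * pi * Re (\<Sum>k\<in>F. fourier_coeff f k * cnj (a k))"
proof -
  define R where "R x = Re (f x * cnj (trig a F x))" for x
  have eq: "(cmod (f x - trig a F x))\<^sup>2 = (cmod (f x))\<^sup>2 + (cmod (trig a F x))\<^sup>2 - 2 * R x" for x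
    unfolding R_def by (simp only: cmod_power2) (simp add: power2_eq_square algebra_simps)
  have i: "integrable leb (\<lambda>x. f x * cnj (trig a F x))"
    using trig_continuous[of _ a F] by (intro L2_integrable L2_mult_continuous f continuous_intros)
  then have "integrable leb R" unfolding R_def by (rule integrable_Re)
  then have "(LINT x|leb. (cmod (f x - trig a F x))\<^sup>2)
      = (LINT x|leb. (cmod (f x))\<^sup>2) + (LINT x|leb. (cmod (trig a F x))\<^sup>2) - 2 * (LINT x|leb. R x)"
    unfolding eq using L2_square_integrable[OF f] L2_square_integrable[OF L2_trig[of a F]] by simp
  also have "(LINT x|leb. R x) = Re (LINT x|leb. f x * cnj (trig a F x))"
    unfolding R_def by (rule integral_Re[OF i])
  finally show ?thesis using trig_norm[OF F, of a] trig_inner[OF L2_integrable[OF f] F(1), of a] by simp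
qed

lemma Bessel:
  assumes f: "L2 f"
  shows "(\<lambda>k. (cmod (fourier_coeff f k))\<^sup>2) summable_on parity_class n"
proof (rule nonneg_bdd_above_summable_on)
  show "bdd_above (sum (\<lambda>k. (cmod (fourier_coeff f k))\<^sup>2) ` {F. F \<subseteq> parity_class n \<and> finite F})"
  proof (rule bdd_aboveI2)
    fix F assume F: "F \<in> {F. F \<subseteq> parity_class n \<and> finite F}"
    let ?S = "\<Sum>k\<in>F. (cmod (fourier_coeff f k))\<^sup>2"
    have "complex_of_real ?S = (\<Sum>k\<in>F. fourier_coeff f k * cnj (fourier_coeff f k))"
      by (simp only: complex_norm_square[symmetric] of_real_sum)
    then have "Re (\<Sum>k\<in>F. fourier_coeff f k * cnj (fourier_coeff f k)) = ?S" by (metis Re_complex_of_real)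
    then have "(LINT x|leb. (cmod (f x - trig (fourier_coeff f) F x))\<^sup>2) = (LINT x|leb. (cmod (f x))\<^sup>2) - pi * ?S"
      using norm_diff_trig[OF f, of F n "fourier_coeff f"] F by (simp only: mem_Collect_eq)
    moreover have "0 \<le> (LINT x|leb. (cmod (f x - trig (fourier_coeff f) F x))\<^sup>2)" by (rule Bochner_Integration.integral_nonneg) simp
    ultimately have "0 \<le> (LINT x|leb. (cmod (f x))\<^sup>2) - pi * ?S" by (simp only:)
    then show "?S \<le> (LINT x|leb. (cmod (f x))\<^sup>2) / pi" by (simp add: field_simps)
  qed
qed simp

text \<open>The small parameter \<open>e\<close> replaces the Cauchy--Schwarz inequality.\<close>

lemma norm_integral_product_le:
  assumes "L2 f" "L2 g" "e > 0"
  shows "cmod (LINT x|leb. f x * g x) \<le> (LINT x|leb. (cmod (f x))\<^sup>2) / e + e * (LINT x|leb. (cmod (g x))\<^sup>2)"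
proof -
  have "cmod (LINT x|leb. f x * g x) \<le> (LINT x|leb. (cmod (f x))\<^sup>2 / e + e * (cmod (g x))\<^sup>2)"
  proof (rule Bochner_Integration.integral_norm_bound_integral)
    fix x
    define p where "p = cmod (f x)"
    define q where "q = cmod (g x)"
    have "0 \<le> (p - e * q)\<^sup>2" "0 \<le> p * q * e" using assms(3) by (simp_all add: p_def q_def)
    then have "p * q * e \<le> p\<^sup>2 + e\<^sup>2 * q\<^sup>2"
      by (simp add: power2_eq_square algebra_simps)
    then have "p * q \<le> p\<^sup>2 / e + e * q\<^sup>2"
      using assms(3) by (simp add: field_simps power2_eq_square)
    then show "cmod (f x * g x) \<le> (cmod (f x))\<^sup>2 / e + e * (cmod (g x))\<^sup>2"
      by (simp add: norm_mult p_def q_def)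
  qed (use assms L2_product_integrable L2_square_integrable in auto)
  also have "\<dots> = (LINT x|leb. (cmod (f x))\<^sup>2) / e + e * (LINT x|leb. (cmod (g x))\<^sup>2)"
    using assms L2_square_integrable by simp
  finally show ?thesis .
qed

lemma L2_limit_product:
  assumes f: "\<And>N. L2 (f N)" and g: "L2 g" and lim: "(\<lambda>N. LINT x|leb. (cmod (f N x))\<^sup>2) \<longlonglongrightarrow> 0"
  shows "(\<lambda>N. LINT x|leb. f N x * g x) \<longlonglongrightarrow> 0"
proof (rule LIMSEQ_I)
  fix r :: real assume r: "r > 0"
  define B where "B = (LINT x|leb. (cmod (g x))\<^sup>2)"
  have B: "B \<ge> 0" unfolding B_def by simp
  \<comment> \<open>The second term of \<open>norm_integral_product_le\<close> is then at most r /
    2, while the first one tends to 0 for this fixed \<open>e\<close>.\<close>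
  define e where "e = r / (2 * (B + 1))"
  have e: "e > 0" using r B by (simp add: e_def)
  have "r / 2 * (B / (B + 1)) \<le> r / 2 * 1" using B r by (intro mult_left_mono) auto
  then have eB: "e * B \<le> r / 2" by (simp add: e_def)
  have "\<forall>\<^sub>F N in sequentially. (LINT x|leb. (cmod (f N x))\<^sup>2) < e * r / 2"
    using e r by (intro order_tendstoD(2)[OF lim]) auto
  then obtain N0 where N0: "\<And>N. N \<ge> N0 \<Longrightarrow> (LINT x|leb. (cmod (f N x))\<^sup>2) < e * r / 2"
    by (auto simp: eventually_sequentially)
  have "cmod (LINT x|leb. f N x * g x) < r" if "N \<ge> N0" for N
  proof -
    have "cmod (LINT x|leb. f N x * g x) \<le> (LINT x|leb. (cmod (f N x))\<^sup>2) / e + e * B"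
      unfolding B_def by (rule norm_integral_product_le[OF f g e])
    moreover have "(LINT x|leb. (cmod (f N x))\<^sup>2) / e < r / 2"
      using N0[OF that] e by (simp add: pos_divide_less_eq mult.commute)
    ultimately show ?thesis using eB by linarith
  qed
  then show "\<exists>no. \<forall>n\<ge>no. norm ((LINT x|leb. f n x * g x) - 0) < r" by auto
qed

section \<open>Unordered sums as limits, and the Riesz--Fischer theorem\<close>

lemma eventually_symmetric_interval:
  assumes "finite X" "X \<subseteq> A"
  shows "\<forall>\<^sub>F N in sequentially. X \<subseteq> A \<inter> {- int N..int N}"
proof -
  define M where "M = Max (abs ` X)"
  have M: "\<bar>x\<bar> \<le> M" if "x \<in> X" for x
    unfolding M_def using assms(1) that by (intro Max_ge) auto
  show ?thesis
    unfolding eventually_sequentially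
  proof (intro exI allI impI subsetI)
    fix N x assume "nat M \<le> N" "x \<in> X"
    then show "x \<in> A \<inter> {- int N..int N}" using M[of x] assms(2) by auto
  qed
qed

lemma filterlim_symmetric_interval:
  "filterlim (\<lambda>N. A \<inter> {- int N..int N}) (finite_subsets_at_top A) sequentially"
  unfolding filterlim_iff
proof (intro allI impI)
  fix P assume "\<forall>\<^sub>F X in finite_subsets_at_top A. P X"
  then obtain X where X: "finite X" "X \<subseteq> A" and P: "\<forall>Y. finite Y \<and> X \<subseteq> Y \<and> Y \<subseteq> A \<longrightarrow> P Y"
    unfolding eventually_finite_subsets_at_top by (elim exE conjE)
  show "\<forall>\<^sub>F N in sequentially. P (A \<inter> {- int N..int N})"
    using eventually_symmetric_interval[OF X] by (rule eventually_mono) (use P in simp)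
qed

lemma infsum_symmetric_limit:
  fixes g :: "int \<Rightarrow> 'a::{comm_monoid_add,t2_space}"
  assumes "g summable_on A"
  shows "(\<lambda>N. \<Sum>k\<in>A \<inter> {- int N..int N}. g k) \<longlonglongrightarrow> infsum g A"
  using filterlim_compose[OF infsum_tendsto[OF assms] filterlim_symmetric_interval] .

lemma tail_small:
  fixes g :: "int \<Rightarrow> real"
  assumes g: "g summable_on A" "\<And>k. 0 \<le> g k" and e: "e > 0"
  obtains N where "\<And>X. finite X \<Longrightarrow> X \<subseteq> A - {- int N..int N} \<Longrightarrow> sum g X < e"
proof -
  have "\<forall>\<^sub>F N in sequentially. infsum g A - e < (\<Sum>k\<in>A \<inter> {- int N..int N}. g k)"
    by (rule order_tendstoD(1)[OF infsum_symmetric_limit[OF g(1)]]) (use e in simp)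
  then obtain N where N: "infsum g A - e < (\<Sum>k\<in>A \<inter> {- int N..int N}. g k)"
    by (auto simp: eventually_sequentially)
  show ?thesis
  proof (rule that)
    fix X assume X: "finite X" "X \<subseteq> A - {- int N..int N}"
    have "sum g (A \<inter> {- int N..int N}) + sum g X = sum g ((A \<inter> {- int N..int N}) \<union> X)"
      using X by (intro sum.union_disjoint[symmetric]) auto
    also have "\<dots> \<le> infsum g A"
      using X g by (intro finite_sum_le_infsum) auto
    finally show "sum g X < e" using N by linarith
  qed
qed

lemma trig_diff:
  assumes "finite F" "F' \<subseteq> F" shows "trig a F x - trig a F' x = trig a (F - F') x"
  using sum_diff[OF assms, of "\<lambda>k. a k * cis (of_int k * x)"] by (simp add: trig_def)

text \<open>Completeness of L2 in concrete form: a fast subsequence of the partial sums converges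
  almost everywhere, and Fatou's lemma turns the pointwise limit into a limit in mean square of the
  whole sequence. The last property is recorded because the formula for products depends on
  it.\<close>

theorem Riesz_Fischer:
  assumes a: "(\<lambda>k. (cmod (a k))\<^sup>2) summable_on parity_class n"
  obtains g where "L2 g" "\<And>k. even (k - n) \<Longrightarrow> fourier_coeff g k = a k"
    "(\<lambda>N. LINT x|leb. (cmod (trig a (parity_class n \<inter> {- int N..int N}) x - g x))\<^sup>2) \<longlonglongrightarrow> 0"
proof -
  let ?F = "\<lambda>N. parity_class n \<inter> {- int N..int N}"
  define S where "S N = trig a (?F N)" for N
  have Ssub: "(LINT x|leb. (cmod (S M x - S N x))\<^sup>2) = pi * (\<Sum>k\<in>?F M - ?F N. (cmod (a k))\<^sup>2)"
    if "N \<le> M" for M N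
  proof -
    have sub: "?F N \<subseteq> ?F M" using that by auto
    have "S M x - S N x = trig a (?F M - ?F N) x" for x
      unfolding S_def by (rule trig_diff[OF _ sub]) simp
    then show ?thesis using trig_norm[of "?F M - ?F N" n a] by auto
  qed
  have "\<exists>N. \<forall>M\<ge>N. (LINT x|leb. (cmod (S M x - S N x))\<^sup>2) < e" if e: "e > 0" for e
  proof -
    obtain N where N: "\<And>X. finite X \<Longrightarrow> X \<subseteq> parity_class n - {- int N..int N} \<Longrightarrow> (\<Sum>k\<in>X. (cmod (a k))\<^sup>2) < e / pi"
      using tail_small[OF a, of "e / pi"] e by auto
    have "(LINT x|leb. (cmod (S M x - S N x))\<^sup>2) < e" if "N \<le> M" for M
    proof -
      have "(\<Sum>k\<in>?F M - ?F N. (cmod (a k))\<^sup>2) < e / pi" by (rule N) auto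
      then show ?thesis unfolding Ssub[OF that] by (simp add: field_simps)
    qed
    then show ?thesis by blast
  qed
  \<comment> \<open>The rate 1/4 is chosen so that a geometric series of ratio 1/2 remains after the
    factor 2^i that is lost in passing from mean squares to means.\<close>
  then have "\<exists>N. \<forall>M\<ge>N. (LINT x|leb. (cmod (S M x - S N x))\<^sup>2) < (1/4)^i" for i :: nat by simp
  then obtain N0 where N0: "\<And>i M. M \<ge> N0 i \<Longrightarrow> (LINT x|leb. (cmod (S M x - S (N0 i) x))\<^sup>2) < (1/4)^i"
    by metis
  \<comment> \<open>Adding up the thresholds makes \<open>idx\<close> monotone and not smaller than
    \<open>N0 i\<close>; the summand i makes it tend to infinity.\<close>
  define idx where "idx i = (\<Sum>j\<le>i. N0 j) + i" for i
  have idx_mono: "idx i \<le> idx (Suc i)" for i by (simp add: idx_def)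
  have idx_ge: "N0 i \<le> idx i" "i \<le> idx i" for i
    using member_le_sum[of i "{..i}" N0] by (auto simp: idx_def)
  have L2S: "L2 (S N)" for N unfolding S_def by (rule L2_trig)
  have tail: "(LINT x|leb. (cmod (S M x - S N x))\<^sup>2) \<le> (LINT x|leb. (cmod (S M' x - S N' x))\<^sup>2)"
    if "N' \<le> N" "N \<le> M" "M \<le> M'" for M N M' N'
  proof -
    have "(\<Sum>k\<in>?F M - ?F N. (cmod (a k))\<^sup>2) \<le> (\<Sum>k\<in>?F M' - ?F N'. (cmod (a k))\<^sup>2)"
      using that by (intro sum_mono2) auto
    then show ?thesis using that by (simp add: Ssub)
  qed
  have step: "(LINT x|leb. (cmod (S (idx (Suc i)) x - S (idx i) x))\<^sup>2) \<le> (1/4)^i" for i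
    using tail[OF idx_ge(1) idx_mono order_refl, of i] N0[of i "idx (Suc i)"] idx_ge(1)[of i] idx_mono[of i]
    by simp
  define \<Delta> where "\<Delta> i x = cmod (S (idx (Suc i)) x - S (idx i) x)" for i x
  have \<Delta>L2: "L2 (\<lambda>x. S (idx (Suc i)) x - S (idx i) x)" for i by (intro L2_diff L2S)
  have \<Delta>i: "integrable leb (\<Delta> i)" for i
    unfolding \<Delta>_def using L2_integrable[OF \<Delta>L2] by (rule integrable_norm)
  have \<Delta>_le: "(LINT x|leb. \<Delta> i x) \<le> (1 + pi) * (1/2)^i" for i
  proof -
    have "(LINT x|leb. \<Delta> i x) \<le> (LINT x|leb. 2^i * (\<Delta> i x)\<^sup>2 + (1/2)^i)"
    proof (rule Bochner_Integration.integral_mono[OF \<Delta>i])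
      show "integrable leb (\<lambda>x. 2^i * (\<Delta> i x)\<^sup>2 + (1/2)^i)"
        unfolding \<Delta>_def using L2_square_integrable[OF \<Delta>L2[of i]] by simp
      fix x
      \<comment> \<open>The inequality p \<le> p^2 + 1, divided by 2^i, bounds a mean by a mean
        square and takes the place of the Cauchy--Schwarz inequality.\<close>
      define p where "p = 2^i * \<Delta> i x"
      have "0 \<le> (p - 1)\<^sup>2" "0 \<le> p" by (simp_all add: p_def \<Delta>_def)
      then have "p \<le> p\<^sup>2 + 1" unfolding power2_diff by simp
      then have "2^i * \<Delta> i x \<le> (2^i * \<Delta> i x)\<^sup>2 + 1" unfolding p_def .
      then have "2^i * \<Delta> i x * (1/2)^i \<le> ((2^i * \<Delta> i x)\<^sup>2 + 1) * (1/2)^i"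
        by (rule mult_right_mono) simp
      also have "\<dots> = 2^i * (\<Delta> i x)\<^sup>2 + (1/2)^i"
        by (simp add: power2_eq_square field_simps)
      finally show "\<Delta> i x \<le> 2^i * (\<Delta> i x)\<^sup>2 + (1/2)^i" by (simp add: field_simps)
    qed
    also have "\<dots> = 2^i * (LINT x|leb. (\<Delta> i x)\<^sup>2) + (1/2)^i * pi"
      unfolding \<Delta>_def using L2_square_integrable[OF \<Delta>L2[of i]]
      by (simp add: measure_restrict_space)
    also have "\<dots> \<le> 2^i * (1/4)^i + (1/2)^i * pi"
      using step[of i] unfolding \<Delta>_def by simp
    also have "(2::real)^i * (1/4)^i = (1/2)^i" by (simp flip: power_mult_distrib)
    finally show ?thesis by (simp add: algebra_simps)
  qed
  have "AE x in leb. summable (\<lambda>i. \<Delta> i x)"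
  proof -
    have "(\<integral>\<^sup>+x. (\<Sum>i. ennreal (\<Delta> i x)) \<partial>leb) = (\<Sum>i. \<integral>\<^sup>+x. ennreal (\<Delta> i x) \<partial>leb)"
      using \<Delta>i by (intro nn_integral_suminf) auto
    also have "\<dots> = (\<Sum>i. ennreal (LINT x|leb. \<Delta> i x))"
      by (intro suminf_cong nn_integral_eq_integral \<Delta>i AE_I2) (simp add: \<Delta>_def)
    also have "\<dots> \<le> (\<Sum>i. ennreal ((1 + pi) * (1/2)^i))"
      using \<Delta>_le by (intro suminf_le ennreal_leI) auto
    also have "\<dots> = ennreal (\<Sum>i. (1 + pi) * (1/2)^i)"
      by (intro suminf_ennreal2) (auto intro!: summable_mult summable_geometric)
    also have "\<dots> < \<infinity>" by simp
    finally have "(\<integral>\<^sup>+x. (\<Sum>i. ennreal (\<Delta> i x)) \<partial>leb) \<noteq> \<infinity>" by simp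
    then have "AE x in leb. (\<Sum>i. ennreal (\<Delta> i x)) \<noteq> \<infinity>"
      using \<Delta>i by (intro nn_integral_noteq_infinite) auto
    then show ?thesis
    proof (rule eventually_mono)
      fix x assume "(\<Sum>i. ennreal (\<Delta> i x)) \<noteq> \<infinity>"
      then show "summable (\<lambda>i. \<Delta> i x)"
        by (intro summable_suminf_not_top) (auto simp: \<Delta>_def)
    qed
  qed
  define g where "g x = lim (\<lambda>i. S (idx i) x)" for x
  have conv: "AE x in leb. (\<lambda>i. S (idx i) x) \<longlonglongrightarrow> g x"
    using \<open>AE x in leb. summable (\<lambda>i. \<Delta> i x)\<close>
  proof (rule eventually_mono)
    fix x assume "summable (\<lambda>i. \<Delta> i x)"
    then have "summable (\<lambda>i. S (idx (Suc i)) x - S (idx i) x)"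
      unfolding \<Delta>_def by (rule summable_norm_cancel)
    then have "convergent (\<lambda>m. \<Sum>i<m. S (idx (Suc i)) x - S (idx i) x)"
      by (simp add: summable_iff_convergent)
    then have "convergent (\<lambda>m. S (idx m) x - S (idx 0) x)" by (simp add: sum_lessThan_telescope[of "\<lambda>i. S (idx i) x"])
    then have "convergent (\<lambda>m. (S (idx m) x - S (idx 0) x) + S (idx 0) x)"
      by (intro convergent_add convergent_const)
    then show "(\<lambda>i. S (idx i) x) \<longlonglongrightarrow> g x"
      unfolding g_def by (simp add: convergent_LIMSEQ_iff)
  qed
  have gm: "g \<in> borel_measurable leb"
    unfolding g_def by (rule borel_measurable_lim_metric) (use L2S L2_measurable in auto)
  have fatou: "(\<integral>\<^sup>+x. ennreal ((cmod (g x - S N x))\<^sup>2) \<partial>leb) \<le> ennreal e"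
    if N: "\<And>M. M \<ge> N \<Longrightarrow> (LINT x|leb. (cmod (S M x - S N x))\<^sup>2) \<le> e" for N e
  proof -
    have "(\<integral>\<^sup>+x. ennreal ((cmod (g x - S N x))\<^sup>2) \<partial>leb)
        = (\<integral>\<^sup>+x. liminf (\<lambda>i. ennreal ((cmod (S (idx i) x - S N x))\<^sup>2)) \<partial>leb)"
      using conv
    proof (intro nn_integral_cong_AE, elim eventually_mono)
      fix x assume "(\<lambda>i. S (idx i) x) \<longlonglongrightarrow> g x"
      then have "(\<lambda>i. ennreal ((cmod (S (idx i) x - S N x))\<^sup>2)) \<longlonglongrightarrow> ennreal ((cmod (g x - S N x))\<^sup>2)"
        by (intro tendsto_ennrealI tendsto_intros)
      then show "ennreal ((cmod (g x - S N x))\<^sup>2) = liminf (\<lambda>i. ennreal ((cmod (S (idx i) x - S N x))\<^sup>2))"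
        by (intro lim_imp_Liminf[symmetric]) auto
    qed
    also have "\<dots> \<le> liminf (\<lambda>i. \<integral>\<^sup>+x. ennreal ((cmod (S (idx i) x - S N x))\<^sup>2) \<partial>leb)"
      using L2_measurable[OF L2S] by (intro nn_integral_liminf) measurable
    also have "\<dots> \<le> liminf (\<lambda>i. ennreal e)"
    proof (rule Liminf_mono, unfold eventually_sequentially, intro exI allI impI)
      fix i assume "N \<le> i"
      then have "N \<le> idx i" using idx_ge(2)[of i] by simp
      have "(\<integral>\<^sup>+x. ennreal ((cmod (S (idx i) x - S N x))\<^sup>2) \<partial>leb) = ennreal (LINT x|leb. (cmod (S (idx i) x - S N x))\<^sup>2)"
        by (rule nn_integral_eq_integral[OF L2_square_integrable[OF L2_diff[OF L2S L2S]]]) simp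
      then show "(\<integral>\<^sup>+x. ennreal ((cmod (S (idx i) x - S N x))\<^sup>2) \<partial>leb) \<le> ennreal e"
        using N[OF \<open>N \<le> idx i\<close>] by (simp add: ennreal_leI)
    qed
    finally show ?thesis by (simp add: Liminf_const)
  qed
  have L2gS: "L2 (\<lambda>x. g x - S N x)" and gS_le: "(LINT x|leb. (cmod (g x - S N x))\<^sup>2) \<le> e"
    if N: "\<And>M. M \<ge> N \<Longrightarrow> (LINT x|leb. (cmod (S M x - S N x))\<^sup>2) \<le> e" for N e
  proof -
    have e0: "0 \<le> e" using N[of N] by simp
    have m: "(\<lambda>x. g x - S N x) \<in> borel_measurable leb" using gm L2_measurable[OF L2S] by measurable
    have lt: "(\<integral>\<^sup>+x. ennreal ((cmod (g x - S N x))\<^sup>2) \<partial>leb) < \<infinity>"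
      using fatou[OF N] le_less_trans by (metis ennreal_less_top infinity_ennreal_def)
    have i: "integrable leb (\<lambda>x. (cmod (g x - S N x))\<^sup>2)"
      by (rule integrableI_nonneg) (use m lt in auto)
    show "L2 (\<lambda>x. g x - S N x)" using m i by (simp add: L2_iff)
    have "ennreal (LINT x|leb. (cmod (g x - S N x))\<^sup>2) \<le> ennreal e"
      using fatou[OF N] nn_integral_eq_integral[OF i] by simp
    then show "(LINT x|leb. (cmod (g x - S N x))\<^sup>2) \<le> e" using e0 by simp
  qed
  have cauchy: "(LINT x|leb. (cmod (S M x - S (N0 i) x))\<^sup>2) \<le> (1/4)^i" if "M \<ge> N0 i" for M i
    using N0[OF that] by simp
  have "L2 (\<lambda>x. (g x - S (N0 0) x) + S (N0 0) x)"
    by (intro L2_add L2gS[OF cauchy[of 0]] L2S)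
  then have g: "L2 g" by simp
  have lim: "(\<lambda>N. LINT x|leb. (cmod (S N x - g x))\<^sup>2) \<longlonglongrightarrow> 0"
  proof (rule LIMSEQ_I)
    fix r :: real assume r: "r > 0"
    obtain i :: nat where i: "(1/4)^i < r" using real_arch_pow_inv[OF r, of "1/4"] by auto
    have "(LINT x|leb. (cmod (g x - S N x))\<^sup>2) \<le> (1/4)^i" if "N \<ge> N0 i" for N
    proof (rule gS_le)
      fix M assume "N \<le> M"
      then show "(LINT x|leb. (cmod (S M x - S N x))\<^sup>2) \<le> (1/4)^i"
        using tail[OF that _ order_refl] cauchy[of i M] that by force
    qed
    then show "\<exists>no. \<forall>n\<ge>no. norm ((LINT x|leb. (cmod (S n x - g x))\<^sup>2) - 0) < r"
      using i by (intro exI[of _ "N0 i"]) (force simp: norm_minus_commute)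
  qed
  have "fourier_coeff g k = a k" if k: "even (k - n)" for k
  proof -
    let ?c = "\<lambda>x. cis (- (of_int k * x))"
    have "(\<lambda>N. LINT x|leb. (S N x - g x) * ?c x) \<longlonglongrightarrow> 0"
      by (rule L2_limit_product[OF L2_diff[OF L2S g] L2_continuous lim]) (intro continuous_intros)
    then have "(\<lambda>N. (LINT x|leb. (S N x - g x) * ?c x) / pi) \<longlonglongrightarrow> 0 / complex_of_real pi"
      by (rule tendsto_divide[OF _ tendsto_const]) simp
    moreover have "(LINT x|leb. (S N x - g x) * ?c x) / pi = fourier_coeff (S N) k - fourier_coeff g k" for N
      using integrable_mult_cis[OF L2_integrable[OF L2S[of N]], of "- of_int k"]
        integrable_mult_cis[OF L2_integrable[OF g], of "- of_int k"]
      by (simp add: fourier_coeff_eq left_diff_distrib diff_divide_distrib)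
    ultimately have l0: "(\<lambda>N. fourier_coeff (S N) k - fourier_coeff g k) \<longlonglongrightarrow> 0" by simp
    have "\<forall>\<^sub>F N in sequentially. {k} \<subseteq> ?F N"
      by (rule eventually_symmetric_interval) (use k in auto)
    then have "\<forall>\<^sub>F N in sequentially. fourier_coeff (S N) k - fourier_coeff g k = a k - fourier_coeff g k"
      by (rule eventually_mono) (use k in \<open>simp add: S_def fourier_coeff_trig[of _ n]\<close>)
    with l0 have "(\<lambda>N. a k - fourier_coeff g k) \<longlonglongrightarrow> 0" by (rule Lim_transform_eventually)
    then show ?thesis by (simp add: LIMSEQ_const_iff)
  qed
  with g lim show ?thesis unfolding S_def by (intro that)
qed

lemma fourier_coeff_AE_cong:
  assumes "AE x in leb. f x = g x" "f \<in> borel_measurable leb" "g \<in> borel_measurable leb"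
  shows "fourier_coeff f k = fourier_coeff g k"
proof -
  have c: "(\<lambda>x. cis (- (of_int k * x))) \<in> borel_measurable leb"
    by (intro continuous_borel_measurable_leb continuous_intros)
  have "(LINT x|leb. f x * cis (- (of_int k * x))) = (LINT x|leb. g x * cis (- (of_int k * x)))"
    by (rule integral_cong_AE) (use assms c in \<open>auto elim: eventually_mono\<close>)
  then show ?thesis by (simp add: fourier_coeff_eq)
qed

text \<open>The limit supplied by \<open>Riesz_Fischer\<close> has the same coefficients as f and
  hence equals f almost everywhere.\<close>

lemma fourier_partial_sums:
  assumes f: "L2 f"
  shows "(\<lambda>N. LINT x|leb. (cmod (trig (fourier_coeff f) (parity_class n \<inter> {- int N..int N}) x - f x))\<^sup>2) \<longlonglongrightarrow> 0"
proof -
  obtain g where g: "L2 g" "\<And>k. even (k - n) \<Longrightarrow> fourier_coeff g k = fourier_coeff f k"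
    and lim: "(\<lambda>N. LINT x|leb. (cmod (trig (fourier_coeff f) (parity_class n \<inter> {- int N..int N}) x - g x))\<^sup>2) \<longlonglongrightarrow> 0"
    by (rule Riesz_Fischer[OF Bessel[OF f, of n]]) (rule that)
  have "fourier_coeff (\<lambda>x. f x - g x) k = 0" if "even (k - n)" for k
    using integrable_mult_cis[OF L2_integrable[OF f], of "- of_int k"] g(2)[OF that]
      integrable_mult_cis[OF L2_integrable[OF g(1)], of "- of_int k"]
    by (simp add: fourier_coeff_eq left_diff_distrib)
  then have AE: "AE x in leb. f x - g x = 0"
    by (intro fourier_uniqueness L2_integrable L2_diff f g)
  have eq: "(LINT x|leb. (cmod (trig a F x - g x))\<^sup>2) = (LINT x|leb. (cmod (trig a F x - f x))\<^sup>2)" for a F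
  proof (rule integral_cong_AE)
    show "AE x in leb. (cmod (trig a F x - g x))\<^sup>2 = (cmod (trig a F x - f x))\<^sup>2"
      using AE by (rule eventually_mono) simp
  qed (intro L2_square_integrable[THEN borel_measurable_integrable] L2_diff L2_trig f g)+
  show ?thesis using lim unfolding eq .
qed

text \<open>The product is in general only integrable, so its own Fourier series gives no access to
  the sum. Instead f is paired with the partial sums of g, which converge in mean square. Since the
  convolution is absolutely summable, the limit along symmetric intervals is the unordered
  sum.\<close>

theorem fourier_coeff_product:
  assumes f: "L2 f" and g: "L2 g"
  shows "((\<lambda>k. fourier_coeff f (j - k) * fourier_coeff g k) has_sum fourier_coeff (\<lambda>x. f x * g x) j) (parity_class n)"
proof -
  let ?h = "\<lambda>k. fourier_coeff f (j - k) * fourier_coeff g k"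
  let ?F = "\<lambda>N. parity_class n \<inter> {- int N..int N}"
  let ?c = "\<lambda>x. cis (- (of_int j * x))"
  have "(\<lambda>k. (cmod (fourier_coeff f (j - k)))\<^sup>2) summable_on parity_class n"
  proof -
    have bij: "bij_betw (\<lambda>k. j - k) (parity_class n) (parity_class (j - n))"
      by (rule bij_betw_byWitness[where f' = "\<lambda>k. j - k"]) auto
    show ?thesis by (rule summable_on_reindex_bij_betw[OF bij, THEN iffD2, OF Bessel[OF f]])
  qed
  then have "(\<lambda>k. (cmod (fourier_coeff f (j - k)))\<^sup>2 + (cmod (fourier_coeff g k))\<^sup>2) summable_on parity_class n"
    by (intro summable_on_add Bessel g)
  then have "(\<lambda>k. norm (?h k)) summable_on parity_class n"
  proof (rule summable_on_comparison_test)
    fix k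
    define p where "p = cmod (fourier_coeff f (j - k))"
    define q where "q = cmod (fourier_coeff g k)"
    have "0 \<le> (p - q)\<^sup>2" "0 \<le> p * q" by (simp_all add: p_def q_def)
    then have "p * q \<le> p\<^sup>2 + q\<^sup>2" unfolding power2_diff by simp
    then show "norm (?h k) \<le> (cmod (fourier_coeff f (j - k)))\<^sup>2 + (cmod (fourier_coeff g k))\<^sup>2"
      by (simp add: norm_mult p_def q_def)
  qed simp
  then have s: "?h summable_on parity_class n" by (rule abs_summable_summable)
  have fc: "L2 (\<lambda>x. f x * ?c x)" by (intro L2_mult_continuous f continuous_intros)
  have "(\<lambda>N. LINT x|leb. (trig (fourier_coeff g) (?F N) x - g x) * (f x * ?c x)) \<longlonglongrightarrow> 0"
    by (rule L2_limit_product[OF L2_diff[OF L2_trig g] fc fourier_partial_sums[OF g]])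
  then have l0: "(\<lambda>N. (LINT x|leb. (trig (fourier_coeff g) (?F N) x - g x) * (f x * ?c x)) / pi) \<longlonglongrightarrow> 0 / complex_of_real pi"
    by (rule tendsto_divide[OF _ tendsto_const]) simp
  have eq: "(LINT x|leb. (trig (fourier_coeff g) F x - g x) * (f x * ?c x)) / pi
      = (\<Sum>k\<in>F. ?h k) - fourier_coeff (\<lambda>x. f x * g x) j" if F: "finite F" for F
  proof -
    have "- (of_int (j - k) * x) = of_int (k - j) * x" for k and x :: real
      by (simp add: algebra_simps)
    then have coeff: "fourier_coeff f (j - k) = (LINT x|leb. f x * cis (of_int (k - j) * x)) / pi" for k
      unfolding fourier_coeff_eq by presburger
    have "(LINT x|leb. trig (fourier_coeff g) F x * (f x * ?c x))
        = (LINT x|leb. (\<Sum>k\<in>F. fourier_coeff g k * (f x * cis (of_int (k - j) * x))))"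
      by (simp add: trig_def sum_distrib_right mult.assoc mult.left_commute[of "cis _"] cis_mult
          left_diff_distrib)
    also have "\<dots> = (\<Sum>k\<in>F. fourier_coeff g k * (LINT x|leb. f x * cis (of_int (k - j) * x)))"
      by (subst Bochner_Integration.integral_sum)
        (intro integrable_mult_right integrable_mult_cis L2_integrable f, simp)
    finally have 1: "(LINT x|leb. trig (fourier_coeff g) F x * (f x * ?c x)) / pi = (\<Sum>k\<in>F. ?h k)"
      by (simp only: sum_divide_distrib) (rule sum.cong, simp_all add: coeff)
    have 2: "(LINT x|leb. g x * (f x * ?c x)) / pi = fourier_coeff (\<lambda>x. f x * g x) j"
      by (simp add: fourier_coeff_eq mult_ac)
    show ?thesis
      unfolding 1[symmetric] 2[symmetric]
      using L2_product_integrable[OF L2_trig fc] L2_product_integrable[OF g fc]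
      by (simp add: left_diff_distrib diff_divide_distrib)
  qed
  have "(\<lambda>N. (\<Sum>k\<in>?F N. ?h k) - fourier_coeff (\<lambda>x. f x * g x) j) \<longlonglongrightarrow> 0"
    using l0 by (simp add: eq)
  then have "(\<lambda>N. \<Sum>k\<in>?F N. ?h k) \<longlonglongrightarrow> fourier_coeff (\<lambda>x. f x * g x) j"
    by (simp add: LIM_zero_iff)
  with infsum_symmetric_limit[OF s] have "infsum ?h (parity_class n) = fourier_coeff (\<lambda>x. f x * g x) j"
    by (rule LIMSEQ_unique)
  with s show ?thesis by (simp add: has_sum_iff)
qed

subsection \<open>Eigenvalues as solutions of infinite linear systems\<close>

lemma fourier_coeff_add:
  assumes "integrable leb f" "integrable leb g"
  shows "fourier_coeff (\<lambda>x. f x + g x) k = fourier_coeff f k + fourier_coeff g k"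
  using integrable_mult_cis[OF assms(1), of "- of_int k"] integrable_mult_cis[OF assms(2), of "- of_int k"]
  by (simp add: fourier_coeff_eq distrib_right add_divide_distrib)

lemma fourier_coeff_cmult: "fourier_coeff (\<lambda>x. c * f x) k = c * fourier_coeff f k"
  by (simp add: fourier_coeff_eq mult.assoc)

lemma fourier_coeff_diff:
  assumes "integrable leb f" "integrable leb g"
  shows "fourier_coeff (\<lambda>x. f x - g x) k = fourier_coeff f k - fourier_coeff g k"
  using fourier_coeff_add[OF assms(1), of "\<lambda>x. -1 * g x" k] fourier_coeff_cmult[of "-1" g k] assms(2)
  by simp

lemma AE_leb_iff: "(AE x in lebesgue. x \<in> {0..pi} \<longrightarrow> P x) \<longleftrightarrow> (AE x in leb. P x)"
  by (rule AE_restrict_space_iff[symmetric]) simp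

lemma continuous_AE_zero:
  fixes y :: "real \<Rightarrow> complex"
  assumes c: "continuous_on {0..pi} y" and ae: "AE x in leb. y x = 0" and x: "x \<in> {0..pi}"
  shows "y x = 0"
proof -
  have cn: "continuous_on {0..pi} (\<lambda>x. cmod (y x))" using c by (intro continuous_intros)
  have "integrable leb (\<lambda>x. cmod (y x))" by (rule integrable_norm[OF continuous_integrable_leb[OF c]])
  from has_integral_integral_lebesgue_on[OF this]
  have "((\<lambda>x. cmod (y x)) has_integral (LINT x|leb. cmod (y x))) {0..pi}" by simp
  moreover have "(LINT x|leb. cmod (y x)) = 0"
    by (rule integral_eq_zero_AE) (use ae in \<open>simp only: norm_eq_zero\<close>)
  ultimately have "((\<lambda>x. cmod (y x)) has_integral 0) (cbox 0 pi)" by (simp add: cbox_interval)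
  from has_integral_0_cbox_imp_0[of 0 pi "\<lambda>x. cmod (y x)" x, OF _ _ this] cn x
  show ?thesis using pi_gt_zero by (simp add: cbox_interval not_le)
qed

lemma L2_AE_cong:
  assumes "L2 f" "AE x in leb. f x = g x" "g \<in> borel_measurable leb"
  shows "L2 g"
  unfolding L2_iff
proof
  show "integrable leb (\<lambda>x. (cmod (g x))\<^sup>2)"
  proof (rule integrable_cong_AE_imp[OF L2_square_integrable[OF assms(1)]])
    show "(\<lambda>x. (cmod (g x))\<^sup>2) \<in> borel_measurable leb" using assms(3) by measurable
    show "AE x in leb. (cmod (f x))\<^sup>2 = (cmod (g x))\<^sup>2"
      using assms(2) by (rule eventually_mono) simp
  qed
qed (rule assms)

lemma AC_nonzero_coeff:
  assumes y: "continuous_on {0..pi} y" and x: "x \<in> {0..pi}" "y x \<noteq> 0"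
  shows "\<exists>j\<in>parity_class n. fourier_coeff y j \<noteq> 0"
proof (rule ccontr)
  assume "\<not> ?thesis"
  then have "\<forall>j\<in>parity_class n. fourier_coeff y j = 0" by blast
  then have "fourier_coeff y j = 0" if "even (j - n)" for j
    by (rule bspec[OF _ CollectI]) (rule that)
  then have "AE x in leb. y x = 0" by (intro fourier_uniqueness continuous_integrable_leb y)
  from continuous_AE_zero[OF y this x(1)] x(2) show False by simp
qed

lemma coeff_nonzero_imp_nonzero:
  assumes "fourier_coeff y j \<noteq> 0" shows "\<exists>x\<in>{0..pi}. y x \<noteq> 0"
proof (rule ccontr)
  assume "\<not> ?thesis"
  then have "(LINT x|leb. y x * cis (- (of_int j * x))) = (LINT x|leb. 0)"
    by (intro Bochner_Integration.integral_cong) auto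
  with assms show False by (simp add: fourier_coeff_eq)
qed

text \<open>The coefficient form of q' y = (q y)' - q y', whose right side makes sense for square
  integrable q. The factor \<open>j - k\<close> hidden in \<open>hill_coeff\<close> vanishes at
  \<open>k = j\<close>, where the constant \<open>C\<close> takes its place.\<close>

lemma has_sum_hill:
  assumes "j \<in> parity_class n"
    and "((\<lambda>k. fourier_coeff q (j - k) * x k) has_sum a) (parity_class n)"
    and "((\<lambda>k. fourier_coeff q (j - k) * (\<i> * of_int k * x k)) has_sum b) (parity_class n)"
  shows "((\<lambda>k. hill_coeff C q (j - k) * x k) has_sum (\<i> * of_int j * a - b + C * x j)) (parity_class n)"
proof -
  have "((\<lambda>k. \<i> * of_int j * (fourier_coeff q (j - k) * x k) + (- (fourier_coeff q (j - k) * (\<i> * of_int k * x k))))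
      has_sum (\<i> * of_int j * a + (- b))) (parity_class n)"
    by (intro has_sum_add has_sum_cmult_right has_sum_uminusI assms)
  moreover have "((\<lambda>k. if k = j then C * x j else 0) has_sum (C * x j)) (parity_class n)"
    by (rule has_sum_finite_neutralI[where B = "{j}"]) (use assms(1) in auto)
  ultimately have "((\<lambda>k. (\<i> * of_int j * (fourier_coeff q (j - k) * x k)
      + (- (fourier_coeff q (j - k) * (\<i> * of_int k * x k)))) + (if k = j then C * x j else 0))
      has_sum ((\<i> * of_int j * a + (- b)) + C * x j)) (parity_class n)"
    by (rule has_sum_add)
  then have "((\<lambda>k. hill_coeff C q (j - k) * x k) has_sum ((\<i> * of_int j * a + (- b)) + C * x j)) (parity_class n)"
    by (rule has_sum_cong[THEN iffD1, rotated]) (auto simp: hill_coeff_def algebra_simps)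
  then show ?thesis by simp
qed

text \<open>The quasi-derivative u turns the eigenvalue equation into two equations of first order,
  each read off coefficientwise by \<open>AC_fourier_coeff\<close>; eliminating the coefficients of
  u gives the system. The weight 1 + j^2 records that y' is square integrable.\<close>

lemma hill_eigenvalue_imp_solution:
  assumes q: "L2 q" and ev: "is_eigenvalue (*) (hill_op C q (bc_of n)) \<mu>"
  obtains x where "\<exists>j\<in>parity_class n. x j \<noteq> 0"
    "(\<lambda>j. (1 + (of_int j)\<^sup>2) * (cmod (x j))\<^sup>2) summable_on parity_class n"
    "\<And>j. j \<in> parity_class n \<Longrightarrow>
       (\<mu> - of_int (j\<^sup>2)) * x j = (\<Sum>\<^sub>\<infinity>k\<in>parity_class n. hill_coeff C q (j - k) * x k)"
proof -
  from ev obtain y where y0: "\<exists>t\<in>{0..pi}. y t \<noteq> 0" and op: "hill_op C q (bc_of n) y (\<lambda>t. \<mu> * y t)"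
    unfolding is_eigenvalue_def by blast
  from op obtain y' u u' where y: "has_AC_deriv y y'" "L2 y'" and u: "has_AC_deriv u u'"
    and ae1: "AE t in leb. u t = y' t - q t * y t"
    and ae2: "AE t in leb. \<mu> * y t = - u' t - q t * y' t + C * y t"
    and bc: "y pi = bc_sign (bc_of n) * y 0" "u pi = bc_sign (bc_of n) * u 0"
    unfolding hill_op_def AE_leb_iff by blast
  have yc: "continuous_on {0..pi} y" by (rule AC_continuous[OF y(1)])
  have yL2: "L2 y" by (rule L2_continuous[OF yc])
  have ui': "integrable leb u'" using u by (simp add: has_AC_deriv_def L1_iff)
  note ints = L2_integrable[OF yL2] L2_integrable[OF y(2)] L2_product_integrable[OF q yL2]
    L2_product_integrable[OF q y(2)]
  define x where "x = fourier_coeff y"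
  have y'x: "fourier_coeff y' k = \<i> * of_int k * x k" if "k \<in> parity_class n" for k
    unfolding x_def using AC_fourier_coeff[OF y(1) bc(1)] that by simp
  have s1: "(\<lambda>j. (cmod (x j))\<^sup>2) summable_on parity_class n" unfolding x_def by (rule Bessel[OF yL2])
  have s2: "(\<lambda>j. (of_int j)\<^sup>2 * (cmod (x j))\<^sup>2) summable_on parity_class n"
    using Bessel[OF y(2), of n]
    by (rule summable_on_cong[THEN iffD1, rotated]) (simp add: y'x norm_mult power_mult_distrib)
  show ?thesis
  proof (rule that[of x])
    show "\<exists>j\<in>parity_class n. x j \<noteq> 0" unfolding x_def using AC_nonzero_coeff[OF yc] y0 by blast
    show "(\<lambda>j. (1 + (of_int j)\<^sup>2) * (cmod (x j))\<^sup>2) summable_on parity_class n"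
      using summable_on_add[OF s1 s2] by (simp add: distrib_right)
    fix j assume j: "j \<in> parity_class n"
    have qy: "((\<lambda>k. fourier_coeff q (j - k) * x k) has_sum fourier_coeff (\<lambda>t. q t * y t) j) (parity_class n)"
      unfolding x_def by (rule fourier_coeff_product[OF q yL2])
    have qy': "((\<lambda>k. fourier_coeff q (j - k) * (\<i> * of_int k * x k)) has_sum fourier_coeff (\<lambda>t. q t * y' t) j)
        (parity_class n)"
      using fourier_coeff_product[OF q y(2), of j n]
      by (rule has_sum_cong[THEN iffD1, rotated]) (simp add: y'x)
    have "fourier_coeff u j = fourier_coeff (\<lambda>t. y' t - q t * y t) j"
      by (rule fourier_coeff_AE_cong[OF ae1 continuous_borel_measurable_leb[OF AC_continuous[OF u]]])
        (intro borel_measurable_diff borel_measurable_integrable ints)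
    also have "\<dots> = \<i> * of_int j * x j - fourier_coeff (\<lambda>t. q t * y t) j"
      using ints y'x[OF j] by (simp add: fourier_coeff_diff)
    finally have uj: "fourier_coeff u j = \<i> * of_int j * x j - fourier_coeff (\<lambda>t. q t * y t) j" .
    have "fourier_coeff u' j = fourier_coeff (\<lambda>t. (C - \<mu>) * y t - q t * y' t) j"
    proof (rule fourier_coeff_AE_cong)
      show "AE t in leb. u' t = (C - \<mu>) * y t - q t * y' t"
        using ae2 by (rule eventually_mono) (simp add: algebra_simps)
    qed (use ints ui' in auto)
    also have "\<dots> = (C - \<mu>) * x j - fourier_coeff (\<lambda>t. q t * y' t) j"
      using ints by (simp add: fourier_coeff_diff fourier_coeff_cmult x_def)
    finally have u'j: "fourier_coeff u' j = (C - \<mu>) * x j - fourier_coeff (\<lambda>t. q t * y' t) j" .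
    have "fourier_coeff u' j = \<i> * of_int j * fourier_coeff u j"
      using AC_fourier_coeff[OF u bc(2)] j by simp
    then have "(\<mu> - of_int (j\<^sup>2)) * x j = \<i> * of_int j * fourier_coeff (\<lambda>t. q t * y t) j
        - fourier_coeff (\<lambda>t. q t * y' t) j + C * x j"
      unfolding uj u'j by (simp add: algebra_simps power2_eq_square)
    with infsumI[OF has_sum_hill[OF j qy qy', of C]]
    show "(\<mu> - of_int (j\<^sup>2)) * x j = (\<Sum>\<^sub>\<infinity>k\<in>parity_class n. hill_coeff C q (j - k) * x k)" by simp
  qed
qed

text \<open>\<open>weak_derivative\<close> is applied twice. The sequences x k and
  \<open>\<i> * k * x k\<close> give y and y'. The system then says exactly that the coefficients of
  f are \<open>\<i> * j\<close> times those of y' - q y, so the quasi-derivative has an absolutely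
  continuous representative with the right boundary values.\<close>

lemma solution_imp_hill_eigenvalue:
  assumes q: "L2 q" and x0: "\<exists>j\<in>parity_class n. x j \<noteq> 0"
    and s: "(\<lambda>j. (1 + (of_int j)\<^sup>2) * (cmod (x j))\<^sup>2) summable_on parity_class n"
    and eq: "\<And>j. j \<in> parity_class n \<Longrightarrow>
       (\<mu> - of_int (j\<^sup>2)) * x j = (\<Sum>\<^sub>\<infinity>k\<in>parity_class n. hill_coeff C q (j - k) * x k)"
  shows "is_eigenvalue (*) (hill_op C q (bc_of n)) \<mu>"
proof -
  have "(\<lambda>j. (cmod (x j))\<^sup>2) summable_on parity_class n"
    using s by (rule summable_on_comparison_test) (auto simp: distrib_right)
  then obtain y0 where y0: "L2 y0" "\<And>k. even (k - n) \<Longrightarrow> fourier_coeff y0 k = x k"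
    by (rule Riesz_Fischer) (rule that)
  have "(\<lambda>j. (cmod (\<i> * of_int j * x j))\<^sup>2) summable_on parity_class n"
    using s by (rule summable_on_comparison_test) (auto simp: distrib_right norm_mult power_mult_distrib)
  then obtain y' where y': "L2 y'" "\<And>k. even (k - n) \<Longrightarrow> fourier_coeff y' k = \<i> * of_int k * x k"
    by (rule Riesz_Fischer) (rule that)
  obtain y where y: "has_AC_deriv y y'" "y pi = bc_sign (bc_of n) * y 0" "AE t in leb. y t = y0 t"
    by (rule weak_derivative[OF L2_integrable[OF y'(1)] L2_integrable[OF y0(1)], of n])
      (use y0(2) y'(2) in auto)
  have yc: "continuous_on {0..pi} y" by (rule AC_continuous[OF y(1)])
  have yL2: "L2 y" by (rule L2_continuous[OF yc])
  have yx: "fourier_coeff y k = x k" if "k \<in> parity_class n" for k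
    using fourier_coeff_AE_cong[OF y(3) L2_measurable[OF yL2] L2_measurable[OF y0(1)], of k] y0(2) that by simp
  note ints = L2_integrable[OF yL2] L2_integrable[OF y'(1)] L2_product_integrable[OF q yL2]
    L2_product_integrable[OF q y'(1)]
  define f where "f t = (C - \<mu>) * y t - q t * y' t" for t
  define g where "g t = y' t - q t * y t" for t
  have fi: "integrable leb f" and gi: "integrable leb g" unfolding f_def g_def using ints by auto
  have fg: "fourier_coeff f j = \<i> * of_int j * fourier_coeff g j" if "even (j - n)" for j
  proof -
    have j: "j \<in> parity_class n" using that by simp
    have qy: "((\<lambda>k. fourier_coeff q (j - k) * x k) has_sum fourier_coeff (\<lambda>t. q t * y t) j) (parity_class n)"
      using fourier_coeff_product[OF q yL2, of j n]
      by (rule has_sum_cong[THEN iffD1, rotated]) (simp add: yx)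
    have qy': "((\<lambda>k. fourier_coeff q (j - k) * (\<i> * of_int k * x k)) has_sum fourier_coeff (\<lambda>t. q t * y' t) j)
        (parity_class n)"
      using fourier_coeff_product[OF q y'(1), of j n]
      by (rule has_sum_cong[THEN iffD1, rotated]) (simp add: y'(2))
    have e: "(\<mu> - of_int (j\<^sup>2)) * x j = \<i> * of_int j * fourier_coeff (\<lambda>t. q t * y t) j
        - fourier_coeff (\<lambda>t. q t * y' t) j + C * x j"
      using infsumI[OF has_sum_hill[OF j qy qy', of C]] eq[OF j] by simp
    have fj: "fourier_coeff f j = (C - \<mu>) * x j - fourier_coeff (\<lambda>t. q t * y' t) j"
      unfolding f_def using ints yx[OF j] by (simp add: fourier_coeff_diff fourier_coeff_cmult)
    have gj: "fourier_coeff g j = \<i> * of_int j * x j - fourier_coeff (\<lambda>t. q t * y t) j"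
      unfolding g_def using ints y'(2)[OF that] by (simp add: fourier_coeff_diff)
    have "\<i> * of_int j * fourier_coeff g j
        = - (of_int (j\<^sup>2) * x j) - \<i> * of_int j * fourier_coeff (\<lambda>t. q t * y t) j"
      unfolding gj by (simp add: algebra_simps power2_eq_square)
    also have "\<dots> = fourier_coeff f j" unfolding fj using e by (simp add: algebra_simps)
    finally show ?thesis by (rule sym)
  qed
  obtain u where u: "has_AC_deriv u f" "u pi = bc_sign (bc_of n) * u 0" "AE t in leb. u t = g t"
    by (rule weak_derivative[OF fi gi fg])
  have "hill_op C q (bc_of n) y (\<lambda>t. \<mu> * y t)"
    unfolding hill_op_def AE_leb_iff
  proof (intro exI conjI)
    show "AE t in leb. u t = y' t - q t * y t" using u(3) unfolding g_def .
    show "AE t in leb. \<mu> * y t = - f t - q t * y' t + C * y t"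
      unfolding f_def by (intro AE_I2) (simp add: algebra_simps)
    show "L2 (\<lambda>t. \<mu> * y t)" by (rule L2_cmult[OF yL2])
  qed (fact y y' u)+
  moreover obtain j where "j \<in> parity_class n" "x j \<noteq> 0" using x0 by blast
  then have "\<exists>t\<in>{0..pi}. y t \<noteq> 0" using yx by (intro coeff_nonzero_imp_nonzero[of y j]) simp
  ultimately show ?thesis unfolding is_eigenvalue_def by blast
qed

section \<open>The linear system of the Dirac operator\<close>

lemma parity_class_uminus: "bij_betw uminus (parity_class n) (parity_class n)"
  by (rule bij_betw_byWitness[where f' = uminus]) auto

text \<open>The first component is expanded in exp(-ijx) and the second one in exp(ijx), so that i
  d/dx on the former and -i d/dx on the latter both act as multiplication by j. This reflection
  explains the arguments \<open>- j - k\<close> and \<open>j + k\<close>.\<close>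

lemma dirac_eigenvalue_imp_solution:
  assumes P: "L2 P" and Q: "L2 Q" and ev: "is_eigenvalue scale2 (dirac_op P Q (bc_of n)) \<mu>"
  obtains a b where "\<exists>j\<in>parity_class n. a j \<noteq> 0 \<or> b j \<noteq> 0"
    "(\<lambda>j. (1 + (of_int j)\<^sup>2) * (cmod (a j))\<^sup>2) summable_on parity_class n"
    "(\<lambda>j. (1 + (of_int j)\<^sup>2) * (cmod (b j))\<^sup>2) summable_on parity_class n"
    "\<And>j. j \<in> parity_class n \<Longrightarrow>
       (\<mu> - of_int j) * a j = (\<Sum>\<^sub>\<infinity>k\<in>parity_class n. fourier_coeff P (- j - k) * b k)"
    "\<And>j. j \<in> parity_class n \<Longrightarrow>
       (\<mu> - of_int j) * b j = (\<Sum>\<^sub>\<infinity>k\<in>parity_class n. fourier_coeff Q (j + k) * a k)"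
proof -
  from ev obtain y where y0: "\<exists>t\<in>{0..pi}. y t \<noteq> 0" and op: "dirac_op P Q (bc_of n) y (\<lambda>t. scale2 \<mu> (y t))"
    unfolding is_eigenvalue_def by blast
  define y1 where "y1 t = fst (y t)" for t
  define y2 where "y2 t = snd (y t)" for t
  from op obtain g1 g2 where g1: "has_AC_deriv y1 g1" "L2 g1" and g2: "has_AC_deriv y2 g2" "L2 g2"
    and ae: "AE t in leb. \<mu> * y1 t = \<i> * g1 t + P t * y2 t \<and> \<mu> * y2 t = - \<i> * g2 t + Q t * y1 t"
    and bc: "y1 pi = bc_sign (bc_of n) * y1 0" "y2 pi = bc_sign (bc_of n) * y2 0"
    unfolding dirac_op_def AE_leb_iff scale2_def y1_def[symmetric] y2_def[symmetric] fst_conv snd_conv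
    by blast
  have c: "continuous_on {0..pi} y1" "continuous_on {0..pi} y2"
    by (rule AC_continuous[OF g1(1)] AC_continuous[OF g2(1)])+
  note L = L2_continuous[OF c(1)] L2_continuous[OF c(2)]
  define a where "a j = fourier_coeff y1 (- j)" for j
  define b where "b j = fourier_coeff y2 j" for j
  have g1a: "fourier_coeff g1 (- j) = - \<i> * of_int j * a j" if "j \<in> parity_class n" for j
    unfolding a_def using AC_fourier_coeff[OF g1(1) bc(1), of "- j"] that by simp
  have g2b: "fourier_coeff g2 j = \<i> * of_int j * b j" if "j \<in> parity_class n" for j
    unfolding b_def using AC_fourier_coeff[OF g2(1) bc(2)] that by simp
  have bessel': "(\<lambda>j. (cmod (fourier_coeff f (- j)))\<^sup>2) summable_on parity_class n" if "L2 f" for f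
    using summable_on_reindex_bij_betw[OF parity_class_uminus, THEN iffD2, OF Bessel[OF that]] .
  have b1: "(\<lambda>j. (cmod (b j))\<^sup>2) summable_on parity_class n"
    unfolding b_def by (rule Bessel[OF L(2)])
  have b2: "(\<lambda>j. (of_int j)\<^sup>2 * (cmod (b j))\<^sup>2) summable_on parity_class n"
    using Bessel[OF g2(2), of n]
    by (rule summable_on_cong[THEN iffD1, rotated]) (simp add: g2b norm_mult power_mult_distrib)
  have a1: "(\<lambda>j. (cmod (a j))\<^sup>2) summable_on parity_class n"
    unfolding a_def by (rule bessel'[OF L(1)])
  have a2: "(\<lambda>j. (of_int j)\<^sup>2 * (cmod (a j))\<^sup>2) summable_on parity_class n"
    using bessel'[OF g1(2)]
    by (rule summable_on_cong[THEN iffD1, rotated]) (simp add: g1a norm_mult power_mult_distrib)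
  show ?thesis
  proof (rule that[of a b])
    from y0 obtain t where t: "t \<in> {0..pi}" "y t \<noteq> 0" by blast
    then have "y1 t \<noteq> 0 \<or> y2 t \<noteq> 0" by (auto simp: y1_def y2_def prod_eq_iff)
    then show "\<exists>j\<in>parity_class n. a j \<noteq> 0 \<or> b j \<noteq> 0"
    proof
      assume "y1 t \<noteq> 0"
      then obtain j where j: "j \<in> parity_class n" "fourier_coeff y1 j \<noteq> 0"
        using AC_nonzero_coeff[OF c(1) t(1)] by blast
      then show ?thesis by (intro bexI[of _ "- j"]) (auto simp: a_def)
    next
      assume "y2 t \<noteq> 0"
      then show ?thesis using AC_nonzero_coeff[OF c(2) t(1)] unfolding b_def by blast
    qed
    show "(\<lambda>j. (1 + (of_int j)\<^sup>2) * (cmod (a j))\<^sup>2) summable_on parity_class n"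
      using summable_on_add[OF a1 a2] by (simp add: distrib_right)
    show "(\<lambda>j. (1 + (of_int j)\<^sup>2) * (cmod (b j))\<^sup>2) summable_on parity_class n"
      using summable_on_add[OF b1 b2] by (simp add: distrib_right)
    fix j assume j: "j \<in> parity_class n"
    have "fourier_coeff (\<lambda>t. \<mu> * y1 t) (- j) = fourier_coeff (\<lambda>t. \<i> * g1 t + P t * y2 t) (- j)"
    proof (rule fourier_coeff_AE_cong)
      show "AE t in leb. \<mu> * y1 t = \<i> * g1 t + P t * y2 t" using ae by (rule eventually_mono) simp
    qed (use L L2_integrable[OF g1(2)] L2_product_integrable[OF P L(2)] in \<open>auto intro!: L2_measurable L2_cmult\<close>)
    then have "\<mu> * a j = \<i> * (- \<i> * of_int j * a j) + fourier_coeff (\<lambda>t. P t * y2 t) (- j)"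
      using L2_integrable[OF g1(2)] L2_product_integrable[OF P L(2)]
      by (simp add: fourier_coeff_add fourier_coeff_cmult g1a[OF j] a_def[symmetric])
    then show "(\<mu> - of_int j) * a j = (\<Sum>\<^sub>\<infinity>k\<in>parity_class n. fourier_coeff P (- j - k) * b k)"
      using infsumI[OF fourier_coeff_product[OF P L(2), of "- j" n]] unfolding b_def
      by (simp add: algebra_simps)
    have "fourier_coeff (\<lambda>t. \<mu> * y2 t) j = fourier_coeff (\<lambda>t. - \<i> * g2 t + Q t * y1 t) j"
    proof (rule fourier_coeff_AE_cong)
      show "AE t in leb. \<mu> * y2 t = - \<i> * g2 t + Q t * y1 t" using ae by (rule eventually_mono) simp
    qed (use L L2_integrable[OF g2(2)] L2_product_integrable[OF Q L(1)] in \<open>auto intro!: L2_measurable L2_cmult\<close>)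
    then have 1: "\<mu> * b j = - \<i> * (\<i> * of_int j * b j) + fourier_coeff (\<lambda>t. Q t * y1 t) j"
      using L2_integrable[OF g2(2)] L2_product_integrable[OF Q L(1)]
      by (simp only: fourier_coeff_add fourier_coeff_cmult g2b[OF j] b_def[symmetric] integrable_mult_right)
    have "(\<Sum>\<^sub>\<infinity>k\<in>parity_class n. fourier_coeff Q (j + k) * a k)
        = (\<Sum>\<^sub>\<infinity>k\<in>parity_class n. fourier_coeff Q (j - k) * fourier_coeff y1 k)"
      unfolding a_def
      using infsum_reindex_bij_betw[OF parity_class_uminus, of "\<lambda>k. fourier_coeff Q (j - k) * fourier_coeff y1 k" n]
      by simp
    with infsumI[OF fourier_coeff_product[OF Q L(1), of j n]] 1
    show "(\<mu> - of_int j) * b j = (\<Sum>\<^sub>\<infinity>k\<in>parity_class n. fourier_coeff Q (j + k) * a k)"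
      by (simp add: algebra_simps)
  qed
qed

text \<open>Regularity is gained in two stages. The candidates for the derivatives contain P w2 and
  Q w1, products that are at first known to be integrable; this gives absolutely continuous y1 and
  y2. These are bounded, so the derivatives turn out to be square integrable.\<close>

lemma solution_imp_dirac_eigenvalue:
  assumes P: "L2 P" and Q: "L2 Q" and ab0: "\<exists>j\<in>parity_class n. a j \<noteq> 0 \<or> b j \<noteq> 0"
    and sa: "(\<lambda>j. (cmod (a j))\<^sup>2) summable_on parity_class n"
    and sb: "(\<lambda>j. (cmod (b j))\<^sup>2) summable_on parity_class n"
    and eqa: "\<And>j. j \<in> parity_class n \<Longrightarrow>
       (\<mu> - of_int j) * a j = (\<Sum>\<^sub>\<infinity>k\<in>parity_class n. fourier_coeff P (- j - k) * b k)"
    and eqb: "\<And>j. j \<in> parity_class n \<Longrightarrow>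
       (\<mu> - of_int j) * b j = (\<Sum>\<^sub>\<infinity>k\<in>parity_class n. fourier_coeff Q (j + k) * a k)"
  shows "is_eigenvalue scale2 (dirac_op P Q (bc_of n)) \<mu>"
proof -
  have "(\<lambda>j. (cmod (a (- j)))\<^sup>2) summable_on parity_class n"
    using summable_on_reindex_bij_betw[OF parity_class_uminus, THEN iffD2, OF sa] .
  then obtain w1 where w1: "L2 w1" "\<And>k. even (k - n) \<Longrightarrow> fourier_coeff w1 k = a (- k)"
    by (rule Riesz_Fischer) (rule that)
  obtain w2 where w2: "L2 w2" "\<And>k. even (k - n) \<Longrightarrow> fourier_coeff w2 k = b k"
    by (rule Riesz_Fischer[OF sb]) (rule that)
  define g1 where "g1 t = - \<i> * (\<mu> * w1 t - P t * w2 t)" for t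
  define g2 where "g2 t = \<i> * (\<mu> * w2 t - Q t * w1 t)" for t
  note ints = L2_integrable[OF w1(1)] L2_integrable[OF w2(1)] L2_product_integrable[OF P w2(1)]
    L2_product_integrable[OF Q w1(1)]
  have gi: "integrable leb g1" "integrable leb g2" unfolding g1_def g2_def using ints by auto
  have "fourier_coeff g1 j = \<i> * of_int j * fourier_coeff w1 j" if j: "even (j - n)" for j
  proof -
    have j': "- j \<in> parity_class n" using j by simp
    have "((\<lambda>k. fourier_coeff P (j - k) * b k) has_sum fourier_coeff (\<lambda>t. P t * w2 t) j) (parity_class n)"
      using fourier_coeff_product[OF P w2(1), of j n]
      by (rule has_sum_cong[THEN iffD1, rotated]) (simp add: w2(2))
    from infsumI[OF this] eqa[OF j']
    have e1: "(\<mu> + of_int j) * a (- j) = fourier_coeff (\<lambda>t. P t * w2 t) j" by simp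
    have e2: "fourier_coeff g1 j = - \<i> * (\<mu> * a (- j) - fourier_coeff (\<lambda>t. P t * w2 t) j)"
      unfolding g1_def fourier_coeff_cmult using ints by (simp add: fourier_coeff_diff fourier_coeff_cmult w1(2)[OF j])
    show ?thesis unfolding e2 e1[symmetric] w1(2)[OF j] by (simp add: algebra_simps)
  qed
  then obtain y1 where y1: "has_AC_deriv y1 g1" "y1 pi = bc_sign (bc_of n) * y1 0" "AE t in leb. y1 t = w1 t"
    by (rule weak_derivative[OF gi(1) ints(1)])
  have "fourier_coeff g2 j = \<i> * of_int j * fourier_coeff w2 j" if j: "even (j - n)" for j
  proof -
    have j': "j \<in> parity_class n" using j by simp
    have "((\<lambda>k. fourier_coeff Q (j - k) * a (- k)) has_sum fourier_coeff (\<lambda>t. Q t * w1 t) j) (parity_class n)"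
      using fourier_coeff_product[OF Q w1(1), of j n]
      by (rule has_sum_cong[THEN iffD1, rotated]) (simp add: w1(2))
    moreover have "(\<Sum>\<^sub>\<infinity>k\<in>parity_class n. fourier_coeff Q (j - k) * a (- k))
        = (\<Sum>\<^sub>\<infinity>k\<in>parity_class n. fourier_coeff Q (j + k) * a k)"
      using infsum_reindex_bij_betw[OF parity_class_uminus, of "\<lambda>k. fourier_coeff Q (j + k) * a k" n] by simp
    ultimately have e1: "(\<mu> - of_int j) * b j = fourier_coeff (\<lambda>t. Q t * w1 t) j"
      using eqb[OF j'] by (simp add: infsumI)
    have e2: "fourier_coeff g2 j = \<i> * (\<mu> * b j - fourier_coeff (\<lambda>t. Q t * w1 t) j)"
      unfolding g2_def fourier_coeff_cmult using ints by (simp add: fourier_coeff_diff fourier_coeff_cmult w2(2)[OF j])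
    show ?thesis unfolding e2 e1[symmetric] w2(2)[OF j] by (simp add: algebra_simps)
  qed
  then obtain y2 where y2: "has_AC_deriv y2 g2" "y2 pi = bc_sign (bc_of n) * y2 0" "AE t in leb. y2 t = w2 t"
    by (rule weak_derivative[OF gi(2) ints(2)])
  have c: "continuous_on {0..pi} y1" "continuous_on {0..pi} y2"
    by (rule AC_continuous[OF y1(1)] AC_continuous[OF y2(1)])+
  note L = L2_continuous[OF c(1)] L2_continuous[OF c(2)]
  have ae1: "AE t in leb. - \<i> * (\<mu> * y1 t - P t * y2 t) = g1 t"
    using y1(3) y2(3) unfolding g1_def by eventually_elim simp
  have ae2: "AE t in leb. \<i> * (\<mu> * y2 t - Q t * y1 t) = g2 t"
    using y1(3) y2(3) unfolding g2_def by eventually_elim simp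
  have "L2 g1"
    using gi by (intro L2_AE_cong[OF _ ae1] L2_cmult L2_diff L L2_mult_continuous P c) auto
  have "L2 g2"
    using gi by (intro L2_AE_cong[OF _ ae2] L2_cmult L2_diff L L2_mult_continuous Q c) auto
  have ae: "AE t in leb. \<mu> * y1 t = \<i> * g1 t + P t * y2 t \<and> \<mu> * y2 t = - \<i> * g2 t + Q t * y1 t"
    using ae1 ae2
  proof eventually_elim
    case (elim t)
    show ?case unfolding elim[symmetric] by (simp add: algebra_simps)
  qed
  have "dirac_op P Q (bc_of n) (\<lambda>t. (y1 t, y2 t)) (\<lambda>t. scale2 \<mu> (y1 t, y2 t))"
    unfolding dirac_op_def AE_leb_iff scale2_def fst_conv snd_conv
    by (rule exI[of _ g1], rule exI[of _ g2]) (intro conjI y1 y2 \<open>L2 g1\<close> \<open>L2 g2\<close> ae)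
  moreover have "\<exists>t\<in>{0..pi}. (y1 t, y2 t) \<noteq> 0"
  proof -
    from ab0 obtain j where j: "j \<in> parity_class n" "a j \<noteq> 0 \<or> b j \<noteq> 0" by blast
    have "fourier_coeff w1 (- j) = a j" "fourier_coeff w2 j = b j"
      using w1(2)[of "- j"] w2(2)[of j] j(1) by simp_all
    then have "fourier_coeff y1 (- j) = a j" "fourier_coeff y2 j = b j"
      using fourier_coeff_AE_cong[OF y1(3) L2_measurable[OF L(1)] L2_measurable[OF w1(1)], of "- j"]
        fourier_coeff_AE_cong[OF y2(3) L2_measurable[OF L(2)] L2_measurable[OF w2(1)], of j] by simp_all
    with j(2) have "fourier_coeff y1 (- j) \<noteq> 0 \<or> fourier_coeff y2 j \<noteq> 0" by simp
    then have "(\<exists>t\<in>{0..pi}. y1 t \<noteq> 0) \<or> (\<exists>t\<in>{0..pi}. y2 t \<noteq> 0)"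
      by (elim disj_forward coeff_nonzero_imp_nonzero)
    then show ?thesis by (auto simp: zero_prod_def)
  qed
  ultimately show ?thesis
    unfolding is_eigenvalue_def by (intro exI[of _ "\<lambda>t. (y1 t, y2 t)"] conjI)
qed

subsection \<open>Hilbert--Schmidt estimates\<close>

text \<open>A bracket that never drops below 1, so that the weights stay positive at the resonant
  indices as well.\<close>

definition br :: "int \<Rightarrow> real" where "br a = max 1 \<bar>of_int a\<bar>"

lemma br_ge_1: "1 \<le> br a" and br_pos: "0 < br a" and br_minus: "br (- a) = br a"
  and br_swap: "br (a - b) = br (b - a)" and br_ge_abs: "\<bar>of_int a\<bar> \<le> br a"
  by (auto simp: br_def)

lemma br_triangle: "br (a + b) \<le> br a + br b"
  by (auto simp: br_def)

lemma summable_br: "(\<lambda>a. 1 / (br a * sqrt (br a))) summable_on UNIV"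
proof -
  have "summable (\<lambda>n. 1 / (br (int n) * sqrt (br (int n))))"
  proof (rule summable_cong[THEN iffD1])
    show "summable (\<lambda>n. of_nat n powr (- (3/2)) :: real)" by (subst summable_real_powr_iff) simp
    show "\<forall>\<^sub>F n in sequentially. of_nat n powr (- (3/2)) = 1 / (br (int n) * sqrt (br (int n)))"
      unfolding eventually_sequentially
    proof (intro exI[of _ 1] allI impI)
      fix n :: nat assume n: "n \<ge> 1"
      have "real n powr (3/2) = real n powr 1 * real n powr (1/2)"
        using powr_add[of "real n" 1 "1/2"] by simp
      also have "\<dots> = real n * sqrt (real n)" using n by (simp add: powr_half_sqrt)
      finally show "of_nat n powr (- (3/2)) = 1 / (br (int n) * sqrt (br (int n)))"
        using n by (simp add: br_def powr_minus_divide)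
    qed
  qed
  then have "(\<lambda>n. 1 / (br (int n) * sqrt (br (int n)))) summable_on UNIV"
    by (rule summable_nonneg_imp_summable_on) (simp add: br_def)
  then have 1: "(\<lambda>a. 1 / (br a * sqrt (br a))) summable_on range int"
    by (subst summable_on_reindex) (auto simp: o_def)
  then have "((\<lambda>a. 1 / (br a * sqrt (br a))) \<circ> uminus) summable_on range int"
    by (simp add: o_def br_minus)
  then have 2: "(\<lambda>a. 1 / (br a * sqrt (br a))) summable_on uminus ` range int"
    by (subst summable_on_reindex) auto
  have "UNIV = range int \<union> uminus ` range int"
    by (auto simp: image_iff) (metis int_cases2)
  with summable_on_union[OF 1 2] show ?thesis by simp
qed

definition br_sum :: real where "br_sum = (\<Sum>\<^sub>\<infinity>a. 1 / (br a * sqrt (br a)))"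

lemma br_sum_nonneg: "0 \<le> br_sum"
  unfolding br_sum_def by (rule infsum_nonneg) (simp add: br_def)

text \<open>The larger of the two brackets is at least half of \<open>br (a + b)\<close>. Half a
  power of it is spent on decay in a + b; the other half dominates the square root of the smaller
  bracket, which leaves the summable exponent 3/2.\<close>

lemma inverse_br_product_le:
  "1 / (br a * br b) \<le> 2 / sqrt (br (a + b)) * (1 / (br a * sqrt (br a)) + 1 / (br b * sqrt (br b)))"
proof -
  have aux: "1 / (x * y) \<le> 2 / sqrt m * (1 / (x * sqrt x))" if "0 < x" "x \<le> y" "0 < m" "m \<le> x + y" for x y m :: real
  proof -
    \<comment> \<open>The bound m \<le> 2 y is weakened to 4 y so that the root becomes 2 * sqrt
      y.\<close>
    have "sqrt m \<le> sqrt (2\<^sup>2 * y)" using that by (intro real_sqrt_le_mono) auto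
    then have "sqrt m \<le> 2 * sqrt y" by (simp add: real_sqrt_mult)
    then have "sqrt m * sqrt x \<le> (2 * sqrt y) * sqrt y"
      using that by (intro mult_mono real_sqrt_le_mono) auto
    also have "\<dots> = 2 * y" using that by simp
    finally have "x * (sqrt m * sqrt x) \<le> x * (2 * y)" using that by (intro mult_left_mono) auto
    then have le: "sqrt m * (x * sqrt x) \<le> 2 * (x * y)" by (simp add: mult_ac)
    have p: "0 < sqrt m * (x * sqrt x)" "0 < x * y" using that by auto
    have "1 / (x * y) = 2 / (2 * (x * y))" by simp
    also have "\<dots> \<le> 2 / (sqrt m * (x * sqrt x))" using le p by (intro divide_left_mono) auto
    finally show ?thesis by simp
  qed
  have m: "0 < br (a + b)" "br (a + b) \<le> br a + br b" by (rule br_pos br_triangle)+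
  have nn: "0 \<le> 2 / sqrt (br (a + b)) * (1 / (br c * sqrt (br c)))" for c
    using br_pos[of c] br_pos[of "a + b"] by simp
  show ?thesis
  proof (cases "br a \<le> br b")
    case True
    from aux[OF br_pos True m] nn[of b] show ?thesis unfolding distrib_left by linarith
  next
    case False
    then have "br b \<le> br a" by simp
    moreover have "br (a + b) \<le> br b + br a" using m(2) by simp
    ultimately have "1 / (br b * br a) \<le> 2 / sqrt (br (a + b)) * (1 / (br b * sqrt (br b)))"
      by (intro aux br_pos m(1))
    with nn[of a] show ?thesis
      unfolding distrib_left mult.commute[of "br a" "br b"] by linarith
  qed
qed

section \<open>Families of kernels whose sums tend to zero\<close>

definition vanishing :: "(int \<Rightarrow> int \<times> int \<Rightarrow> real) \<Rightarrow> bool" where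
  "vanishing F \<longleftrightarrow> (\<forall>N p. 0 \<le> F N p) \<and>
     (\<forall>e>0. \<exists>N0. \<forall>N. N0 \<le> \<bar>N\<bar> \<longrightarrow> F N summable_on UNIV \<and> infsum (F N) UNIV \<le> e)"

lemma vanishingD:
  assumes "vanishing F" "e > 0"
  obtains N0 where "\<And>N. N0 \<le> \<bar>N\<bar> \<Longrightarrow> F N summable_on UNIV" "\<And>N. N0 \<le> \<bar>N\<bar> \<Longrightarrow> infsum (F N) UNIV \<le> e"
  using assms unfolding vanishing_def by meson

lemma vanishing_nonneg: "vanishing F \<Longrightarrow> 0 \<le> F N p"
  unfolding vanishing_def by (elim conjE allE)

lemma vanishing_add:
  assumes F: "vanishing F" and G: "vanishing G" shows "vanishing (\<lambda>N p. F N p + G N p)"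
  unfolding vanishing_def
proof (intro conjI allI impI)
  show "0 \<le> F N p + G N p" for N p using vanishing_nonneg[OF F] vanishing_nonneg[OF G] by simp
  fix e :: real assume "e > 0"
  then have e: "e / 2 > 0" by simp
  obtain N1 where N1: "\<And>N. N1 \<le> \<bar>N\<bar> \<Longrightarrow> F N summable_on UNIV" "\<And>N. N1 \<le> \<bar>N\<bar> \<Longrightarrow> infsum (F N) UNIV \<le> e / 2"
    by (rule vanishingD[OF F e]) (rule that)
  obtain N2 where N2: "\<And>N. N2 \<le> \<bar>N\<bar> \<Longrightarrow> G N summable_on UNIV" "\<And>N. N2 \<le> \<bar>N\<bar> \<Longrightarrow> infsum (G N) UNIV \<le> e / 2"
    by (rule vanishingD[OF G e]) (rule that)
  show "\<exists>N0. \<forall>N. N0 \<le> \<bar>N\<bar> \<longrightarrow> (\<lambda>p. F N p + G N p) summable_on UNIV \<and> (\<Sum>\<^sub>\<infinity>p. F N p + G N p) \<le> e"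
  proof (intro exI[of _ "max N1 N2"] allI impI conjI)
    fix N assume "max N1 N2 \<le> \<bar>N\<bar>"
    then have N: "N1 \<le> \<bar>N\<bar>" "N2 \<le> \<bar>N\<bar>" by auto
    show "(\<lambda>p. F N p + G N p) summable_on UNIV" by (intro summable_on_add N1 N2 N)
    show "(\<Sum>\<^sub>\<infinity>p. F N p + G N p) \<le> e"
      using N1(2)[OF N(1)] N2(2)[OF N(2)] infsum_add[OF N1(1)[OF N(1)] N2(1)[OF N(2)]] by simp
  qed
qed

lemma vanishing_reindex:
  assumes F: "vanishing F" and \<sigma>: "\<And>N. bij (\<sigma> N)" and k: "\<And>N. \<bar>N\<bar> \<le> \<bar>k N\<bar>"
  shows "vanishing (\<lambda>N p. F (k N) (\<sigma> N p))"
  unfolding vanishing_def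
proof (intro conjI allI impI)
  show "0 \<le> F (k N) (\<sigma> N p)" for N p by (rule vanishing_nonneg[OF F])
  fix e :: real assume e: "e > 0"
  obtain N1 where N1: "\<And>N. N1 \<le> \<bar>N\<bar> \<Longrightarrow> F N summable_on UNIV" "\<And>N. N1 \<le> \<bar>N\<bar> \<Longrightarrow> infsum (F N) UNIV \<le> e"
    by (rule vanishingD[OF F e]) (rule that)
  show "\<exists>N0. \<forall>N. N0 \<le> \<bar>N\<bar> \<longrightarrow> (\<lambda>p. F (k N) (\<sigma> N p)) summable_on UNIV \<and> (\<Sum>\<^sub>\<infinity>p. F (k N) (\<sigma> N p)) \<le> e"
  proof (intro exI[of _ N1] allI impI conjI)
    fix N assume "N1 \<le> \<bar>N\<bar>"
    then have N: "N1 \<le> \<bar>k N\<bar>" using k[of N] by simp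
    show "(\<lambda>p. F (k N) (\<sigma> N p)) summable_on UNIV"
      by (rule summable_on_reindex_bij_betw[OF \<sigma>, THEN iffD2, OF N1(1)[OF N]])
    show "(\<Sum>\<^sub>\<infinity>p. F (k N) (\<sigma> N p)) \<le> e"
      unfolding infsum_reindex_bij_betw[OF \<sigma>] by (rule N1(2)[OF N])
  qed
qed

lemma vanishing_bound:
  assumes F0: "\<And>N p. 0 \<le> F N p" and s: "\<And>N. F N summable_on UNIV"
    and le: "\<And>N. infsum (F N) UNIV \<le> w N"
    and w: "\<And>e. e > 0 \<Longrightarrow> \<exists>N0. \<forall>N. N0 \<le> \<bar>N\<bar> \<longrightarrow> w N \<le> e"
  shows "vanishing F"
  unfolding vanishing_def
proof (intro conjI allI impI F0)
  fix e :: real assume "e > 0"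
  from w[OF this] obtain N0 where "\<forall>N. N0 \<le> \<bar>N\<bar> \<longrightarrow> w N \<le> e" by blast
  then show "\<exists>N0. \<forall>N. N0 \<le> \<bar>N\<bar> \<longrightarrow> F N summable_on UNIV \<and> infsum (F N) UNIV \<le> e"
    using s le order_trans by (intro exI[of _ N0]) fast
qed

lemma inverse_sqrt_br_small:
  assumes e: "e > 0" shows "\<exists>N0. \<forall>N. N0 \<le> \<bar>N\<bar> \<longrightarrow> 1 / sqrt (br N) \<le> e"
proof (intro exI[of _ "\<lceil>1 / e\<^sup>2\<rceil>"] allI impI)
  fix N assume "\<lceil>1 / e\<^sup>2\<rceil> \<le> \<bar>N\<bar>"
  then have "1 / e\<^sup>2 \<le> of_int \<bar>N\<bar>" by (simp only: ceiling_le_iff)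
  then have "1 / e\<^sup>2 \<le> br N" using br_ge_abs[of N] by simp
  then have "sqrt (1 / e\<^sup>2) \<le> sqrt (br N)" by (rule real_sqrt_le_mono)
  then have "1 / e \<le> sqrt (br N)" using e by (simp add: real_sqrt_divide)
  then show "1 / sqrt (br N) \<le> e" using e br_pos[of N] by (simp add: field_simps)
qed

context
  fixes B :: "int \<Rightarrow> real"
  assumes B0: "\<And>m. 0 \<le> B m" and B: "B summable_on UNIV"
begin

lemma B_shift_summable: "(\<lambda>m. B (m + N)) summable_on UNIV"
proof -
  have "bij (\<lambda>m. m + N)" by (rule bij_betw_byWitness[where f' = "\<lambda>m. m - N"]) auto
  from summable_on_reindex_bij_betw[OF this, THEN iffD2, OF B] show ?thesis .
qed

lemma B_weighted_summable: "(\<lambda>m. B (m + N) / sqrt (br m)) summable_on UNIV"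
  using B_shift_summable[of N]
proof (rule summable_on_comparison_test)
  fix m
  have "1 \<le> sqrt (br m)" using br_ge_1[of m] by simp
  then have "B (m + N) / sqrt (br m) \<le> B (m + N) / 1" using B0 by (intro divide_left_mono) auto
  then show "B (m + N) / sqrt (br m) \<le> B (m + N)" by simp
qed (use B0 br_pos in \<open>auto intro!: divide_nonneg_nonneg simp: less_imp_le\<close>)

text \<open>Most of the mass of \<open>B\<close> lies in a bounded set. For large |N| the terms with
  \<open>m + N\<close> in that set have large |m| and hence a small weight, and the remaining terms
  carry little mass.\<close>

lemma B_weighted_small:
  assumes e: "e > 0"
  shows "\<exists>N0. \<forall>N. N0 \<le> \<bar>N\<bar> \<longrightarrow> (\<Sum>\<^sub>\<infinity>m. B (m + N) / sqrt (br m)) \<le> e"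
proof -
  define b where "b = infsum B UNIV"
  have b: "0 \<le> b" unfolding b_def by (rule infsum_nonneg) (rule B0)
  have e2: "e / 2 > 0" using e by simp
  obtain K :: nat where K: "\<And>X. finite X \<Longrightarrow> X \<subseteq> UNIV - {- int K..int K} \<Longrightarrow> sum B X < e / 2"
    by (rule tail_small[OF B B0 e2]) (rule that)
  have "e / (2 * (b + 1)) > 0" using e b by simp
  from inverse_sqrt_br_small[OF this] obtain N1 where N1: "\<And>N. N1 \<le> \<bar>N\<bar> \<Longrightarrow> 1 / sqrt (br N) \<le> e / (2 * (b + 1))"
    by blast
  show ?thesis
  proof (intro exI[of _ "N1 + int K"] allI impI)
    fix N assume N: "N1 + int K \<le> \<bar>N\<bar>"
    let ?S = "{m. \<bar>m + N\<bar> \<le> int K}"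
    have "(\<Sum>m\<in>X. B (m + N) / sqrt (br m)) \<le> e" if X: "finite X" for X
    proof -
      have "(\<Sum>m\<in>X. B (m + N) / sqrt (br m))
          = (\<Sum>m\<in>X \<inter> ?S. B (m + N) / sqrt (br m)) + (\<Sum>m\<in>X - ?S. B (m + N) / sqrt (br m))"
        using sum.Int_Diff[OF X] .
      also have "(\<Sum>m\<in>X \<inter> ?S. B (m + N) / sqrt (br m)) \<le> (\<Sum>m\<in>X \<inter> ?S. B (m + N) * (e / (2 * (b + 1))))"
      proof (rule sum_mono)
        fix m assume "m \<in> X \<inter> ?S"
        then have "N1 \<le> \<bar>m\<bar>" using N by auto
        from mult_left_mono[OF N1[OF this] B0[of "m + N"]]
        show "B (m + N) / sqrt (br m) \<le> B (m + N) * (e / (2 * (b + 1)))" by simp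
      qed
      also have "\<dots> = (\<Sum>m\<in>X \<inter> ?S. B (m + N)) * (e / (2 * (b + 1)))" by (rule sum_distrib_right[symmetric])
      also have "\<dots> \<le> b * (e / (2 * (b + 1)))"
      proof (rule mult_right_mono)
        have inj: "inj_on (\<lambda>m. m + N) (X \<inter> ?S)" by (auto simp: inj_on_def)
        have "(\<Sum>m\<in>X \<inter> ?S. B (m + N)) = sum B ((\<lambda>m. m + N) ` (X \<inter> ?S))"
          by (subst sum.reindex[OF inj]) simp
        also have "\<dots> \<le> b" unfolding b_def using X B0 by (intro finite_sum_le_infsum B) auto
        finally show "(\<Sum>m\<in>X \<inter> ?S. B (m + N)) \<le> b" .
      qed (use e b in simp)
      also have "b * (e / (2 * (b + 1))) \<le> e / 2"
      proof -
        have "(e / 2) * (b / (b + 1)) \<le> (e / 2) * 1" using b e by (intro mult_left_mono) auto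
        then show ?thesis by (simp add: mult.commute)
      qed
      also have "(\<Sum>m\<in>X - ?S. B (m + N) / sqrt (br m)) \<le> (\<Sum>m\<in>X - ?S. B (m + N))"
      proof (rule sum_mono)
        fix m
        have "1 \<le> sqrt (br m)" using br_ge_1[of m] by simp
        then have "B (m + N) / sqrt (br m) \<le> B (m + N) / 1" using B0 by (intro divide_left_mono) auto
        then show "B (m + N) / sqrt (br m) \<le> B (m + N)" by simp
      qed
      also have "\<dots> = sum B ((\<lambda>m. m + N) ` (X - ?S))"
        by (subst sum.reindex) (auto simp: inj_on_def)
      also have "\<dots> < e / 2" using X by (intro K) auto
      finally show ?thesis by simp
    qed
    then show "(\<Sum>\<^sub>\<infinity>m. B (m + N) / sqrt (br m)) \<le> e"
      by (intro infsum_le_finite_sums B_weighted_summable) auto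
  qed
qed

text \<open>By \<open>inverse_br_product_le\<close> and the substitution m = a + b the majorant
  splits into two double sums, each of which factors into \<open>br_sum\<close> and the weighted sum
  of \<open>B_weighted_small\<close>.\<close>

lemma vanishing_convolution: "vanishing (\<lambda>N (a, b). B (a + b + N) / (br a * br b))"
proof (rule vanishing_bound)
  let ?s = "\<lambda>a. 1 / (br a * sqrt (br a))"
  define w where "w N = (\<Sum>\<^sub>\<infinity>m. B (m + N) / sqrt (br m))" for N
  define F where "F N = (\<lambda>(a, b). B (a + b + N) / (br a * br b))" for N
  have s0: "0 \<le> ?s a" for a using br_pos[of a] by simp
  have t0: "0 \<le> B (m + N) / sqrt (br m)" for m N using br_pos[of m] B0 by simp
  have prod: "((\<lambda>(a, m). ?s a * (B (m + N) / sqrt (br m))) has_sum (br_sum * w N)) (UNIV \<times> UNIV)" for N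
  proof (rule has_sum_SigmaI)
    have i: "((\<lambda>m. ?s a * (B (m + N) / sqrt (br m))) has_sum (?s a * w N)) UNIV" for a
      unfolding w_def by (intro has_sum_cmult_right has_sum_infsum B_weighted_summable)
    then show "((\<lambda>y. case (a, y) of (a, m) \<Rightarrow> ?s a * (B (m + N) / sqrt (br m))) has_sum (?s a * w N)) UNIV" for a
      by simp
    show o: "((\<lambda>a. ?s a * w N) has_sum (br_sum * w N)) UNIV"
      unfolding br_sum_def by (intro has_sum_cmult_left has_sum_infsum summable_br)
    show "(\<lambda>(a, m). ?s a * (B (m + N) / sqrt (br m))) summable_on UNIV \<times> UNIV"
    proof (rule summable_on_SigmaI)
      show "((\<lambda>y. case (a, y) of (a, m) \<Rightarrow> ?s a * (B (m + N) / sqrt (br m))) has_sum (?s a * w N)) UNIV" for a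
        using i by simp
      show "(\<lambda>a. ?s a * w N) summable_on UNIV" using o by (rule has_sum_imp_summable)
      show "0 \<le> (case (a, m) of (a, m) \<Rightarrow> ?s a * (B (m + N) / sqrt (br m)))" for a m
        using mult_nonneg_nonneg[OF s0 t0] by simp
    qed
  qed
  have b1: "bij (\<lambda>(a, b). (a, a + b) :: int \<times> int)"
    by (rule bij_betw_byWitness[where f' = "\<lambda>(a, m). (a, m - a)"]) auto
  have b2: "bij (\<lambda>(a, b). (b, a + b) :: int \<times> int)"
    by (rule bij_betw_byWitness[where f' = "\<lambda>(b, m). (m - b, b)"]) auto
  have h1: "((\<lambda>(a, b). ?s a * (B (a + b + N) / sqrt (br (a + b)))) has_sum (br_sum * w N)) UNIV" for N
    using prod[of N] has_sum_reindex_bij_betw[OF b1, of "\<lambda>(a, m). ?s a * (B (m + N) / sqrt (br m))"]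
    by (simp add: case_prod_unfold)
  have h2: "((\<lambda>(a, b). ?s b * (B (a + b + N) / sqrt (br (a + b)))) has_sum (br_sum * w N)) UNIV" for N
    using prod[of N] has_sum_reindex_bij_betw[OF b2, of "\<lambda>(a, m). ?s a * (B (m + N) / sqrt (br m))"]
    by (simp add: case_prod_unfold)
  have h: "((\<lambda>p. 2 * ((\<lambda>(a, b). ?s a * (B (a + b + N) / sqrt (br (a + b)))) p
      + (\<lambda>(a, b). ?s b * (B (a + b + N) / sqrt (br (a + b)))) p)) has_sum (2 * (br_sum * w N + br_sum * w N))) UNIV" for N
    by (intro has_sum_cmult_right has_sum_add h1 h2)
  have le: "F N p \<le> 2 * ((\<lambda>(a, b). ?s a * (B (a + b + N) / sqrt (br (a + b)))) p
      + (\<lambda>(a, b). ?s b * (B (a + b + N) / sqrt (br (a + b)))) p)" for N p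
  proof -
    obtain a b where p: "p = (a, b)" by (cases p)
    from mult_left_mono[OF inverse_br_product_le[of a b] B0[of "a + b + N"]]
    show ?thesis unfolding p F_def by (simp add: algebra_simps)
  qed
  show F0: "0 \<le> (\<lambda>(a, b). B (a + b + N) / (br a * br b)) p" for N p
    using br_pos B0 by (cases p) (simp add: less_imp_le)
  show s: "(\<lambda>(a, b). B (a + b + N) / (br a * br b)) summable_on UNIV" for N
    unfolding F_def[symmetric]
    by (rule summable_on_comparison_test[OF has_sum_imp_summable[OF h] le]) (unfold F_def, rule F0)
  show "(\<Sum>\<^sub>\<infinity>(a, b). B (a + b + N) / (br a * br b)) \<le> 2 * (br_sum * w N + br_sum * w N)" for N
    using has_sum_mono[OF has_sum_infsum[OF s] h le[unfolded F_def]] .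
  fix e :: real assume e: "e > 0"
  have "e / (4 * (br_sum + 1)) > 0" using e br_sum_nonneg by simp
  from B_weighted_small[OF this] obtain N0 where N0: "\<And>N. N0 \<le> \<bar>N\<bar> \<Longrightarrow> w N \<le> e / (4 * (br_sum + 1))"
    unfolding w_def by blast
  show "\<exists>N0. \<forall>N. N0 \<le> \<bar>N\<bar> \<longrightarrow> 2 * (br_sum * w N + br_sum * w N) \<le> e"
  proof (intro exI[of _ N0] allI impI)
    fix N assume "N0 \<le> \<bar>N\<bar>"
    from N0[OF this] have "(br_sum + 1) * w N \<le> e / 4" using br_sum_nonneg by (simp add: field_simps)
    moreover have "0 \<le> w N" unfolding w_def by (intro infsum_nonneg t0)
    ultimately show "2 * (br_sum * w N + br_sum * w N) \<le> e" by (simp add: algebra_simps)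
  qed
qed

text \<open>For fixed j the sum over i is the total mass of \<open>B\<close>. What remains is a sum
  over j of order 1 / sqrt (br (2 * N)), because \<open>(N - j) + (N + j) = 2 * N\<close>.\<close>

lemma vanishing_diagonal: "vanishing (\<lambda>N (i, j). B (i - j) / (br (N - j) * br (N + j)))"
proof (rule vanishing_bound)
  let ?s = "\<lambda>a. 1 / (br a * sqrt (br a))"
  define b where "b = infsum B UNIV"
  have b: "0 \<le> b" unfolding b_def by (rule infsum_nonneg) (rule B0)
  have bi1: "bij (\<lambda>j. N - j)" for N :: int by (rule bij_betw_byWitness[where f' = "\<lambda>j. N - j"]) auto
  have bi2: "bij (\<lambda>j. N + j)" for N :: int by (rule bij_betw_byWitness[where f' = "\<lambda>j. j - N"]) auto
  have "(?s has_sum br_sum) UNIV" unfolding br_sum_def by (intro has_sum_infsum summable_br)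
  then have h: "((\<lambda>j. 2 / sqrt (br (2 * N)) * (?s (N - j) + ?s (N + j))) has_sum (2 / sqrt (br (2 * N)) * (br_sum + br_sum))) UNIV"
    for N :: int
    by (intro has_sum_cmult_right has_sum_add has_sum_reindex_bij_betw[OF bi1, THEN iffD2]
        has_sum_reindex_bij_betw[OF bi2, THEN iffD2])
  have le: "1 / (br (N - j) * br (N + j)) \<le> 2 / sqrt (br (2 * N)) * (?s (N - j) + ?s (N + j))" for N j
    using inverse_br_product_le[of "N - j" "N + j"] by simp
  have nn: "0 \<le> 1 / (br (N - j) * br (N + j))" for N j using br_pos[of "N - j"] br_pos[of "N + j"] by simp
  have sj: "(\<lambda>j. 1 / (br (N - j) * br (N + j))) summable_on UNIV" for N
    by (rule summable_on_comparison_test[OF has_sum_imp_summable[OF h] le nn])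
  have Sj: "(\<Sum>\<^sub>\<infinity>j. 1 / (br (N - j) * br (N + j))) \<le> 2 / sqrt (br (2 * N)) * (br_sum + br_sum)" for N
    by (rule has_sum_mono[OF has_sum_infsum[OF sj] h le])
  have bij: "bij (\<lambda>(j, m). (m + j, j) :: int \<times> int)"
    by (rule bij_betw_byWitness[where f' = "\<lambda>(i, j). (j, i - j)"]) auto
  have i: "((\<lambda>m. B m / (br (N - j) * br (N + j))) has_sum (1 / (br (N - j) * br (N + j)) * b)) UNIV" for N j
    using has_sum_cmult_right[OF has_sum_infsum[OF B], of "1 / (br (N - j) * br (N + j))"] by (simp add: b_def)
  have P: "((\<lambda>(j, m). B m / (br (N - j) * br (N + j))) has_sum ((\<Sum>\<^sub>\<infinity>j. 1 / (br (N - j) * br (N + j))) * b)) (UNIV \<times> UNIV)" for N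
  proof (rule has_sum_SigmaI)
    show "((\<lambda>m. case (j, m) of (j, m) \<Rightarrow> B m / (br (N - j) * br (N + j))) has_sum (1 / (br (N - j) * br (N + j)) * b)) UNIV" for j
      using i by simp
    show o: "((\<lambda>j. 1 / (br (N - j) * br (N + j)) * b) has_sum ((\<Sum>\<^sub>\<infinity>j. 1 / (br (N - j) * br (N + j))) * b)) UNIV"
      by (intro has_sum_cmult_left has_sum_infsum sj)
    show "(\<lambda>(j, m). B m / (br (N - j) * br (N + j))) summable_on UNIV \<times> UNIV"
    proof (rule summable_on_SigmaI)
      show "((\<lambda>m. case (j, m) of (j, m) \<Rightarrow> B m / (br (N - j) * br (N + j))) has_sum (1 / (br (N - j) * br (N + j)) * b)) UNIV" for j
        using i by simp
      show "(\<lambda>j. 1 / (br (N - j) * br (N + j)) * b) summable_on UNIV" using o by (rule has_sum_imp_summable)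
      show "0 \<le> (case (j, m) of (j, m) \<Rightarrow> B m / (br (N - j) * br (N + j)))" for j m
        using mult_nonneg_nonneg[OF B0 nn, of m N j] by simp
    qed
  qed
  have Q: "((\<lambda>(i, j). B (i - j) / (br (N - j) * br (N + j))) has_sum ((\<Sum>\<^sub>\<infinity>j. 1 / (br (N - j) * br (N + j))) * b)) UNIV" for N
    using P[of N] has_sum_reindex_bij_betw[OF bij, of "\<lambda>(i, j). B (i - j) / (br (N - j) * br (N + j))"]
    by (simp add: case_prod_unfold)
  show "0 \<le> (\<lambda>(i, j). B (i - j) / (br (N - j) * br (N + j))) p" for N p
    using br_pos B0 by (cases p) (simp add: less_imp_le)
  show "(\<lambda>(i, j). B (i - j) / (br (N - j) * br (N + j))) summable_on UNIV" for N
    by (rule has_sum_imp_summable[OF Q])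
  show "(\<Sum>\<^sub>\<infinity>(i, j). B (i - j) / (br (N - j) * br (N + j))) \<le> (2 / sqrt (br (2 * N)) * (br_sum + br_sum)) * b" for N
    unfolding infsumI[OF Q] by (rule mult_right_mono[OF Sj b])
  fix e :: real assume e: "e > 0"
  have "e / (4 * br_sum * b + 1) > 0" using e br_sum_nonneg b by (simp add: add_nonneg_pos)
  from inverse_sqrt_br_small[OF this] obtain N0 where N0: "\<And>N. N0 \<le> \<bar>N\<bar> \<Longrightarrow> 1 / sqrt (br N) \<le> e / (4 * br_sum * b + 1)"
    by blast
  show "\<exists>N0. \<forall>N. N0 \<le> \<bar>N\<bar> \<longrightarrow> (2 / sqrt (br (2 * N)) * (br_sum + br_sum)) * b \<le> e"
  proof (intro exI[of _ N0] allI impI)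
    fix N assume "N0 \<le> \<bar>N\<bar>"
    then have "N0 \<le> \<bar>2 * N\<bar>" by simp
    moreover have "0 < 4 * br_sum * b + 1" using br_sum_nonneg b by (simp add: add_nonneg_pos)
    ultimately have "1 / sqrt (br (2 * N)) * (4 * br_sum * b + 1) \<le> e"
      using N0[of "2 * N"] by (simp add: pos_le_divide_eq)
    moreover have "0 \<le> 1 / sqrt (br (2 * N))" using br_pos[of "2 * N"] by simp
    moreover have "(2 / sqrt (br (2 * N)) * (br_sum + br_sum)) * b
        = 1 / sqrt (br (2 * N)) * (4 * br_sum * b + 1) - 1 / sqrt (br (2 * N))"
      by (simp add: algebra_simps)
    ultimately show "(2 / sqrt (br (2 * N)) * (br_sum + br_sum)) * b \<le> e" by linarith
  qed
qed

end

text \<open>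
  Majorants of \<open>|A i j|\<^sup>2 / (h i * h j)\<close> for both operators; for the Hill operator
  \<open>i - j = (i - n) - (j - n) = (i + n) - (j + n)\<close> is estimated in both ways.
\<close>

lemma vanishing_dirac:
  assumes "\<And>m. 0 \<le> B m" "B summable_on UNIV"
  shows "vanishing (\<lambda>n (i, j). B (i + j) / (br (n - i) * br (n - j)))"
proof -
  have "bij (\<lambda>(i, j). (i - n, j - n))" for n :: int
    by (rule bij_betw_byWitness[where f' = "\<lambda>(a, b). (a + n, b + n)"]) auto
  from vanishing_reindex[OF vanishing_convolution[OF assms] this, of "\<lambda>n. 2 * n"]
  have "vanishing (\<lambda>n p. (\<lambda>(a, b). B (a + b + 2 * n) / (br a * br b)) ((\<lambda>(i, j). (i - n, j - n)) p))"
    by simp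
  moreover have "(\<lambda>(a, b). B (a + b + 2 * n) / (br a * br b)) ((\<lambda>(i, j). (i - n, j - n)) p)
      = (\<lambda>(i, j). B (i + j) / (br (n - i) * br (n - j))) p" for n p
    by (cases p) (simp add: br_swap[of n])
  ultimately show ?thesis by simp
qed

lemma vanishing_hill:
  assumes "\<And>m. 0 \<le> B m" "B summable_on UNIV"
  shows "vanishing (\<lambda>n (i, j). B (i - j) * (1 / (br (n - j) * br (n + j)) + 1 / (br (n - i) * br (n + i))
     + 1 / (br (n + i) * br (n - j)) + 1 / (br (n - i) * br (n + j))))"
proof -
  have B': "0 \<le> B (- m)" "(\<lambda>m. B (- m)) summable_on UNIV" for m
    using assms(1) summable_on_reindex_bij_betw[of uminus UNIV UNIV B, THEN iffD2, OF _ assms(2)]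
    by (auto intro: bij_uminus)
  have swap: "bij (\<lambda>(i, j). (j, i) :: int \<times> int)"
    by (rule bij_betw_byWitness[where f' = "\<lambda>(i, j). (j, i)"]) auto
  note D1 = vanishing_diagonal[OF assms]
  note D2 = vanishing_reindex[OF vanishing_diagonal[OF B'] swap, of "\<lambda>n. n", OF order_refl]
  \<comment> \<open>The sum of the new coordinates is \<open>i - j + 2 * n\<close> here and
    \<open>i - j - 2 * n\<close> in \<open>b4\<close>; the shifts \<open>- (2 * n)\<close> and
    \<open>2 * n\<close> restore the argument \<open>i - j\<close> of \<open>B\<close>, and the
    brackets become the mixed products.\<close>
  have b3: "bij (\<lambda>(i, j). (i + n, n - j))" for n :: int
    by (rule bij_betw_byWitness[where f' = "\<lambda>(a, b). (a - n, n - b)"]) auto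
  have b4: "bij (\<lambda>(i, j). (i - n, - n - j))" for n :: int
    by (rule bij_betw_byWitness[where f' = "\<lambda>(a, b). (a + n, - n - b)"]) auto
  have k3: "\<bar>n\<bar> \<le> \<bar>- (2 * n)\<bar>" and k4: "\<bar>n\<bar> \<le> \<bar>2 * n\<bar>" for n :: int by auto
  note D3 = vanishing_reindex[OF vanishing_convolution[OF assms] b3, of "\<lambda>n. - (2 * n)", OF k3]
  note D4 = vanishing_reindex[OF vanishing_convolution[OF assms] b4, of "\<lambda>n. 2 * n", OF k4]
  have br4: "br (- n - j) = br (n + j)" for n j using br_minus[of "n + j"] by simp
  have "vanishing (\<lambda>n p. (\<lambda>(i, j). B (i - j) / (br (n - j) * br (n + j))) p
      + (\<lambda>(i, j). B (- (i - j)) / (br (n - j) * br (n + j))) ((\<lambda>(i, j). (j, i)) p)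
      + (\<lambda>(a, b). B (a + b + - (2 * n)) / (br a * br b)) ((\<lambda>(i, j). (i + n, n - j)) p)
      + (\<lambda>(a, b). B (a + b + 2 * n) / (br a * br b)) ((\<lambda>(i, j). (i - n, - n - j)) p))"
    by (intro vanishing_add D1 D2 D3 D4)
  moreover have "(\<lambda>(i, j). B (i - j) / (br (n - j) * br (n + j))) p
      + (\<lambda>(i, j). B (- (i - j)) / (br (n - j) * br (n + j))) ((\<lambda>(i, j). (j, i)) p)
      + (\<lambda>(a, b). B (a + b + - (2 * n)) / (br a * br b)) ((\<lambda>(i, j). (i + n, n - j)) p)
      + (\<lambda>(a, b). B (a + b + 2 * n) / (br a * br b)) ((\<lambda>(i, j). (i - n, - n - j)) p)
    = (\<lambda>(i, j). B (i - j) * (1 / (br (n - j) * br (n + j)) + 1 / (br (n - i) * br (n + i))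
     + 1 / (br (n + i) * br (n - j)) + 1 / (br (n - i) * br (n + j)))) p" for n p
  proof -
    obtain i j where p: "p = (i, j)" by (cases p)
    have "i + n + (n - j) + - (2 * n) = i - j" "i - n + (- n - j) + 2 * n = i - j" by auto
    then show ?thesis unfolding p prod.case br4 br_swap[of n i] add.commute[of n i]
      by (simp add: algebra_simps)
  qed
  ultimately show ?thesis by simp
qed

text \<open>The square on the left comes from V(m) = i m q(m). Each product in the expansion of the
  two bounds for |i - j| cancels two of the four brackets, so that two brackets survive in every
  term.\<close>

lemma hill_kernel_le:
  assumes "1 \<le> n"
  shows "(of_int (i - j))\<^sup>2 / ((br (n - i) * br (n + i)) * (br (n - j) * br (n + j)))
    \<le> 1 / (br (n - j) * br (n + j)) + 1 / (br (n - i) * br (n + i))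
     + 1 / (br (n + i) * br (n - j)) + 1 / (br (n - i) * br (n + j))"
proof -
  let ?a = "br (n - i)" and ?b = "br (n + i)" and ?c = "br (n - j)" and ?d = "br (n + j)"
  have p: "0 < ?a" "0 < ?b" "0 < ?c" "0 < ?d" by (rule br_pos)+
  have 1: "\<bar>real_of_int (i - j)\<bar> \<le> ?a + ?c"
    using br_ge_abs[of "n - i"] br_ge_abs[of "n - j"] by linarith
  have 2: "\<bar>real_of_int (i - j)\<bar> \<le> ?b + ?d"
    using br_ge_abs[of "n + i"] br_ge_abs[of "n + j"] by linarith
  have "(of_int (i - j))\<^sup>2 = \<bar>real_of_int (i - j)\<bar> * \<bar>real_of_int (i - j)\<bar>"
    by (simp only: power2_eq_square abs_mult_self_eq)
  also have "\<dots> \<le> (?a + ?c) * (?b + ?d)" using p by (intro mult_mono 1 2) auto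
  finally have "(of_int (i - j))\<^sup>2 / ((?a * ?b) * (?c * ?d)) \<le> ((?a + ?c) * (?b + ?d)) / ((?a * ?b) * (?c * ?d))"
    using p by (intro divide_right_mono) auto
  also have "\<dots> = 1 / (?c * ?d) + 1 / (?a * ?b) + 1 / (?b * ?c) + 1 / (?a * ?d)"
    using p by (simp add: divide_simps) (simp add: algebra_simps)
  finally show ?thesis .
qed

section \<open>Hilbert--Schmidt norms of the two operators\<close>

lemma summable_on_UNIV_parity:
  assumes "f summable_on parity_class 0"
  shows "(\<lambda>m. if even m then f m else (0::real)) summable_on UNIV"
  using assms by (rule summable_on_cong_neutral[THEN iffD1, rotated -1]) auto

lemma hill_HS:
  assumes q: "L2 q" and e: "e > 0"
  shows "\<exists>N0. \<forall>n. N0 \<le> n \<and> 1 \<le> n \<longrightarrow>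
    (\<lambda>(i, j). (cmod (hill_coeff C q (i - j)))\<^sup>2 / ((br (n - i) * br (n + i)) * (br (n - j) * br (n + j))))
      summable_on parity_class n \<times> parity_class n \<and>
    (\<Sum>\<^sub>\<infinity>(i, j)\<in>parity_class n \<times> parity_class n.
      (cmod (hill_coeff C q (i - j)))\<^sup>2 / ((br (n - i) * br (n + i)) * (br (n - j) * br (n + j)))) \<le> e"
proof -
  define B where "B m = (if even m then (cmod (fourier_coeff q m))\<^sup>2 else 0) + (if m = 0 then (cmod C)\<^sup>2 else 0)" for m
  have B0: "0 \<le> B m" for m by (simp add: B_def)
  have "(\<lambda>m::int. if m = 0 then (cmod C)\<^sup>2 else 0) summable_on UNIV"
    by (rule finite_nonzero_values_imp_summable_on, rule finite_subset[of _ "{0}"]) auto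
  then have B: "B summable_on UNIV"
    unfolding B_def by (intro summable_on_add summable_on_UNIV_parity Bessel q)
  define T where "T n = (\<lambda>(i, j). B (i - j) * (1 / (br (n - j) * br (n + j)) + 1 / (br (n - i) * br (n + i))
     + 1 / (br (n + i) * br (n - j)) + 1 / (br (n - i) * br (n + j))))" for n
  have "vanishing T" unfolding T_def by (rule vanishing_hill[OF B0 B])
  then obtain N0 where N0: "\<And>n. N0 \<le> \<bar>n\<bar> \<Longrightarrow> T n summable_on UNIV" "\<And>n. N0 \<le> \<bar>n\<bar> \<Longrightarrow> infsum (T n) UNIV \<le> e"
    by (rule vanishingD[OF _ e]) (rule that)
  show ?thesis
  proof (intro exI[of _ N0] allI impI)
    fix n :: int assume n: "N0 \<le> n \<and> 1 \<le> n"
    let ?K = "\<lambda>(i, j). (cmod (hill_coeff C q (i - j)))\<^sup>2 / ((br (n - i) * br (n + i)) * (br (n - j) * br (n + j)))"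
    let ?E = "parity_class n \<times> parity_class n"
    have K0: "0 \<le> ?K p" for p using br_pos by (cases p) (simp add: less_imp_le)
    have T0: "0 \<le> T n p" for p using \<open>vanishing T\<close> by (rule vanishing_nonneg)
    have le: "?K p \<le> T n p" if pE: "p \<in> ?E" for p
    proof -
      obtain i j where p: "p = (i, j)" and ev: "even (i - j)" using pE by auto
      let ?H = "(br (n - i) * br (n + i)) * (br (n - j) * br (n + j))"
      have H: "0 < ?H" using br_pos by simp
      define R where "R = 1 / (br (n - j) * br (n + j)) + 1 / (br (n - i) * br (n + i))
     + 1 / (br (n + i) * br (n - j)) + 1 / (br (n - i) * br (n + j))"
      have T: "T n (i, j) = B (i - j) * R" by (simp add: T_def R_def)
      show ?thesis
      proof (cases "i = j")
        \<comment> \<open>On the diagonal the entry is the constant \<open>C\<close>, without a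
          factor i - j. The first summand of \<open>R\<close> suffices here because the brackets are
          at least 1.\<close>
        case True
        have g1: "1 \<le> br (n - j) * br (n + j)"
          using mult_mono[OF br_ge_1[of "n - j"] br_ge_1[of "n + j"]] br_pos[of "n - j"] by simp
        have "1 / ?H \<le> 1 / (br (n - j) * br (n + j))"
          using g1 True mult_left_mono[OF g1, of "br (n - j) * br (n + j)"]
          by (intro divide_left_mono) simp_all
        also have "\<dots> \<le> R"
        proof -
          have "0 \<le> 1 / (br a * br b)" for a b using br_pos[of a] br_pos[of b] by simp
          then show ?thesis unfolding R_def by (simp add: add.assoc)
        qed
        finally have "(cmod C)\<^sup>2 * (1 / ?H) \<le> (cmod C)\<^sup>2 * R" by (rule mult_left_mono) simp
        also have "\<dots> \<le> B (i - j) * R"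
          using True br_pos by (intro mult_right_mono) (auto simp: B_def R_def less_imp_le)
        finally show ?thesis unfolding p T using True by (simp add: hill_coeff_def)
      next
        case False
        have "(cmod (hill_coeff C q (i - j)))\<^sup>2 / ?H = (cmod (fourier_coeff q (i - j)))\<^sup>2 * ((of_int (i - j))\<^sup>2 / ?H)"
          using False by (simp add: hill_coeff_def norm_mult power_mult_distrib flip: of_int_diff)
        also have "\<dots> \<le> (cmod (fourier_coeff q (i - j)))\<^sup>2 * R"
          unfolding R_def using n by (intro mult_left_mono hill_kernel_le) auto
        also have "\<dots> = B (i - j) * R" using False ev by (simp add: B_def)
        finally show ?thesis unfolding p T by simp
      qed
    qed
    have TE: "T n summable_on ?E" using N0(1)[of n] n by (auto intro: summable_on_subset_banach)
    then have KE: "?K summable_on ?E" by (rule summable_on_comparison_test[OF _ le K0])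
    have "infsum ?K ?E \<le> infsum (T n) ?E" by (rule infsum_mono[OF KE TE le])
    also have "\<dots> \<le> infsum (T n) UNIV" using N0(1)[of n] n T0 by (intro infsum_mono2 TE) auto
    also have "\<dots> \<le> e" using N0(2)[of n] n by simp
    finally show "?K summable_on ?E \<and> infsum ?K ?E \<le> e" using KE by blast
  qed
qed

text \<open>\<open>False\<close> and \<open>True\<close> index the two components of a Dirac eigenfunction.\<close>

definition dirac_kernel ::
  "(int \<Rightarrow> complex) \<Rightarrow> (int \<Rightarrow> complex) \<Rightarrow> bool \<times> int \<Rightarrow> bool \<times> int \<Rightarrow> complex" where
  "dirac_kernel p q = (\<lambda>(s, i) (s', j). if s = s' then 0 else if s then q (i + j) else p (i + j))"

lemma dirac_HS:
  assumes P: "L2 P" and Q: "L2 Q" and e: "e > 0"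
  shows "\<exists>N0. \<forall>n. N0 \<le> \<bar>n\<bar> \<longrightarrow>
    (\<lambda>(x, y). (cmod (dirac_kernel (\<lambda>m. fourier_coeff P (- m)) (fourier_coeff Q) x y))\<^sup>2 / (br (n - snd x) * br (n - snd y)))
      summable_on (UNIV \<times> parity_class n) \<times> (UNIV \<times> parity_class n) \<and>
    (\<Sum>\<^sub>\<infinity>(x, y)\<in>(UNIV \<times> parity_class n) \<times> (UNIV \<times> parity_class n).
      (cmod (dirac_kernel (\<lambda>m. fourier_coeff P (- m)) (fourier_coeff Q) x y))\<^sup>2 / (br (n - snd x) * br (n - snd y))) \<le> e"
proof -
  let ?A = "dirac_kernel (\<lambda>m. fourier_coeff P (- m)) (fourier_coeff Q)"
  define B where "B m = (if even m then (cmod (fourier_coeff P (- m)))\<^sup>2 else 0)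
      + (if even m then (cmod (fourier_coeff Q m))\<^sup>2 else 0)" for m
  have B0: "0 \<le> B m" for m by (simp add: B_def)
  have "(\<lambda>m. (cmod (fourier_coeff P (- m)))\<^sup>2) summable_on parity_class 0"
    by (rule summable_on_reindex_bij_betw[OF parity_class_uminus, THEN iffD2, OF Bessel[OF P]])
  then have B: "B summable_on UNIV"
    unfolding B_def by (intro summable_on_add summable_on_UNIV_parity Bessel Q)
  define T where "T n = (\<lambda>(i, j). B (i + j) / (br (n - i) * br (n - j)))" for n
  have v: "vanishing T" unfolding T_def by (rule vanishing_dirac[OF B0 B])
  \<comment> \<open>There are four pairs of components, and each of them contributes at most the sum
    of \<open>T n\<close>.\<close>
  have e4: "e / 4 > 0" using e by simp
  from v obtain N0 where N0: "\<And>n. N0 \<le> \<bar>n\<bar> \<Longrightarrow> T n summable_on UNIV" "\<And>n. N0 \<le> \<bar>n\<bar> \<Longrightarrow> infsum (T n) UNIV \<le> e / 4"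
    by (rule vanishingD[OF _ e4]) (rule that)
  show ?thesis
  proof (intro exI[of _ N0] allI impI)
    fix n :: int assume n: "N0 \<le> \<bar>n\<bar>"
    let ?K = "\<lambda>(x, y). (cmod (?A x y))\<^sup>2 / (br (n - snd x) * br (n - snd y))"
    let ?I = "UNIV \<times> parity_class n :: (bool \<times> int) set"
    let ?T = "\<lambda>(x :: bool \<times> int, y :: bool \<times> int). T n (snd x, snd y)"
    have T0: "0 \<le> T n p" for p using v by (rule vanishing_nonneg)
    have inner: "((\<lambda>p. T n p) has_sum infsum (T n) UNIV) UNIV" by (rule has_sum_infsum[OF N0(1)[OF n]])
    have four: "((\<lambda>b :: bool \<times> bool. infsum (T n) UNIV) has_sum (4 * infsum (T n) UNIV)) UNIV"
      by (rule has_sum_finiteI) (simp_all add: UNIV_Times_UNIV[symmetric] card_cartesian_product UNIV_bool del: UNIV_Times_UNIV)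
    have prod: "((\<lambda>(b, p). T n p) has_sum (4 * infsum (T n) UNIV)) ((UNIV :: (bool \<times> bool) set) \<times> UNIV)"
    proof (rule has_sum_SigmaI[OF _ four])
      show "((\<lambda>p. case (b, p) of (b, p) \<Rightarrow> T n p) has_sum infsum (T n) UNIV) UNIV" for b :: "bool \<times> bool"
        using inner by simp
      show "(\<lambda>(b, p). T n p) summable_on (UNIV :: (bool \<times> bool) set) \<times> UNIV"
        by (rule summable_on_SigmaI[OF _ has_sum_imp_summable[OF four]]) (use inner T0 in auto)
    qed
    have bij: "bij (\<lambda>((s, i), (s', j)). ((s, s'), (i, j)) :: (bool \<times> bool) \<times> int \<times> int)"
      by (rule bij_betw_byWitness[where f' = "\<lambda>((s, s'), (i, j)). ((s, i), (s', j))"]) auto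
    have TU: "(?T has_sum (4 * infsum (T n) UNIV)) UNIV"
      using prod has_sum_reindex_bij_betw[OF bij, of "\<lambda>(b, p). T n p"] by (simp add: case_prod_unfold)
    have K0: "0 \<le> ?K p" for p using br_pos by (cases p) (simp add: less_imp_le)
    have le: "?K p \<le> ?T p" if pE: "p \<in> ?I \<times> ?I" for p
    proof -
      obtain s i s' j where p: "p = ((s, i), (s', j))" and ev: "even (i + j)" using pE by auto
      have "(cmod (?A (s, i) (s', j)))\<^sup>2 \<le> B (i + j)"
        using ev by (auto simp: dirac_kernel_def B_def)
      then have "(cmod (?A (s, i) (s', j)))\<^sup>2 / (br (n - i) * br (n - j)) \<le> B (i + j) / (br (n - i) * br (n - j))"
        using br_pos by (intro divide_right_mono) (auto simp: less_imp_le)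
      then show ?thesis unfolding p T_def by simp
    qed
    have TE: "?T summable_on ?I \<times> ?I"
      by (rule summable_on_subset_banach[OF has_sum_imp_summable[OF TU]]) simp
    then have KE: "?K summable_on ?I \<times> ?I" by (rule summable_on_comparison_test[OF _ le K0])
    have "infsum ?K (?I \<times> ?I) \<le> infsum ?T (?I \<times> ?I)" by (rule infsum_mono[OF KE TE le])
    also have "\<dots> \<le> infsum ?T UNIV"
      using T0 by (intro infsum_mono2 TE has_sum_imp_summable[OF TU]) auto
    also have "\<dots> \<le> e" using infsumI[OF TU] N0(2)[OF n] by simp
    finally show "?K summable_on ?I \<times> ?I \<and> infsum ?K (?I \<times> ?I) \<le> e" using KE by blast
  qed
qed

no_notation Infinite_Set_Sum.abs_summable_on (infix "abs'_summable'_on" 50)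

subsection \<open>Weighted square summability\<close>

lemma weighted_Cauchy_Schwarz:
  fixes x y h :: "'i \<Rightarrow> real"
  assumes h: "\<And>i. i \<in> I \<Longrightarrow> h i > 0"
    and x: "(\<lambda>i. (x i)\<^sup>2 / h i) summable_on I" and y: "(\<lambda>i. (y i)\<^sup>2 / h i) summable_on I"
  shows "(\<lambda>i. \<bar>x i * y i\<bar> / h i) summable_on I"
    and "(\<Sum>\<^sub>\<infinity>i\<in>I. \<bar>x i * y i\<bar> / h i)
           \<le> sqrt (\<Sum>\<^sub>\<infinity>i\<in>I. (x i)\<^sup>2 / h i) * sqrt (\<Sum>\<^sub>\<infinity>i\<in>I. (y i)\<^sup>2 / h i)"
proof -
  have fin: "(\<Sum>i\<in>F. \<bar>x i * y i\<bar> / h i)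
      \<le> sqrt (\<Sum>\<^sub>\<infinity>i\<in>I. (x i)\<^sup>2 / h i) * sqrt (\<Sum>\<^sub>\<infinity>i\<in>I. (y i)\<^sup>2 / h i)"
    if F: "finite F" "F \<subseteq> I" for F
  proof -
    have pos: "h i > 0" if "i \<in> F" for i using h F that by auto
    have "(\<Sum>i\<in>F. \<bar>x i * y i\<bar> / h i) = (\<Sum>i\<in>F. \<bar>x i / sqrt (h i)\<bar> * \<bar>y i / sqrt (h i)\<bar>)"
    proof (intro sum.cong refl)
      fix i assume "i \<in> F"
      then have "h i > 0" by (rule pos)
      then have "sqrt (h i) * sqrt (h i) = h i" by simp
      then show "\<bar>x i * y i\<bar> / h i = \<bar>x i / sqrt (h i)\<bar> * \<bar>y i / sqrt (h i)\<bar>"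
        using \<open>h i > 0\<close> by (simp add: abs_mult)
    qed
    also have "\<dots> \<le> L2_set (\<lambda>i. x i / sqrt (h i)) F * L2_set (\<lambda>i. y i / sqrt (h i)) F"
      by (rule L2_set_mult_ineq)
    also have "\<dots> = sqrt (\<Sum>i\<in>F. (x i)\<^sup>2 / h i) * sqrt (\<Sum>i\<in>F. (y i)\<^sup>2 / h i)"
      unfolding L2_set_def
      by (intro arg_cong2[where f = "(*)"] arg_cong[where f = sqrt] sum.cong refl)
        (use pos in \<open>auto simp: power_divide less_imp_le\<close>)
    also have "\<dots> \<le> sqrt (\<Sum>\<^sub>\<infinity>i\<in>I. (x i)\<^sup>2 / h i) * sqrt (\<Sum>\<^sub>\<infinity>i\<in>I. (y i)\<^sup>2 / h i)"
      using F h by (intro mult_mono real_sqrt_le_mono finite_sum_le_infsum x y real_sqrt_ge_zero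
          sum_nonneg infsum_nonneg divide_nonneg_pos) (auto simp: less_imp_le)
    finally show ?thesis .
  qed
  show summ: "(\<lambda>i. \<bar>x i * y i\<bar> / h i) summable_on I"
  proof (rule nonneg_bdd_above_summable_on)
    show "bdd_above (sum (\<lambda>i. \<bar>x i * y i\<bar> / h i) ` {F. F \<subseteq> I \<and> finite F})"
      using fin by (intro bdd_aboveI2) auto
  qed (use h in \<open>auto intro!: divide_nonneg_pos\<close>)
  show "(\<Sum>\<^sub>\<infinity>i\<in>I. \<bar>x i * y i\<bar> / h i)
      \<le> sqrt (\<Sum>\<^sub>\<infinity>i\<in>I. (x i)\<^sup>2 / h i) * sqrt (\<Sum>\<^sub>\<infinity>i\<in>I. (y i)\<^sup>2 / h i)"
    by (rule infsum_le_finite_sums[OF summ]) (use fin in auto)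
qed

lemma weighted_square_summable_add:
  fixes x y h :: "'i \<Rightarrow> real"
  assumes h: "\<And>i. i \<in> I \<Longrightarrow> h i > 0"
    and x: "(\<lambda>i. (x i)\<^sup>2 / h i) summable_on I" and y: "(\<lambda>i. (y i)\<^sup>2 / h i) summable_on I"
  shows "(\<lambda>i. (x i + y i)\<^sup>2 / h i) summable_on I"
proof (rule summable_on_comparison_test)
  show "(\<lambda>i. 2 * ((x i)\<^sup>2 / h i) + 2 * ((y i)\<^sup>2 / h i)) summable_on I"
    by (intro summable_on_add summable_on_cmult_right x y)
  show "(x i + y i)\<^sup>2 / h i \<le> 2 * ((x i)\<^sup>2 / h i) + 2 * ((y i)\<^sup>2 / h i)" if "i \<in> I" for i
  proof -
    have "(x i + y i)\<^sup>2 \<le> 2 * (x i)\<^sup>2 + 2 * (y i)\<^sup>2"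
      using zero_le_power2[of "x i - y i"] by (simp add: power2_eq_square algebra_simps)
    then have "(x i + y i)\<^sup>2 / h i \<le> (2 * (x i)\<^sup>2 + 2 * (y i)\<^sup>2) / h i"
      using h[OF that] by (intro divide_right_mono) auto
    then show ?thesis by (simp add: add_divide_distrib)
  qed
qed (use h in \<open>auto intro!: divide_nonneg_pos\<close>)

lemma weighted_square_summable_cmult:
  fixes x h :: "'i \<Rightarrow> real"
  assumes "(\<lambda>i. (x i)\<^sup>2 / h i) summable_on I"
  shows "(\<lambda>i. (c * x i)\<^sup>2 / h i) summable_on I"
  using summable_on_cmult_right[OF assms, of "c\<^sup>2"] by (simp add: power_mult_distrib)

text \<open>The net of finite partial sums converges locally uniformly by the Weierstrass test, and
  such limits of holomorphic functions are holomorphic.\<close>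

lemma holomorphic_on_infsum:
  fixes f :: "'i \<Rightarrow> complex \<Rightarrow> complex"
  assumes f: "\<And>i. i \<in> I \<Longrightarrow> f i holomorphic_on U" and U: "open U"
    and M: "\<And>i z. i \<in> I \<Longrightarrow> z \<in> U \<Longrightarrow> norm (f i z) \<le> M i" "M summable_on I"
  shows "(\<lambda>z. \<Sum>\<^sub>\<infinity>i\<in>I. f i z) holomorphic_on U"
proof -
  have "\<exists>d. (\<lambda>z. \<Sum>\<^sub>\<infinity>i\<in>I. f i z) holomorphic_on ball w d \<and> d > 0" if "w \<in> U" for w
  proof -
    obtain d where d: "d > 0" "cball w d \<subseteq> U"
      using U \<open>w \<in> U\<close> open_contains_cball by blast
    have lim: "uniform_limit (cball w d) (\<lambda>F z. \<Sum>i\<in>F. f i z) (\<lambda>z. \<Sum>\<^sub>\<infinity>i\<in>I. f i z)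
        (finite_subsets_at_top I)"
      by (rule Weierstrass_m_test_general[OF _ M(2)]) (use M(1) d in auto)
    have "\<forall>\<^sub>F F in finite_subsets_at_top I. (\<lambda>z. \<Sum>i\<in>F. f i z) holomorphic_on U"
      by (rule eventually_finite_subsets_at_top_weakI) (use f in \<open>auto intro!: holomorphic_on_sum\<close>)
    then have "\<forall>\<^sub>F F in finite_subsets_at_top I. continuous_on (cball w d) (\<lambda>z. \<Sum>i\<in>F. f i z)
        \<and> (\<lambda>z. \<Sum>i\<in>F. f i z) holomorphic_on ball w d"
    proof (rule eventually_mono)
      fix F assume "(\<lambda>z. \<Sum>i\<in>F. f i z) holomorphic_on U"
      then show "continuous_on (cball w d) (\<lambda>z. \<Sum>i\<in>F. f i z)
          \<and> (\<lambda>z. \<Sum>i\<in>F. f i z) holomorphic_on ball w d"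
        using d(2) by (auto intro: holomorphic_on_imp_continuous_on
            holomorphic_on_subset[OF _ order_trans[OF ball_subset_cball]] holomorphic_on_subset)
    qed
    from holomorphic_uniform_limit[OF this lim] d(1) show ?thesis by auto
  qed
  then have "(\<lambda>z. \<Sum>\<^sub>\<infinity>i\<in>I. f i z) field_differentiable at w" if "w \<in> U" for w
    using that holomorphic_on_imp_differentiable_at[OF _ open_ball centre_in_ball[THEN iffD2]] by blast
  then show ?thesis by (simp add: holomorphic_on_def field_differentiable_at_within)
qed

subsection \<open>Walk sums\<close>

text \<open>Entry (i, j) of A (T A)^k with T the diagonal matrix of t on J, that is, the k-th term
  of a Neumann series. The value type is left open so that the same recursion also defines real
  majorants.\<close>

primrec walk :: "'i set \<Rightarrow> ('i \<Rightarrow> 'i \<Rightarrow> 'a) \<Rightarrow> ('i \<Rightarrow> 'a) \<Rightarrow> nat \<Rightarrow> 'i \<Rightarrow> 'i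
    \<Rightarrow> 'a::{real_normed_field,banach}" where
  "walk J A t 0 i j = A i j"
| "walk J A t (Suc k) i j = (\<Sum>\<^sub>\<infinity>l\<in>J. A i l * t l * walk J A t k l j)"

text \<open>The kernels a and \<tau> dominate A and t. Summability is required of the dominating
  walk sums and passes to the complex ones by comparison.\<close>

locale dominated_walk =
  fixes I J :: "'i set" and A :: "'i \<Rightarrow> 'i \<Rightarrow> complex" and t :: "'i \<Rightarrow> complex"
    and a :: "'i \<Rightarrow> 'i \<Rightarrow> real" and \<tau> :: "'i \<Rightarrow> real"
  assumes JI: "J \<subseteq> I"
    and norm_A: "\<And>i j. i \<in> I \<Longrightarrow> j \<in> I \<Longrightarrow> cmod (A i j) \<le> a i j"
    and norm_t: "\<And>l. l \<in> J \<Longrightarrow> cmod (t l) \<le> \<tau> l"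
    and summ: "\<And>k i j. i \<in> I \<Longrightarrow> j \<in> I \<Longrightarrow> (\<lambda>l. a i l * \<tau> l * walk J a \<tau> k l j) summable_on J"
begin

lemma a_nonneg: "i \<in> I \<Longrightarrow> j \<in> I \<Longrightarrow> 0 \<le> a i j"
  using norm_A norm_ge_zero order_trans by blast

lemma \<tau>_nonneg: "l \<in> J \<Longrightarrow> 0 \<le> \<tau> l"
  using norm_t norm_ge_zero order_trans by blast

lemma walk_nonneg: "i \<in> I \<Longrightarrow> j \<in> I \<Longrightarrow> 0 \<le> walk J a \<tau> k i j"
proof (induction k arbitrary: i)
  case (Suc k)
  then show ?case using JI by (auto intro!: infsum_nonneg mult_nonneg_nonneg a_nonneg \<tau>_nonneg)
qed (simp add: a_nonneg)

lemma norm_walk_le: "i \<in> I \<Longrightarrow> j \<in> I \<Longrightarrow> cmod (walk J A t k i j) \<le> walk J a \<tau> k i j"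
  and walk_term_le: "i \<in> I \<Longrightarrow> j \<in> I \<Longrightarrow> l \<in> J \<Longrightarrow>
        cmod (A i l * t l * walk J A t k l j) \<le> a i l * \<tau> l * walk J a \<tau> k l j"
proof -
  have le: "cmod (walk J A t k i j) \<le> walk J a \<tau> k i j \<and>
        (\<forall>l\<in>J. cmod (A i l * t l * walk J A t k l j) \<le> a i l * \<tau> l * walk J a \<tau> k l j)"
    if "i \<in> I" "j \<in> I" for i j k
    using that
  proof (induction k arbitrary: i)
    case 0
    then show ?case using JI
      by (auto simp: norm_mult norm_A intro!: mult_mono norm_t mult_nonneg_nonneg a_nonneg \<tau>_nonneg)
  next
    case (Suc k)
    have "cmod (walk J A t (Suc k) i j) \<le> walk J a \<tau> (Suc k) i j" if "i \<in> I" for i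
    proof -
      have "cmod (walk J A t (Suc k) i j) \<le> (\<Sum>\<^sub>\<infinity>l\<in>J. a i l * \<tau> l * walk J a \<tau> k l j)"
        unfolding walk.simps
      proof (rule norm_infsum_le[OF has_sum_infsum has_sum_infsum])
        show sm: "(\<lambda>l. a i l * \<tau> l * walk J a \<tau> k l j) summable_on J"
          by (rule summ[OF that Suc.prems(2)])
        show "(\<lambda>l. A i l * t l * walk J A t k l j) summable_on J"
          by (rule abs_summable_summable, rule summable_on_comparison_test[OF sm])
            (use Suc that in auto)
      qed (use Suc that in auto)
      then show ?thesis by simp
    qed
    then show ?case using Suc.prems JI
      by (auto simp del: walk.simps simp: norm_mult
          intro!: mult_mono norm_A norm_t mult_nonneg_nonneg a_nonneg \<tau>_nonneg walk_nonneg)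
  qed
  show "i \<in> I \<Longrightarrow> j \<in> I \<Longrightarrow> cmod (walk J A t k i j) \<le> walk J a \<tau> k i j"
    and t: "i \<in> I \<Longrightarrow> j \<in> I \<Longrightarrow> l \<in> J \<Longrightarrow>
        cmod (A i l * t l * walk J A t k l j) \<le> a i l * \<tau> l * walk J a \<tau> k l j"
    using le by auto
qed

end

fun path_weight :: "('i \<Rightarrow> 'i \<Rightarrow> 'a) \<Rightarrow> ('i \<Rightarrow> 'a) \<Rightarrow> 'i \<Rightarrow> 'i list \<Rightarrow> 'i \<Rightarrow> 'a::comm_monoid_mult" where
  "path_weight A t i [] j = A i j"
| "path_weight A t i (l # ls) j = A i l * t l * path_weight A t l ls j"

abbreviation lists_of_length :: "'i set \<Rightarrow> nat \<Rightarrow> 'i list set" where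
  "lists_of_length J k \<equiv> {ls. length ls = k \<and> set ls \<subseteq> J}"

lemma lists_of_length_Suc_eq:
  "lists_of_length J (Suc k) = (\<lambda>(l, ls). l # ls) ` (J \<times> lists_of_length J k)"
  by (auto simp: length_Suc_conv image_iff)

text \<open>The functionals are defined by sums over whole tuples, the walk sums by iterated
  summation; Fubini's theorem identifies the two.\<close>

lemma (in dominated_walk) walk_eq_infsum_lists:
  assumes "i \<in> I" "j \<in> I"
  shows "walk J A t k i j = (\<Sum>\<^sub>\<infinity>ls\<in>lists_of_length J k. path_weight A t i ls j)"
proof -
  \<comment> \<open>The induction carries absolute summability and a bound along with the identity,
    since Fubini's theorem needs both at the next length.\<close>
  have "(\<lambda>ls. path_weight A t i ls j) abs_summable_on lists_of_length J k \<and>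
     (\<Sum>\<^sub>\<infinity>ls\<in>lists_of_length J k. cmod (path_weight A t i ls j)) \<le> walk J a \<tau> k i j \<and>
     walk J A t k i j = (\<Sum>\<^sub>\<infinity>ls\<in>lists_of_length J k. path_weight A t i ls j)"
    using assms
  proof (induction k arbitrary: i)
    case 0
    have "lists_of_length J 0 = {[]}" by auto
    then show ?case using 0 by (simp add: norm_A)
  next
    case (Suc k)
    let ?P = "J \<times> lists_of_length J k"
    let ?g = "\<lambda>(l, ls). A i l * t l * path_weight A t l ls j"
    have inj: "inj_on (\<lambda>(l, ls). l # ls) ?P" by (auto simp: inj_on_def)
    have IH: "(\<lambda>ls. path_weight A t l ls j) abs_summable_on lists_of_length J k"
      "(\<Sum>\<^sub>\<infinity>ls\<in>lists_of_length J k. cmod (path_weight A t l ls j)) \<le> walk J a \<tau> k l j"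
      "walk J A t k l j = (\<Sum>\<^sub>\<infinity>ls\<in>lists_of_length J k. path_weight A t l ls j)" if "l \<in> J" for l
      using Suc that JI by auto
    have inner: "(\<Sum>\<^sub>\<infinity>ls\<in>lists_of_length J k. cmod (?g (l, ls))) \<le> a i l * \<tau> l * walk J a \<tau> k l j"
      if "l \<in> J" for l
      using that JI Suc.prems
      by (auto simp: norm_mult infsum_cmult_right' intro!: mult_mono IH norm_A norm_t
          mult_nonneg_nonneg a_nonneg \<tau>_nonneg infsum_nonneg)
    have outer: "(\<lambda>l. \<Sum>\<^sub>\<infinity>ls\<in>lists_of_length J k. cmod (?g (l, ls))) summable_on J"
      using summ[OF Suc.prems, of k] by (rule summable_on_comparison_test)
        (use inner in \<open>auto intro!: infsum_nonneg\<close>)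
    have abs: "?g abs_summable_on ?P"
    proof (rule Infinite_Sum.abs_summable_on_Sigma_iff[THEN iffD2], intro conjI ballI)
      show "(\<lambda>y. ?g (x, y)) abs_summable_on lists_of_length J k" if "x \<in> J" for x
        using IH(1)[OF that] by (auto simp: norm_mult intro!: summable_on_cmult_right)
      show "(\<lambda>x. \<Sum>\<^sub>\<infinity>y\<in>lists_of_length J k. cmod (?g (x, y))) abs_summable_on J"
        using outer by (simp add: infsum_nonneg)
    qed
    have 1: "(\<lambda>ls. path_weight A t i ls j) abs_summable_on lists_of_length J (Suc k)"
      unfolding lists_of_length_Suc_eq summable_on_reindex[OF inj]
      using abs by (simp add: o_def case_prod_unfold)
    have "(\<Sum>\<^sub>\<infinity>ls\<in>lists_of_length J (Suc k). cmod (path_weight A t i ls j))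
        = (\<Sum>\<^sub>\<infinity>p\<in>?P. cmod (?g p))"
      unfolding lists_of_length_Suc_eq infsum_reindex[OF inj]
      by (intro infsum_cong) auto
    also have "\<dots> = (\<Sum>\<^sub>\<infinity>l\<in>J. \<Sum>\<^sub>\<infinity>ls\<in>lists_of_length J k. cmod (?g (l, ls)))"
      using abs by (subst infsum_Sigma_banach) auto
    also have "\<dots> \<le> (\<Sum>\<^sub>\<infinity>l\<in>J. a i l * \<tau> l * walk J a \<tau> k l j)"
      by (rule infsum_mono[OF outer summ[OF Suc.prems]]) (rule inner)
    finally have 2: "(\<Sum>\<^sub>\<infinity>ls\<in>lists_of_length J (Suc k). cmod (path_weight A t i ls j))
        \<le> walk J a \<tau> (Suc k) i j" by simp
    have "walk J A t (Suc k) i j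
        = (\<Sum>\<^sub>\<infinity>l\<in>J. \<Sum>\<^sub>\<infinity>ls\<in>lists_of_length J k. ?g (l, ls))"
      using IH(3) by (auto simp: infsum_cmult_right' intro!: infsum_cong)
    also have "\<dots> = (\<Sum>\<^sub>\<infinity>p\<in>?P. ?g p)"
      by (rule infsum_Sigma_banach) (rule abs_summable_summable[OF abs])
    also have "\<dots> = (\<Sum>\<^sub>\<infinity>ls\<in>lists_of_length J (Suc k). path_weight A t i ls j)"
      unfolding lists_of_length_Suc_eq infsum_reindex[OF inj]
      by (intro infsum_cong) auto
    finally show ?case using 1 2 by simp
  qed
  then show ?thesis by simp
qed

subsection \<open>The Lyapunov--Schmidt reduction for a Hilbert--Schmidt perturbation\<close>

text \<open>An abstract form of both systems. The resonant indices e and f are n and -n in the Hill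
  case, and the two components at n in the Dirac case. The bound \<epsilon> \<le> 1/4 gives the
  Neumann series a ratio 2 \<epsilon> \<le> 1/2, the factor 2 stemming from
  \<open>denominator\<close>.\<close>

locale perturbed_diagonal =
  fixes I :: "'i set" and e f :: 'i and A :: "'i \<Rightarrow> 'i \<Rightarrow> complex" and d :: "'i \<Rightarrow> complex"
    and h :: "'i \<Rightarrow> real" and c \<epsilon> :: real
  assumes e: "e \<in> I" and f: "f \<in> I" and ef: "e \<noteq> f" and d_e: "d e = 0" and d_f: "d f = 0"
    and h_pos: "\<And>i. i \<in> I \<Longrightarrow> h i > 0"
    and denominator: "\<And>i z. i \<in> I - {e, f} \<Longrightarrow> cmod z < c \<Longrightarrow> h i / 2 \<le> cmod (d i + z)"
    and HS: "(\<lambda>(i, j). (cmod (A i j))\<^sup>2 / (h i * h j)) summable_on I \<times> I"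
    and HS_le: "(\<Sum>\<^sub>\<infinity>(i, j)\<in>I \<times> I. (cmod (A i j))\<^sup>2 / (h i * h j)) \<le> \<epsilon>\<^sup>2"
    and \<epsilon>: "0 \<le> \<epsilon>" "\<epsilon> \<le> 1/4"
begin

abbreviation "J \<equiv> I - {e, f}"

definition row :: "'i \<Rightarrow> real" where
  "row i = sqrt (\<Sum>\<^sub>\<infinity>j\<in>I. (cmod (A i j))\<^sup>2 / h j)"

definition col :: "'i \<Rightarrow> real" where
  "col j = sqrt (\<Sum>\<^sub>\<infinity>i\<in>I. (cmod (A i j))\<^sup>2 / h i)"

lemma row_nonneg: "0 \<le> row i" and col_nonneg: "0 \<le> col i"
  unfolding row_def col_def by (auto intro!: infsum_nonneg divide_nonneg_pos h_pos)

lemma row_summable: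
  assumes "i \<in> I" shows "(\<lambda>j. (cmod (A i j))\<^sup>2 / h j) summable_on I"
proof -
  have "(\<lambda>j. (cmod (A i j))\<^sup>2 / (h i * h j)) summable_on I"
    using summable_on_SigmaD1[OF HS, of i] assms h_pos
    by (force intro!: divide_nonneg_pos)
  from summable_on_cmult_right[OF this, of "h i"] show ?thesis
    using h_pos[OF assms] by simp
qed

lemma HS_swap: "(\<lambda>(j, i). (cmod (A i j))\<^sup>2 / (h i * h j)) summable_on I \<times> I"
  using summable_on_swap[THEN iffD1, OF HS] by (simp add: case_prod_unfold prod.swap_def o_def)

lemma col_summable:
  assumes "j \<in> I" shows "(\<lambda>i. (cmod (A i j))\<^sup>2 / h i) summable_on I"
proof -
  have "(\<lambda>i. (cmod (A i j))\<^sup>2 / (h i * h j)) summable_on I"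
    using summable_on_SigmaD1[OF HS_swap, of j] assms h_pos
    by (force intro!: divide_nonneg_pos)
  from summable_on_cmult_right[OF this, of "h j"] show ?thesis
    using h_pos[OF assms] by simp
qed

lemma row_square:
  assumes "i \<in> I" shows "(row i)\<^sup>2 / h i = (\<Sum>\<^sub>\<infinity>j\<in>I. (cmod (A i j))\<^sup>2 / (h i * h j))"
proof -
  have "(row i)\<^sup>2 = (\<Sum>\<^sub>\<infinity>j\<in>I. (cmod (A i j))\<^sup>2 / h j)"
    unfolding row_def using h_pos by (simp add: infsum_nonneg divide_nonneg_pos less_imp_le)
  then have "(row i)\<^sup>2 / h i = (1 / h i) * (\<Sum>\<^sub>\<infinity>j\<in>I. (cmod (A i j))\<^sup>2 / h j)" by simp
  also have "\<dots> = (\<Sum>\<^sub>\<infinity>j\<in>I. (1 / h i) * ((cmod (A i j))\<^sup>2 / h j))"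
    by (rule infsum_cmult_right'[symmetric])
  finally show ?thesis by simp
qed

lemma col_square:
  assumes "j \<in> I" shows "(col j)\<^sup>2 / h j = (\<Sum>\<^sub>\<infinity>i\<in>I. (cmod (A i j))\<^sup>2 / (h i * h j))"
proof -
  have "(col j)\<^sup>2 = (\<Sum>\<^sub>\<infinity>i\<in>I. (cmod (A i j))\<^sup>2 / h i)"
    unfolding col_def using h_pos by (simp add: infsum_nonneg divide_nonneg_pos less_imp_le)
  then have "(col j)\<^sup>2 / h j = (1 / h j) * (\<Sum>\<^sub>\<infinity>i\<in>I. (cmod (A i j))\<^sup>2 / h i)" by simp
  also have "\<dots> = (\<Sum>\<^sub>\<infinity>i\<in>I. (1 / h j) * ((cmod (A i j))\<^sup>2 / h i))"
    by (rule infsum_cmult_right'[symmetric])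
  finally show ?thesis by (simp add: mult.commute)
qed

lemma row_square_summable: "(\<lambda>i. (row i)\<^sup>2 / h i) summable_on I"
  and row_square_sum: "(\<Sum>\<^sub>\<infinity>i\<in>I. (row i)\<^sup>2 / h i) \<le> \<epsilon>\<^sup>2"
proof -
  have "(\<lambda>i. \<Sum>\<^sub>\<infinity>j\<in>I. (cmod (A i j))\<^sup>2 / (h i * h j)) summable_on I"
    using summable_on_Sigma_banach[OF HS] by simp
  then show "(\<lambda>i. (row i)\<^sup>2 / h i) summable_on I"
    by (subst summable_on_cong) (auto simp: row_square)
  have "(\<Sum>\<^sub>\<infinity>i\<in>I. (row i)\<^sup>2 / h i) = (\<Sum>\<^sub>\<infinity>i\<in>I. \<Sum>\<^sub>\<infinity>j\<in>I. (cmod (A i j))\<^sup>2 / (h i * h j))"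
    by (intro infsum_cong) (auto simp: row_square)
  also have "\<dots> = (\<Sum>\<^sub>\<infinity>(i, j)\<in>I \<times> I. (cmod (A i j))\<^sup>2 / (h i * h j))"
    using infsum_Sigma'_banach[OF HS] by simp
  finally show "(\<Sum>\<^sub>\<infinity>i\<in>I. (row i)\<^sup>2 / h i) \<le> \<epsilon>\<^sup>2" using HS_le by simp
qed

lemma col_square_summable: "(\<lambda>i. (col i)\<^sup>2 / h i) summable_on I"
  and col_square_sum: "(\<Sum>\<^sub>\<infinity>i\<in>I. (col i)\<^sup>2 / h i) \<le> \<epsilon>\<^sup>2"
proof -
  have "(\<lambda>j. \<Sum>\<^sub>\<infinity>i\<in>I. (cmod (A i j))\<^sup>2 / (h i * h j)) summable_on I"
    using summable_on_Sigma_banach[OF HS_swap] by simp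
  then show "(\<lambda>i. (col i)\<^sup>2 / h i) summable_on I"
    by (subst summable_on_cong) (auto simp: col_square)
  have "(\<Sum>\<^sub>\<infinity>i\<in>I. (col i)\<^sup>2 / h i) = (\<Sum>\<^sub>\<infinity>j\<in>I. \<Sum>\<^sub>\<infinity>i\<in>I. (cmod (A i j))\<^sup>2 / (h i * h j))"
    by (intro infsum_cong) (auto simp: col_square)
  also have "\<dots> = (\<Sum>\<^sub>\<infinity>(i, j)\<in>I \<times> I. (cmod (A i j))\<^sup>2 / (h i * h j))"
    using infsum_swap_banach[OF HS] infsum_Sigma'_banach[OF HS] by simp
  finally show "(\<Sum>\<^sub>\<infinity>i\<in>I. (col i)\<^sup>2 / h i) \<le> \<epsilon>\<^sup>2" using HS_le by simp
qed

lemma row_le: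
  assumes "i \<in> I" shows "row i \<le> \<epsilon> * sqrt (h i)"
proof -
  have "(\<Sum>\<^sub>\<infinity>l\<in>{i}. (row l)\<^sup>2 / h l) \<le> (\<Sum>\<^sub>\<infinity>l\<in>I. (row l)\<^sup>2 / h l)"
    using assms h_pos by (intro infsum_mono2 row_square_summable) (auto intro!: divide_nonneg_pos)
  then have "(row i)\<^sup>2 / h i \<le> \<epsilon>\<^sup>2"
    using row_square_sum by simp
  then have "(row i)\<^sup>2 \<le> \<epsilon>\<^sup>2 * h i"
    using h_pos[OF assms] by (simp add: pos_divide_le_eq)
  then have "sqrt ((row i)\<^sup>2) \<le> sqrt (\<epsilon>\<^sup>2 * h i)" by (rule real_sqrt_le_mono)
  then show ?thesis using row_nonneg \<epsilon> by (simp add: real_sqrt_mult)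
qed

lemma col_le:
  assumes "i \<in> I" shows "col i \<le> \<epsilon> * sqrt (h i)"
proof -
  have "(\<Sum>\<^sub>\<infinity>l\<in>{i}. (col l)\<^sup>2 / h l) \<le> (\<Sum>\<^sub>\<infinity>l\<in>I. (col l)\<^sup>2 / h l)"
    using assms h_pos by (intro infsum_mono2 col_square_summable) (auto intro!: divide_nonneg_pos)
  then have "(col i)\<^sup>2 / h i \<le> \<epsilon>\<^sup>2"
    using col_square_sum by simp
  then have "(col i)\<^sup>2 \<le> \<epsilon>\<^sup>2 * h i"
    using h_pos[OF assms] by (simp add: pos_divide_le_eq)
  then have "sqrt ((col i)\<^sup>2) \<le> sqrt (\<epsilon>\<^sup>2 * h i)" by (rule real_sqrt_le_mono)
  then show ?thesis using col_nonneg \<epsilon> by (simp add: real_sqrt_mult)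
qed

lemma entry_le:
  assumes "i \<in> I" "j \<in> I" shows "cmod (A i j) \<le> row i * sqrt (h j)"
proof -
  have "(\<Sum>\<^sub>\<infinity>l\<in>{j}. (cmod (A i l))\<^sup>2 / h l) \<le> (\<Sum>\<^sub>\<infinity>l\<in>I. (cmod (A i l))\<^sup>2 / h l)"
    using assms h_pos by (intro infsum_mono2 row_summable) (auto intro!: divide_nonneg_pos)
  then have "sqrt ((cmod (A i j))\<^sup>2 / h j) \<le> row i"
    unfolding row_def by (intro real_sqrt_le_mono) simp
  then show ?thesis using h_pos[OF assms(2)] by (simp add: real_sqrt_divide field_simps)
qed

text \<open>
  The Cauchy--Schwarz inequality for the weight \<open>h\<close> bounds the kernel of each of the products
  below by a rank one kernel.
\<close>

lemma entry_entry:
  assumes "i \<in> I" "j \<in> I"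
  shows "(\<lambda>l. cmod (A i l) * cmod (A l j) / h l) summable_on I"
    and "(\<Sum>\<^sub>\<infinity>l\<in>I. cmod (A i l) * cmod (A l j) / h l) \<le> row i * col j"
  using weighted_Cauchy_Schwarz[OF h_pos row_summable col_summable] assms
  by (auto simp: abs_mult row_def col_def)

lemma entry_row:
  assumes "i \<in> I"
  shows "(\<lambda>l. cmod (A i l) * row l / h l) summable_on I"
    and "(\<Sum>\<^sub>\<infinity>l\<in>I. cmod (A i l) * row l / h l) \<le> row i * \<epsilon>"
proof -
  note CS = weighted_Cauchy_Schwarz[OF h_pos row_summable[OF assms] row_square_summable]
  show "(\<lambda>l. cmod (A i l) * row l / h l) summable_on I"
    using CS(1) row_nonneg by (simp add: abs_mult)
  have "sqrt (\<Sum>\<^sub>\<infinity>l\<in>I. (row l)\<^sup>2 / h l) \<le> \<epsilon>"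
    using row_square_sum \<epsilon> by (simp add: real_le_lsqrt)
  then have "row i * sqrt (\<Sum>\<^sub>\<infinity>l\<in>I. (row l)\<^sup>2 / h l) \<le> row i * \<epsilon>"
    by (intro mult_left_mono row_nonneg)
  then show "(\<Sum>\<^sub>\<infinity>l\<in>I. cmod (A i l) * row l / h l) \<le> row i * \<epsilon>"
    using CS(2) row_nonneg by (simp add: abs_mult row_def)
qed

lemma col_entry:
  assumes "j \<in> I"
  shows "(\<lambda>l. col l * cmod (A l j) / h l) summable_on I"
    and "(\<Sum>\<^sub>\<infinity>l\<in>I. col l * cmod (A l j) / h l) \<le> \<epsilon> * col j"
proof -
  note CS = weighted_Cauchy_Schwarz[OF h_pos col_square_summable col_summable[OF assms]]
  show "(\<lambda>l. col l * cmod (A l j) / h l) summable_on I"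
    using CS(1) col_nonneg by (simp add: abs_mult)
  have "sqrt (\<Sum>\<^sub>\<infinity>l\<in>I. (col l)\<^sup>2 / h l) \<le> \<epsilon>"
    using col_square_sum \<epsilon> by (simp add: real_le_lsqrt)
  then have "sqrt (\<Sum>\<^sub>\<infinity>l\<in>I. (col l)\<^sup>2 / h l) * col j \<le> \<epsilon> * col j"
    by (intro mult_right_mono col_nonneg)
  then show "(\<Sum>\<^sub>\<infinity>l\<in>I. col l * cmod (A l j) / h l) \<le> \<epsilon> * col j"
    using CS(2) col_nonneg by (simp add: abs_mult col_def)
qed

section \<open>Geometric decay of the walk sums\<close>

abbreviation abs_walk :: "nat \<Rightarrow> 'i \<Rightarrow> 'i \<Rightarrow> real" where
  "abs_walk \<equiv> walk J (\<lambda>i j. cmod (A i j)) (\<lambda>l. 2 / h l)"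

lemma abs_walk_nonneg: "i \<in> I \<Longrightarrow> 0 \<le> abs_walk k i j"
proof (induction k arbitrary: i)
  case (Suc k)
  then show ?case using h_pos by (auto intro!: infsum_nonneg mult_nonneg_nonneg divide_nonneg_pos)
qed simp

text \<open>A rank one bound reproduces itself: by \<open>entry_row\<close> one more step turns
  \<open>row l\<close> into \<open>row i\<close> at the cost of a factor
  \<open>2 * \<epsilon>\<close>. The bound starts at \<open>Suc k\<close> because it is for products
  of entries, not for a single entry, that Cauchy--Schwarz gives \<open>row i * col j\<close>.
  Summability at one length uses the bound at the previous one, whence the joint induction.\<close>

lemma abs_walk_summable:
  "i \<in> I \<Longrightarrow> j \<in> I \<Longrightarrow> (\<lambda>l. cmod (A i l) * (2 / h l) * abs_walk k l j) summable_on J"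
  and abs_walk_le: "i \<in> I \<Longrightarrow> j \<in> I \<Longrightarrow> abs_walk (Suc k) i j \<le> 2 * row i * col j * (2 * \<epsilon>) ^ k"
proof (induction k arbitrary: i)
  case 0
  have s: "(\<lambda>l. 2 * (cmod (A i l) * cmod (A l j) / h l)) summable_on I"
    if "i \<in> I" "j \<in> I" for i
    by (intro summable_on_cmult_right entry_entry that)
  have s': "(\<lambda>l. 2 * (cmod (A i l) * cmod (A l j) / h l)) summable_on J"
    if "i \<in> I" "j \<in> I" for i
    by (rule summable_on_subset_banach[OF s[OF that]]) auto
  { case 1 then show ?case using s'[of i] by (simp add: mult_ac) }
  { case 2
    have "(\<Sum>\<^sub>\<infinity>l\<in>J. 2 * (cmod (A i l) * cmod (A l j) / h l))
        \<le> (\<Sum>\<^sub>\<infinity>l\<in>I. 2 * (cmod (A i l) * cmod (A l j) / h l))"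
      using 2 h_pos by (intro infsum_mono2 s s') (auto intro!: divide_nonneg_pos)
    also have "\<dots> \<le> 2 * (row i * col j)"
      unfolding infsum_cmult_right' using entry_entry[of i j] 2 by (intro mult_left_mono) auto
    finally show ?case by (simp add: mult_ac) }
next
  case (Suc k)
  have s: "(\<lambda>l. (4 * col j * (2 * \<epsilon>) ^ k) * (cmod (A i l) * row l / h l)) summable_on I"
    if "i \<in> I" for i
    by (intro summable_on_cmult_right entry_row that)
  have s': "(\<lambda>l. (4 * col j * (2 * \<epsilon>) ^ k) * (cmod (A i l) * row l / h l)) summable_on J"
    if "i \<in> I" for i
    by (rule summable_on_subset_banach[OF s[OF that]]) auto
  have le: "cmod (A i l) * (2 / h l) * abs_walk (Suc k) l j
      \<le> (4 * col j * (2 * \<epsilon>) ^ k) * (cmod (A i l) * row l / h l)"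
    if "j \<in> I" "l \<in> J" for i l
  proof -
    have "cmod (A i l) * (2 / h l) * abs_walk (Suc k) l j
        \<le> cmod (A i l) * (2 / h l) * (2 * row l * col j * (2 * \<epsilon>) ^ k)"
      using that h_pos[of l] by (intro mult_left_mono Suc.IH(2)) auto
    then show ?thesis by (simp add: mult_ac)
  qed
  have sm: "(\<lambda>l. cmod (A i l) * (2 / h l) * abs_walk (Suc k) l j) summable_on J"
    if "i \<in> I" "j \<in> I" for i
    using s'[OF that(1)]
  proof (rule summable_on_comparison_test)
    show "0 \<le> cmod (A i l) * (2 / h l) * abs_walk (Suc k) l j" if "l \<in> J" for l
      using that h_pos[of l] by (intro mult_nonneg_nonneg abs_walk_nonneg) auto
  qed (rule le, use that in auto)
  { case 1 then show ?case using sm by blast }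
  { case 2
    have "abs_walk (Suc (Suc k)) i j
        \<le> (\<Sum>\<^sub>\<infinity>l\<in>J. (4 * col j * (2 * \<epsilon>) ^ k) * (cmod (A i l) * row l / h l))"
      unfolding walk.simps(2)[of J _ _ "Suc k"]
      by (rule infsum_mono[OF sm s']) (use 2 le in auto)
    also have "\<dots> \<le> (\<Sum>\<^sub>\<infinity>l\<in>I. (4 * col j * (2 * \<epsilon>) ^ k) * (cmod (A i l) * row l / h l))"
      using 2 h_pos \<epsilon> row_nonneg col_nonneg
      by (intro infsum_mono2 s s') (auto intro!: divide_nonneg_pos mult_nonneg_nonneg)
    also have "\<dots> \<le> (4 * col j * (2 * \<epsilon>) ^ k) * (row i * \<epsilon>)"
      unfolding infsum_cmult_right' using 2 \<epsilon>
      by (intro mult_left_mono entry_row mult_nonneg_nonneg col_nonneg) auto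
    finally show ?case by (simp add: mult_ac) }
qed

section \<open>The Neumann series\<close>

definition t :: "complex \<Rightarrow> 'i \<Rightarrow> complex" where
  "t z l = 1 / (d l + z)"

lemma denominator_nonzero: "l \<in> J \<Longrightarrow> cmod z < c \<Longrightarrow> d l + z \<noteq> 0"
  using denominator[of l z] h_pos[of l] by force

lemma norm_t_le:
  assumes "l \<in> J" "cmod z < c" shows "cmod (t z l) \<le> 2 / h l"
proof -
  have "1 / cmod (d l + z) \<le> 1 / (h l / 2)"
    using denominator[OF assms] h_pos[of l] assms denominator_nonzero[OF assms]
    by (intro divide_left_mono) (auto intro!: mult_pos_pos)
  then show ?thesis by (simp add: t_def norm_divide)
qed

lemma dominated: "cmod z < c \<Longrightarrow> dominated_walk I J A (t z) (\<lambda>i j. cmod (A i j)) (\<lambda>l. 2 / h l)"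
  by unfold_locales (use abs_walk_summable in \<open>auto simp: norm_t_le simp del: times_divide_eq_right\<close>)

text \<open>The kernel of A (1 - T A)^(-1), where T is the diagonal matrix of \<open>t z\<close> on
  J. Its four entries at the resonant indices become \<alpha>, which occurs twice, and the two
  functionals \<beta>.\<close>

definition G :: "complex \<Rightarrow> 'i \<Rightarrow> 'i \<Rightarrow> complex" where
  "G z i j = (\<Sum>k. walk J A (t z) k i j)"

definition kernel_bound :: "'i \<Rightarrow> 'i \<Rightarrow> real" where
  "kernel_bound i j = cmod (A i j) + 4 * row i * col j"

text \<open>The exponent is shifted because decay starts with the first intermediate index; the
  geometric series of \<open>2 * row i * col j\<close> with ratio 1/2 produces the constant 4 in
  \<open>kernel_bound\<close>.\<close>

definition walk_bound :: "'i \<Rightarrow> 'i \<Rightarrow> nat \<Rightarrow> real" where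
  "walk_bound i j k = (if k = 0 then cmod (A i j) else 2 * row i * col j * (1 / 2) ^ (k - 1))"

lemma walk_bound_sums: "walk_bound i j sums kernel_bound i j"
proof -
  have "(\<lambda>k. 2 * row i * col j * (1 / 2) ^ k) sums (2 * row i * col j * (1 / (1 - 1 / 2)))"
    by (intro sums_mult geometric_sums) auto
  then have "(\<lambda>k. walk_bound i j (Suc k)) sums (4 * row i * col j)"
    by (simp add: walk_bound_def mult_ac)
  from sums_Suc[OF this] show ?thesis
    by (simp add: walk_bound_def[of i j 0] kernel_bound_def add.commute)
qed

lemma abs_walk_le_walk_bound:
  assumes "i \<in> I" "j \<in> I" shows "abs_walk k i j \<le> walk_bound i j k"
proof (cases k)
  case (Suc m)
  have "2 * row i * col j * (2 * \<epsilon>) ^ m \<le> 2 * row i * col j * (1 / 2) ^ m"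
    using \<epsilon> by (intro mult_left_mono power_mono mult_nonneg_nonneg row_nonneg col_nonneg) auto
  with abs_walk_le[OF assms, of m] show ?thesis unfolding Suc walk_bound_def by simp
qed (simp add: walk_bound_def)

lemma norm_walk_le_walk_bound:
  assumes "cmod z < c" "i \<in> I" "j \<in> I"
  shows "cmod (walk J A (t z) k i j) \<le> walk_bound i j k"
  using dominated_walk.norm_walk_le[OF dominated[OF assms(1)] assms(2,3)]
    abs_walk_le_walk_bound[OF assms(2,3)] order_trans by blast

lemma walk_bound_le_kernel_bound:
  "walk_bound i j k \<le> kernel_bound i j"
proof -
  have "(1 / 2 :: real) ^ (k - 1) \<le> 1" by (rule power_le_one) auto
  then have "2 * row i * col j * (1 / 2) ^ (k - 1) \<le> 2 * row i * col j * 1"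
    by (intro mult_left_mono mult_nonneg_nonneg row_nonneg col_nonneg) auto
  moreover have "0 \<le> row i * col j" "0 \<le> col j * row i"
    by (intro mult_nonneg_nonneg row_nonneg col_nonneg)+
  ultimately show ?thesis
    unfolding walk_bound_def kernel_bound_def using norm_ge_zero[of "A i j"]
    by (auto simp del: norm_ge_zero)
qed

lemma walk_summable_norm:
  assumes "cmod z < c" "i \<in> I" "j \<in> I"
  shows "summable (\<lambda>k. cmod (walk J A (t z) k i j))"
  by (rule summable_comparison_test[OF _ sums_summable[OF walk_bound_sums]])
    (use norm_walk_le_walk_bound[OF assms] in auto)

lemma G_sums:
  assumes "cmod z < c" "i \<in> I" "j \<in> I"
  shows "(\<lambda>k. walk J A (t z) k i j) sums G z i j"
  unfolding G_def using summable_norm_cancel[OF walk_summable_norm[OF assms]] by (rule summable_sums)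

lemma norm_G_le:
  assumes "cmod z < c" "i \<in> I" "j \<in> I"
  shows "cmod (G z i j) \<le> kernel_bound i j"
proof -
  have "cmod (G z i j) \<le> (\<Sum>k. cmod (walk J A (t z) k i j))"
    unfolding G_def by (rule summable_norm[OF walk_summable_norm[OF assms]])
  also have "\<dots> \<le> (\<Sum>k. walk_bound i j k)"
    using norm_walk_le_walk_bound[OF assms] walk_summable_norm[OF assms]
      sums_summable[OF walk_bound_sums] by (intro suminf_le) auto
  finally show ?thesis using sums_unique[OF walk_bound_sums] by simp
qed

lemma kernel_bound_nonneg: "0 \<le> kernel_bound i j"
  by (auto simp: kernel_bound_def intro!: add_nonneg_nonneg mult_nonneg_nonneg row_nonneg col_nonneg)

text \<open>Since 4 \<epsilon>^2 \<le> \<epsilon>, the whole Neumann series at most doubles the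
  bound \<epsilon> * sqrt (h i) * sqrt (h j) that holds for single entries.\<close>

lemma kernel_bound_le:
  assumes "i \<in> I" "j \<in> I"
  shows "kernel_bound i j \<le> 2 * \<epsilon> * sqrt (h i) * sqrt (h j)"
proof -
  have "cmod (A i j) \<le> \<epsilon> * sqrt (h i) * sqrt (h j)"
    using entry_le[OF assms] row_le[OF assms(1)] h_pos[OF assms(2)]
    by (meson mult_right_mono order_trans real_sqrt_ge_zero less_imp_le)
  moreover have "row i * col j \<le> (\<epsilon> * sqrt (h i)) * (\<epsilon> * sqrt (h j))"
    using assms \<epsilon> h_pos
    by (intro mult_mono row_le col_le mult_nonneg_nonneg col_nonneg) (auto simp: less_imp_le)
  moreover have "(\<epsilon> * sqrt (h i)) * (\<epsilon> * sqrt (h j)) \<le> (1/4) * (\<epsilon> * sqrt (h i) * sqrt (h j))"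
  proof -
    have "\<epsilon> * (\<epsilon> * sqrt (h i) * sqrt (h j)) \<le> (1/4) * (\<epsilon> * sqrt (h i) * sqrt (h j))"
      using \<epsilon> assms h_pos by (intro mult_right_mono mult_nonneg_nonneg) (auto simp: less_imp_le)
    then show ?thesis by (simp add: mult_ac)
  qed
  ultimately show ?thesis unfolding kernel_bound_def by linarith
qed

lemma kernel_bound_summable:
  assumes "i \<in> I" shows "(\<lambda>j. (kernel_bound i j)\<^sup>2 / h j) summable_on I"
  unfolding kernel_bound_def
  by (intro weighted_square_summable_add h_pos row_summable[OF assms]
      weighted_square_summable_cmult col_square_summable)

lemma kernel_bound_summable':
  assumes "j \<in> I" shows "(\<lambda>i. (kernel_bound i j)\<^sup>2 / h i) summable_on I"
proof -
  have "(\<lambda>i. (cmod (A i j) + (4 * col j) * row i)\<^sup>2 / h i) summable_on I"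
    by (intro weighted_square_summable_add h_pos col_summable[OF assms]
      weighted_square_summable_cmult row_square_summable)
  then show ?thesis by (simp add: kernel_bound_def mult_ac)
qed

lemma kernel_bound_entry:
  assumes "i \<in> I" "j \<in> I"
  shows "(\<lambda>l. kernel_bound i l * cmod (A l j) / h l) summable_on I"
    and "(\<Sum>\<^sub>\<infinity>l\<in>I. kernel_bound i l * cmod (A l j) / h l) \<le> 2 * row i * col j"
proof -
  have eq: "kernel_bound i l * cmod (A l j) / h l
      = cmod (A i l) * cmod (A l j) / h l + 4 * row i * (col l * cmod (A l j) / h l)" for l
    by (simp add: kernel_bound_def add_divide_distrib algebra_simps)
  show "(\<lambda>l. kernel_bound i l * cmod (A l j) / h l) summable_on I"
    unfolding eq by (intro summable_on_add summable_on_cmult_right entry_entry col_entry assms)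
  have "4 * row i * (\<Sum>\<^sub>\<infinity>l\<in>I. col l * cmod (A l j) / h l) \<le> 4 * row i * (\<epsilon> * col j)"
    using row_nonneg by (intro mult_left_mono col_entry assms) auto
  also have "\<dots> \<le> 4 * row i * (1/4 * col j)"
    using \<epsilon> by (intro mult_left_mono mult_right_mono row_nonneg col_nonneg mult_nonneg_nonneg) auto
  finally show "(\<Sum>\<^sub>\<infinity>l\<in>I. kernel_bound i l * cmod (A l j) / h l) \<le> 2 * row i * col j"
    unfolding eq infsum_add[OF entry_entry(1)[OF assms]
        summable_on_cmult_right[OF col_entry(1)[OF assms(2)]]] infsum_cmult_right'
    using entry_entry(2)[OF assms] by simp
qed

text \<open>\<open>kernel_bound\<close> is an entry plus a rank one kernel. For fixed l the
  Cauchy--Schwarz inequality bounds both parts of the sum over m by a multiple of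
  \<open>row l\<close>, and a second application in l completes the proof.\<close>

lemma bilinear_summable:
  assumes u: "(\<lambda>l. (u l)\<^sup>2 / h l) summable_on I" and v: "(\<lambda>m. (v m)\<^sup>2 / h m) summable_on I"
    and u0: "\<And>l. l \<in> I \<Longrightarrow> 0 \<le> u l" and v0: "\<And>l. l \<in> I \<Longrightarrow> 0 \<le> v l"
  shows "(\<lambda>(l, m). u l * kernel_bound l m * v m / (h l * h m)) summable_on I \<times> I"
proof -
  define V where "V = sqrt (\<Sum>\<^sub>\<infinity>m\<in>I. (v m)\<^sup>2 / h m)"
  define C where "C = (\<Sum>\<^sub>\<infinity>m\<in>I. \<bar>col m * v m\<bar> / h m)"
  have A: "(\<lambda>m. \<bar>cmod (A l m) * v m\<bar> / h m) summable_on I"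
    "(\<Sum>\<^sub>\<infinity>m\<in>I. \<bar>cmod (A l m) * v m\<bar> / h m) \<le> row l * V" if "l \<in> I" for l
    using weighted_Cauchy_Schwarz[OF h_pos row_summable[OF that] v] by (auto simp: V_def row_def)
  have B: "(\<lambda>m. \<bar>col m * v m\<bar> / h m) summable_on I"
    using weighted_Cauchy_Schwarz(1)[OF h_pos col_square_summable v] by auto
  have eq: "u l * kernel_bound l m * v m / (h l * h m)
      = (u l / h l) * (\<bar>cmod (A l m) * v m\<bar> / h m + 4 * row l * (\<bar>col m * v m\<bar> / h m))"
    if "l \<in> I" "m \<in> I" for l m
    using that v0[of m] col_nonneg
    by (simp add: kernel_bound_def abs_mult algebra_simps add_divide_distrib)
  have inner: "(\<lambda>m. u l * kernel_bound l m * v m / (h l * h m)) summable_on I"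
    if "l \<in> I" for l
    by (subst summable_on_cong[OF eq[OF that]], assumption)
      (intro summable_on_cmult_right summable_on_add A B that)
  have inner_le: "(\<Sum>\<^sub>\<infinity>m\<in>I. u l * kernel_bound l m * v m / (h l * h m))
      \<le> (V + 4 * C) * (u l * row l / h l)" if "l \<in> I" for l
  proof -
    have "(\<Sum>\<^sub>\<infinity>m\<in>I. u l * kernel_bound l m * v m / (h l * h m))
        = (u l / h l) * ((\<Sum>\<^sub>\<infinity>m\<in>I. \<bar>cmod (A l m) * v m\<bar> / h m) + 4 * row l * C)"
      unfolding C_def
      unfolding infsum_cmult_right'[symmetric]
        infsum_add[OF A(1)[OF that] summable_on_cmult_right[OF B], symmetric]
      unfolding infsum_cmult_right'[symmetric]
      by (rule infsum_cong[OF eq[OF that]])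
    also have "\<dots> \<le> (u l / h l) * (row l * V + 4 * row l * C)"
      using A(2)[OF that] u0[OF that] h_pos[OF that]
      by (intro mult_left_mono add_right_mono) (auto simp: row_def)
    finally show ?thesis by (simp add: algebra_simps add_divide_distrib)
  qed
  have nn: "0 \<le> u l * kernel_bound l m * v m / (h l * h m)" if "l \<in> I" "m \<in> I" for l m
    using that u0 v0 h_pos kernel_bound_nonneg
    by (intro divide_nonneg_pos mult_nonneg_nonneg mult_pos_pos) auto
  have "(\<lambda>l. \<bar>u l * row l\<bar> / h l) summable_on I"
    by (rule weighted_Cauchy_Schwarz(1)[OF h_pos u row_square_summable])
  then have "(\<lambda>l. (V + 4 * C) * (\<bar>u l * row l\<bar> / h l)) summable_on I"
    by (rule summable_on_cmult_right)
  then have outer: "(\<lambda>l. \<Sum>\<^sub>\<infinity>m\<in>I. u l * kernel_bound l m * v m / (h l * h m)) summable_on I"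
    by (rule summable_on_comparison_test)
      (use inner_le u0 row_nonneg nn in \<open>auto intro!: infsum_nonneg\<close>)
  show ?thesis
    by (rule summable_on_SigmaI[where g = "\<lambda>l. \<Sum>\<^sub>\<infinity>m\<in>I. u l * kernel_bound l m * v m / (h l * h m)"])
      (use inner outer nn in \<open>auto intro: has_sum_infsum\<close>)
qed

text \<open>Associativity of row times kernel times column. For infinite matrices this is an
  instance of Fubini's theorem, with \<open>bilinear_summable\<close> as majorant.\<close>

lemma double_sum_swap:
  fixes u v :: "'i \<Rightarrow> complex"
  assumes U: "(\<lambda>l. (U l)\<^sup>2 / h l) summable_on I" and V: "(\<lambda>m. (V m)\<^sup>2 / h m) summable_on I"
    and u: "\<And>l. l \<in> J \<Longrightarrow> cmod (u l) \<le> U l / h l" and v: "\<And>l. l \<in> J \<Longrightarrow> cmod (v l) \<le> V l / h l"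
    and K: "\<And>l m. l \<in> J \<Longrightarrow> m \<in> J \<Longrightarrow> cmod (K l m) \<le> kernel_bound l m"
  shows "(\<Sum>\<^sub>\<infinity>l\<in>J. u l * (\<Sum>\<^sub>\<infinity>m\<in>J. K l m * v m)) = (\<Sum>\<^sub>\<infinity>m\<in>J. (\<Sum>\<^sub>\<infinity>l\<in>J. u l * K l m) * v m)"
    and "(\<lambda>l. u l * (\<Sum>\<^sub>\<infinity>m\<in>J. K l m * v m)) summable_on J"
proof -
  have s: "(\<lambda>(l, m). \<bar>U l\<bar> * kernel_bound l m * \<bar>V m\<bar> / (h l * h m)) summable_on J \<times> J"
    by (rule summable_on_subset_banach[OF bilinear_summable]) (use U V in auto)
  have "(\<lambda>(l, m). u l * (K l m * v m)) abs_summable_on J \<times> J"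
  proof (rule summable_on_comparison_test[OF s])
    fix p assume "p \<in> J \<times> J"
    then obtain l m where p: "p = (l, m)" and lm: "l \<in> J" "m \<in> J" "h l > 0" "h m > 0"
      using h_pos by auto
    have ul: "cmod (u l) \<le> \<bar>U l\<bar> / h l" and vm: "cmod (v m) \<le> \<bar>V m\<bar> / h m"
      using u[OF lm(1)] v[OF lm(2)] lm divide_right_mono[OF abs_ge_self[of "U l"], of "h l"]
        divide_right_mono[OF abs_ge_self[of "V m"], of "h m"] by linarith+
    have "cmod (u l * (K l m * v m)) \<le> (\<bar>U l\<bar> / h l) * (kernel_bound l m * (\<bar>V m\<bar> / h m))"
      unfolding norm_mult using lm
      by (intro mult_mono ul vm K kernel_bound_nonneg mult_nonneg_nonneg) auto
    then show "cmod (case p of (l, m) \<Rightarrow> u l * (K l m * v m))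
        \<le> (case p of (l, m) \<Rightarrow> \<bar>U l\<bar> * kernel_bound l m * \<bar>V m\<bar> / (h l * h m))"
      unfolding p by simp
  qed auto
  then have s: "(\<lambda>(l, m). u l * (K l m * v m)) summable_on J \<times> J" by (rule abs_summable_summable)
  have "(\<Sum>\<^sub>\<infinity>l\<in>J. u l * (\<Sum>\<^sub>\<infinity>m\<in>J. K l m * v m)) = (\<Sum>\<^sub>\<infinity>l\<in>J. \<Sum>\<^sub>\<infinity>m\<in>J. u l * (K l m * v m))"
    by (simp add: infsum_cmult_right')
  also have "\<dots> = (\<Sum>\<^sub>\<infinity>m\<in>J. \<Sum>\<^sub>\<infinity>l\<in>J. u l * (K l m * v m))"
    by (rule infsum_swap_banach[OF s])
  also have "\<dots> = (\<Sum>\<^sub>\<infinity>m\<in>J. \<Sum>\<^sub>\<infinity>l\<in>J. (u l * K l m) * v m)" by (simp add: mult.assoc)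
  finally show "(\<Sum>\<^sub>\<infinity>l\<in>J. u l * (\<Sum>\<^sub>\<infinity>m\<in>J. K l m * v m))
      = (\<Sum>\<^sub>\<infinity>m\<in>J. (\<Sum>\<^sub>\<infinity>l\<in>J. u l * K l m) * v m)" by (simp add: infsum_cmult_left')
  show "(\<lambda>l. u l * (\<Sum>\<^sub>\<infinity>m\<in>J. K l m * v m)) summable_on J"
    using summable_on_Sigma_banach[OF s] by (simp add: infsum_cmult_right')
qed

lemma norm_entry_t:
  assumes "l \<in> J" "cmod z < c" and "cmod a \<le> b"
  shows "cmod (a * t z l) \<le> (2 * b) / h l" "cmod (t z l * a) \<le> (2 * b) / h l"
proof -
  have "cmod a * cmod (t z l) \<le> b * (2 / h l)"
    using assms norm_t_le[OF assms(1,2)] by (intro mult_mono) (auto intro: order_trans[OF norm_ge_zero])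
  then show "cmod (a * t z l) \<le> (2 * b) / h l" "cmod (t z l * a) \<le> (2 * b) / h l"
    by (simp_all add: norm_mult mult_ac)
qed

lemma norm_walk_le_kernel_bound:
  "cmod z < c \<Longrightarrow> i \<in> I \<Longrightarrow> j \<in> I \<Longrightarrow> cmod (walk J A (t z) k i j) \<le> kernel_bound i j"
  using norm_walk_le_walk_bound walk_bound_le_kernel_bound order_trans by blast

text \<open>The recursion of \<open>walk\<close> splits off the first step, this identity the last
  one. It is needed for \<open>G_eq'\<close> and for reversing walks.\<close>

lemma walk_Suc':
  assumes z: "cmod z < c" and ij: "i \<in> I" "j \<in> I"
  shows "walk J A (t z) (Suc k) i j = (\<Sum>\<^sub>\<infinity>l\<in>J. walk J A (t z) k i l * (t z l * A l j))"
  using ij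
proof (induction k arbitrary: i)
  case 0
  then show ?case by (simp add: mult.assoc)
next
  case (Suc k)
  let ?W = "walk J A (t z)"
  have "?W (Suc (Suc k)) i j = (\<Sum>\<^sub>\<infinity>l\<in>J. A i l * t z l * ?W (Suc k) l j)" by simp
  also have "\<dots> = (\<Sum>\<^sub>\<infinity>l\<in>J. A i l * t z l * (\<Sum>\<^sub>\<infinity>m\<in>J. ?W k l m * (t z m * A m j)))"
    using Suc by (intro infsum_cong) auto
  also have "\<dots> = (\<Sum>\<^sub>\<infinity>m\<in>J. (\<Sum>\<^sub>\<infinity>l\<in>J. A i l * t z l * ?W k l m) * (t z m * A m j))"
    by (rule double_sum_swap[where U = "\<lambda>l. 2 * cmod (A i l)" and V = "\<lambda>m. 2 * cmod (A m j)"];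
        (intro weighted_square_summable_cmult row_summable col_summable
         norm_entry_t norm_walk_le_kernel_bound)?) (use Suc.prems z in auto)
  finally show ?case by simp
qed

lemma suminf_infsum_swap:
  fixes F :: "nat \<Rightarrow> 'j \<Rightarrow> complex"
  assumes le: "\<And>k l. l \<in> S \<Longrightarrow> cmod (F k l) \<le> w l k" and w: "\<And>l. l \<in> S \<Longrightarrow> w l sums b l"
    and b: "b summable_on S"
  shows "(\<lambda>k. \<Sum>\<^sub>\<infinity>l\<in>S. F k l) sums (\<Sum>\<^sub>\<infinity>l\<in>S. \<Sum>k. F k l)"
proof -
  have norm: "summable (\<lambda>k. cmod (F k l))" if "l \<in> S" for l
    by (rule summable_comparison_test[OF _ sums_summable[OF w[OF that]]]) (use le[OF that] in auto)
  have has: "((\<lambda>k. F k l) has_sum (\<Sum>k. F k l)) UNIV" if "l \<in> S" for l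
    by (rule norm_summable_imp_has_sum[OF norm[OF that]])
      (use norm[OF that] in \<open>auto dest: summable_norm_cancel intro: summable_sums\<close>)
  have hasn: "((\<lambda>k. cmod (F k l)) has_sum (\<Sum>k. cmod (F k l))) UNIV" if "l \<in> S" for l
    using norm[OF that] by (intro sums_nonneg_imp_has_sum summable_sums) auto
  have "(\<lambda>(l, k). F k l) abs_summable_on S \<times> UNIV"
  proof (rule Infinite_Sum.abs_summable_on_Sigma_iff[THEN iffD2], intro conjI ballI)
    show "(\<lambda>y. case (x, y) of (l, k) \<Rightarrow> F k l) abs_summable_on UNIV" if "x \<in> S" for x
      using has_sum_imp_summable[OF hasn[OF that]] by simp
    have "(\<lambda>l. \<Sum>\<^sub>\<infinity>k. cmod (F k l)) summable_on S"
      using b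
    proof (rule summable_on_comparison_test)
      show "(\<Sum>\<^sub>\<infinity>k. cmod (F k l)) \<le> b l" if "l \<in> S" for l
      proof -
        have "(\<Sum>k. cmod (F k l)) \<le> (\<Sum>k. w l k)"
          by (intro suminf_le le norm that sums_summable[OF w])
        then show ?thesis using sums_unique[OF w[OF that]] infsumI[OF hasn[OF that]] by simp
      qed
    qed (auto intro: infsum_nonneg)
    then show "(\<lambda>x. \<Sum>\<^sub>\<infinity>y. cmod (case (x, y) of (l, k) \<Rightarrow> F k l)) abs_summable_on S"
      by (simp add: infsum_nonneg)
  qed
  then have s: "(\<lambda>(l, k). F k l) summable_on S \<times> UNIV" by (rule abs_summable_summable)
  then have s': "(\<lambda>(k, l). F k l) summable_on UNIV \<times> S"
    using summable_on_swap[THEN iffD1, OF s] by (simp add: case_prod_unfold prod.swap_def o_def)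
  have "((\<lambda>k. \<Sum>\<^sub>\<infinity>l\<in>S. F k l) has_sum (\<Sum>\<^sub>\<infinity>k. \<Sum>\<^sub>\<infinity>l\<in>S. F k l)) UNIV"
    using summable_on_Sigma_banach[OF s'] by (intro has_sum_infsum) simp
  then have "(\<lambda>k. \<Sum>\<^sub>\<infinity>l\<in>S. F k l) sums (\<Sum>\<^sub>\<infinity>k. \<Sum>\<^sub>\<infinity>l\<in>S. F k l)" by (rule has_sum_imp_sums)
  also have "(\<Sum>\<^sub>\<infinity>k. \<Sum>\<^sub>\<infinity>l\<in>S. F k l) = (\<Sum>\<^sub>\<infinity>l\<in>S. \<Sum>\<^sub>\<infinity>k. F k l)"
    using infsum_swap_banach[OF s] by simp
  also have "\<dots> = (\<Sum>\<^sub>\<infinity>l\<in>S. \<Sum>k. F k l)"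
    using has by (intro infsum_cong) (auto intro: infsumI)
  finally show ?thesis .
qed

text \<open>The resolvent identity G = A + A T G. It serves to construct solutions, whereas the
  mirrored identity \<open>G_eq'\<close> serves to eliminate unknowns.\<close>

lemma G_eq:
  assumes z: "cmod z < c" and ij: "i \<in> I" "j \<in> I"
  shows "G z i j = A i j + (\<Sum>\<^sub>\<infinity>l\<in>J. A i l * t z l * G z l j)"
proof -
  let ?W = "walk J A (t z)"
  have "(\<lambda>l. \<bar>(2 * cmod (A i l)) * kernel_bound l j\<bar> / h l) summable_on J"
    by (rule summable_on_subset_banach[OF weighted_Cauchy_Schwarz(1)[OF h_pos
          weighted_square_summable_cmult[OF row_summable[OF ij(1)]] kernel_bound_summable'[OF ij(2)]]]) auto
  then have b: "(\<lambda>l. 2 * cmod (A i l) / h l * kernel_bound l j) summable_on J"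
    using kernel_bound_nonneg by (simp add: abs_mult)
  have "(\<lambda>k. \<Sum>\<^sub>\<infinity>l\<in>J. A i l * t z l * ?W k l j) sums (\<Sum>\<^sub>\<infinity>l\<in>J. \<Sum>k. A i l * t z l * ?W k l j)"
  proof (rule suminf_infsum_swap[OF _ _ b])
    fix l assume l: "l \<in> J"
    then show "(\<lambda>k. (2 * cmod (A i l) / h l) * walk_bound l j k) sums (2 * cmod (A i l) / h l * kernel_bound l j)"
      by (intro sums_mult walk_bound_sums)
    show "cmod (A i l * t z l * ?W k l j) \<le> (2 * cmod (A i l) / h l) * walk_bound l j k" for k
      unfolding norm_mult[of "_ * _"] using l ij z h_pos[of l]
      by (intro mult_mono norm_entry_t norm_walk_le_walk_bound) auto
  qed
  also have "(\<Sum>\<^sub>\<infinity>l\<in>J. \<Sum>k. A i l * t z l * ?W k l j) = (\<Sum>\<^sub>\<infinity>l\<in>J. A i l * t z l * G z l j)"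
    using sums_summable[OF G_sums[OF z]] ij unfolding G_def
    by (intro infsum_cong suminf_mult) auto
  finally have "(\<lambda>k. ?W (Suc k) i j) sums (\<Sum>\<^sub>\<infinity>l\<in>J. A i l * t z l * G z l j)" by simp
  from sums_Suc[OF this]
  show ?thesis using sums_unique2[OF G_sums[OF z ij]] by (simp add: add.commute)
qed

lemma G_eq':
  assumes z: "cmod z < c" and ij: "i \<in> I" "j \<in> I"
  shows "G z i j = A i j + (\<Sum>\<^sub>\<infinity>l\<in>J. G z i l * (t z l * A l j))"
proof -
  let ?W = "walk J A (t z)"
  have "(\<lambda>l. \<bar>(2 * cmod (A l j)) * kernel_bound i l\<bar> / h l) summable_on J"
    by (rule summable_on_subset_banach[OF weighted_Cauchy_Schwarz(1)[OF h_pos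
          weighted_square_summable_cmult[OF col_summable[OF ij(2)]] kernel_bound_summable[OF ij(1)]]]) auto
  then have b: "(\<lambda>l. kernel_bound i l * (2 * cmod (A l j) / h l)) summable_on J"
    using kernel_bound_nonneg by (simp add: abs_mult mult_ac)
  have "(\<lambda>k. \<Sum>\<^sub>\<infinity>l\<in>J. ?W k i l * (t z l * A l j)) sums (\<Sum>\<^sub>\<infinity>l\<in>J. \<Sum>k. ?W k i l * (t z l * A l j))"
  proof (rule suminf_infsum_swap[OF _ _ b])
    fix l assume l: "l \<in> J"
    then show "(\<lambda>k. walk_bound i l k * (2 * cmod (A l j) / h l)) sums (kernel_bound i l * (2 * cmod (A l j) / h l))"
      by (intro sums_mult2 walk_bound_sums)
    show "cmod (?W k i l * (t z l * A l j)) \<le> walk_bound i l k * (2 * cmod (A l j) / h l)" for k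
      unfolding norm_mult[of "?W k i l"] using l ij z h_pos[of l]
      by (intro mult_mono norm_entry_t norm_walk_le_walk_bound)
        (auto intro: order_trans[OF norm_ge_zero norm_walk_le_walk_bound])
  qed
  also have "(\<Sum>\<^sub>\<infinity>l\<in>J. \<Sum>k. ?W k i l * (t z l * A l j)) = (\<Sum>\<^sub>\<infinity>l\<in>J. G z i l * (t z l * A l j))"
    using sums_summable[OF G_sums[OF z]] ij unfolding G_def
    by (intro infsum_cong suminf_mult2[symmetric]) auto
  finally have "(\<lambda>k. ?W (Suc k) i j) sums (\<Sum>\<^sub>\<infinity>l\<in>J. G z i l * (t z l * A l j))"
    unfolding walk_Suc'[OF z ij] .
  from sums_Suc[OF this]
  show ?thesis using sums_unique2[OF G_sums[OF z ij]] by (simp add: add.commute)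
qed

section \<open>Elimination of the nonresonant unknowns\<close>

definition solution :: "complex \<Rightarrow> ('i \<Rightarrow> complex) \<Rightarrow> bool" where
  "solution z x \<longleftrightarrow> (\<lambda>j. h j * (cmod (x j))\<^sup>2) summable_on I \<and>
     (\<forall>i\<in>I. (d i + z) * x i = (\<Sum>\<^sub>\<infinity>j\<in>I. A i j * x j))"

lemma weighted_norm_square: "j \<in> I \<Longrightarrow> (h j * cmod w)\<^sup>2 / h j = h j * (cmod w)\<^sup>2"
  using h_pos[of j] by (simp add: power2_eq_square)

lemma weighted_abs_product: "j \<in> I \<Longrightarrow> \<bar>a * (h j * cmod w)\<bar> / h j = \<bar>a\<bar> * cmod w"
  using h_pos[of j] by (simp add: abs_mult)

text \<open>The rows of A are known to be square summable with the weight 1 / h; the dual weight h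
  in \<open>solution\<close> is what makes the right side of the system converge absolutely.\<close>

lemma entry_times_summable:
  assumes "i \<in> I" "(\<lambda>j. h j * (cmod (x j))\<^sup>2) summable_on I"
  shows "(\<lambda>j. A i j * x j) abs_summable_on I"
proof -
  have "(\<lambda>j. (h j * cmod (x j))\<^sup>2 / h j) summable_on I"
    by (subst summable_on_cong[OF weighted_norm_square]) (use assms in auto)
  from weighted_Cauchy_Schwarz(1)[OF h_pos row_summable[OF assms(1)] this]
  show ?thesis
    by (simp add: weighted_abs_product norm_mult cong: summable_on_cong)
qed

lemma kernel_times_summable:
  assumes "i \<in> I" "(\<lambda>j. h j * (cmod (x j))\<^sup>2) summable_on I"
    and "\<And>l. l \<in> J \<Longrightarrow> cmod (K l) \<le> kernel_bound i l"
  shows "(\<lambda>j. K j * x j) summable_on J"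
proof (rule abs_summable_summable)
  have "(\<lambda>j. (h j * cmod (x j))\<^sup>2 / h j) summable_on I"
    by (subst summable_on_cong[OF weighted_norm_square]) (use assms in auto)
  from weighted_Cauchy_Schwarz(1)[OF h_pos kernel_bound_summable[OF assms(1)] this]
  have "(\<lambda>j. kernel_bound i j * cmod (x j)) summable_on I"
    using kernel_bound_nonneg by (simp add: weighted_abs_product cong: summable_on_cong)
  then have "(\<lambda>j. kernel_bound i j * cmod (x j)) summable_on J"
    by (rule summable_on_subset_banach) auto
  then show "(\<lambda>j. K j * x j) abs_summable_on J"
    by (rule summable_on_comparison_test) (use assms(3) in \<open>auto simp: norm_mult intro!: mult_right_mono\<close>)
qed

lemma infsum_split:
  assumes "g summable_on I"
  shows "(\<Sum>\<^sub>\<infinity>j\<in>I. g j) = (g e + g f + (\<Sum>\<^sub>\<infinity>j\<in>J. g j) :: complex)"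
proof -
  have "I = {e, f} \<union> J" using e f by auto
  then have "(\<Sum>\<^sub>\<infinity>j\<in>I. g j) = (\<Sum>\<^sub>\<infinity>j\<in>{e, f} \<union> J. g j)" by simp
  also have "\<dots> = (\<Sum>\<^sub>\<infinity>j\<in>{e, f}. g j) + (\<Sum>\<^sub>\<infinity>j\<in>J. g j)"
    by (rule infsum_Un_disjoint) (use assms in \<open>auto intro: summable_on_subset_banach\<close>)
  finally show ?thesis using ef by simp
qed

text \<open>Multiply the equation with index l in J by \<open>G z i l * t z l\<close> and sum over
  l. The resolvent identity G T A = G - A removes all unknowns except \<open>x e\<close> and
  \<open>x f\<close>. For i = e and i = f this is the reduced system; for the other i it expresses
  \<open>x i\<close> by the resonant unknowns.\<close>

lemma solution_reduces:
  assumes z: "cmod z < c" and x: "solution z x" and i: "i \<in> I"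
  shows "(d i + z) * x i = G z i e * x e + G z i f * x f"
proof -
  have xs: "(\<lambda>j. h j * (cmod (x j))\<^sup>2) summable_on I"
    and eq: "\<And>l. l \<in> I \<Longrightarrow> (d l + z) * x l = (\<Sum>\<^sub>\<infinity>j\<in>I. A l j * x j)"
    using x by (auto simp: solution_def)
  have split: "(d l + z) * x l = A l e * x e + A l f * x f + (\<Sum>\<^sub>\<infinity>j\<in>J. A l j * x j)" if "l \<in> I" for l
    using infsum_split[OF abs_summable_summable[OF entry_times_summable[OF that xs]]] eq[OF that] by simp
  have xw: "(\<lambda>j. (h j * cmod (x j))\<^sup>2 / h j) summable_on I"
    by (subst summable_on_cong[OF weighted_norm_square]) (use xs in auto)
  have swap: "(\<Sum>\<^sub>\<infinity>l\<in>J. (G z i l * t z l) * (\<Sum>\<^sub>\<infinity>m\<in>J. A l m * x m))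
      = (\<Sum>\<^sub>\<infinity>m\<in>J. (\<Sum>\<^sub>\<infinity>l\<in>J. (G z i l * t z l) * A l m) * x m)"
    and sm: "(\<lambda>l. (G z i l * t z l) * (\<Sum>\<^sub>\<infinity>m\<in>J. A l m * x m)) summable_on J"
  proof -
    have G_le: "cmod (G z i l * t z l) \<le> (2 * kernel_bound i l) / h l" if "l \<in> J" for l
      using that z i by (intro norm_entry_t norm_G_le) auto
    have x_le: "cmod (x l) \<le> (h l * cmod (x l)) / h l" if "l \<in> J" for l
      using that h_pos[of l] by simp
    have A_le: "cmod (A l m) \<le> kernel_bound l m" for l m
      using row_nonneg col_nonneg by (simp add: kernel_bound_def)
    note S = double_sum_swap[OF weighted_square_summable_cmult[OF kernel_bound_summable[OF i], of 2] xw,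
        OF G_le x_le A_le]
    show "(\<Sum>\<^sub>\<infinity>l\<in>J. (G z i l * t z l) * (\<Sum>\<^sub>\<infinity>m\<in>J. A l m * x m))
        = (\<Sum>\<^sub>\<infinity>m\<in>J. (\<Sum>\<^sub>\<infinity>l\<in>J. (G z i l * t z l) * A l m) * x m)" by (rule S(1))
    show "(\<lambda>l. (G z i l * t z l) * (\<Sum>\<^sub>\<infinity>m\<in>J. A l m * x m)) summable_on J" by (rule S(2))
  qed
  have Ax: "(\<lambda>m. A i m * x m) summable_on J"
    using abs_summable_summable[OF entry_times_summable[OF i xs]] by (rule summable_on_subset_banach) auto
  have Gx: "(\<lambda>m. G z i m * x m) summable_on J"
    by (rule kernel_times_summable[OF i xs]) (use z i norm_G_le in auto)
  have GA: "(\<Sum>\<^sub>\<infinity>l\<in>J. (G z i l * t z l) * A l m) = G z i m - A i m" if "m \<in> I" for m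
    using G_eq'[OF z i that] by (simp add: mult.assoc)
  have "(\<Sum>\<^sub>\<infinity>l\<in>J. (G z i l * t z l) * (A l e * x e + A l f * x f))
      = (\<Sum>\<^sub>\<infinity>l\<in>J. G z i l * x l - (G z i l * t z l) * (\<Sum>\<^sub>\<infinity>m\<in>J. A l m * x m))"
  proof (rule infsum_cong)
    fix l assume l: "l \<in> J"
    then have "A l e * x e + A l f * x f = (d l + z) * x l - (\<Sum>\<^sub>\<infinity>m\<in>J. A l m * x m)"
      using split[of l] by (simp add: algebra_simps)
    moreover have "t z l * (d l + z) = 1"
      using denominator_nonzero[OF l z] by (simp add: t_def)
    ultimately show "(G z i l * t z l) * (A l e * x e + A l f * x f)
        = G z i l * x l - (G z i l * t z l) * (\<Sum>\<^sub>\<infinity>m\<in>J. A l m * x m)"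
      by (simp add: right_diff_distrib mult.assoc[of "G z i l"] mult.assoc[symmetric, of "t z l"])
  qed
  also have "\<dots> = (\<Sum>\<^sub>\<infinity>l\<in>J. G z i l * x l) - (\<Sum>\<^sub>\<infinity>l\<in>J. (G z i l * t z l) * (\<Sum>\<^sub>\<infinity>m\<in>J. A l m * x m))"
    using infsum_add[OF Gx summable_on_uminus[THEN iffD2, OF sm]] by (simp add: infsum_uminus)
  also have "(\<Sum>\<^sub>\<infinity>l\<in>J. (G z i l * t z l) * (\<Sum>\<^sub>\<infinity>m\<in>J. A l m * x m))
      = (\<Sum>\<^sub>\<infinity>m\<in>J. G z i m * x m - A i m * x m)"
    unfolding swap by (intro infsum_cong) (simp add: GA left_diff_distrib)
  also have "\<dots> = (\<Sum>\<^sub>\<infinity>m\<in>J. G z i m * x m) - (\<Sum>\<^sub>\<infinity>m\<in>J. A i m * x m)"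
    using infsum_add[OF Gx summable_on_uminus[THEN iffD2, OF Ax]] by (simp add: infsum_uminus)
  finally have 1: "(\<Sum>\<^sub>\<infinity>l\<in>J. (G z i l * t z l) * (A l e * x e + A l f * x f)) = (\<Sum>\<^sub>\<infinity>m\<in>J. A i m * x m)"
    by simp
  have GAs: "(\<lambda>l. G z i l * t z l * A l m) summable_on J" if "m \<in> I" for m
  proof (rule abs_summable_summable, rule summable_on_comparison_test)
    show "(\<lambda>l. 2 * (kernel_bound i l * cmod (A l m) / h l)) summable_on J"
      by (rule summable_on_subset_banach[OF summable_on_cmult_right[OF kernel_bound_entry(1)[OF i that]]]) auto
    show "cmod (G z i l * t z l * A l m) \<le> 2 * (kernel_bound i l * cmod (A l m) / h l)" if "l \<in> J" for l
    proof -
      have "cmod (G z i l * t z l) \<le> (2 * kernel_bound i l) / h l"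
        using that z i by (intro norm_entry_t norm_G_le) auto
      from mult_right_mono[OF this norm_ge_zero[of "A l m"]] show ?thesis
        by (simp add: norm_mult)
    qed
  qed auto
  have "(\<Sum>\<^sub>\<infinity>l\<in>J. (G z i l * t z l) * (A l e * x e + A l f * x f))
      = (\<Sum>\<^sub>\<infinity>l\<in>J. (G z i l * t z l * A l e) * x e + (G z i l * t z l * A l f) * x f)"
    by (simp add: distrib_left mult.assoc)
  also have "\<dots> = (\<Sum>\<^sub>\<infinity>l\<in>J. (G z i l * t z l * A l e) * x e) + (\<Sum>\<^sub>\<infinity>l\<in>J. (G z i l * t z l * A l f) * x f)"
    by (intro infsum_add summable_on_cmult_left GAs e f)
  also have "\<dots> = (G z i e - A i e) * x e + (G z i f - A i f) * x f"
    by (simp only: infsum_cmult_left' GA e f)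
  finally show ?thesis using split[OF i] 1 by (simp add: algebra_simps)
qed

text \<open>The pair (xe, xf) is extended by the formula of \<open>solution_reduces\<close>. By
  \<open>G_eq\<close> the vector y then equals A x at every index, and the two hypotheses are the
  equations at e and f.\<close>

lemma solution_exists:
  assumes z: "cmod z < c" and xe: "z * xe = G z e e * xe + G z e f * xf"
    and xf: "z * xf = G z f e * xe + G z f f * xf"
  obtains x where "solution z x" "x e = xe" "x f = xf"
proof -
  define y where "y i = G z i e * xe + G z i f * xf" for i
  define x where "x i = (if i = e then xe else if i = f then xf else t z i * y i)" for i
  have [simp]: "x e = xe" "x f = xf" using ef by (auto simp: x_def)
  have y_le: "cmod (y i) \<le> cmod xe * kernel_bound i e + cmod xf * kernel_bound i f" if "i \<in> I" for i
  proof -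
    have "cmod (y i) \<le> cmod (G z i e) * cmod xe + cmod (G z i f) * cmod xf"
      unfolding y_def by (metis norm_mult norm_triangle_ineq)
    also have "\<dots> \<le> kernel_bound i e * cmod xe + kernel_bound i f * cmod xf"
      using that z e f by (intro add_mono mult_right_mono norm_G_le) auto
    finally show ?thesis by (simp add: mult.commute)
  qed
  have "(\<lambda>i. (cmod xe * kernel_bound i e + cmod xf * kernel_bound i f)\<^sup>2 / h i) summable_on I"
    by (intro weighted_square_summable_add weighted_square_summable_cmult kernel_bound_summable' e f h_pos)
  from weighted_square_summable_cmult[OF this, of 2]
  have b: "(\<lambda>i. (2 * (cmod xe * kernel_bound i e + cmod xf * kernel_bound i f))\<^sup>2 / h i) summable_on J"
    by (rule summable_on_subset_banach) auto
  have "(\<lambda>i. h i * (cmod (x i))\<^sup>2) summable_on J"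
  proof (rule summable_on_comparison_test[OF b])
    fix i assume i: "i \<in> J"
    then have hi: "h i > 0" by (simp add: h_pos)
    have "cmod (x i) \<le> (2 * (cmod xe * kernel_bound i e + cmod xf * kernel_bound i f)) / h i"
      using i norm_entry_t(2)[OF i z y_le[of i]] by (simp add: x_def)
    then have "(h i * cmod (x i)) \<le> 2 * (cmod xe * kernel_bound i e + cmod xf * kernel_bound i f)"
      using hi by (simp add: pos_le_divide_eq mult.commute)
    then have "(h i * cmod (x i))\<^sup>2 / h i
        \<le> (2 * (cmod xe * kernel_bound i e + cmod xf * kernel_bound i f))\<^sup>2 / h i"
      using hi by (intro divide_right_mono power_mono) auto
    then show "h i * (cmod (x i))\<^sup>2 \<le> (2 * (cmod xe * kernel_bound i e + cmod xf * kernel_bound i f))\<^sup>2 / h i"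
      using i by (simp only: weighted_norm_square Diff_iff)
  next
    show "0 \<le> h i * (cmod (x i))\<^sup>2" if "i \<in> J" for i
      using that h_pos[of i] by simp
  qed
  then have "(\<lambda>i. h i * (cmod (x i))\<^sup>2) summable_on insert e (insert f J)"
    by (simp only: summable_on_insert_iff)
  moreover have "insert e (insert f J) = I" using e f by auto
  ultimately have xs: "(\<lambda>i. h i * (cmod (x i))\<^sup>2) summable_on I" by simp
  have sum_eq: "(\<Sum>\<^sub>\<infinity>j\<in>I. A i j * x j) = y i" if i: "i \<in> I" for i
  proof -
    have Gs: "(\<lambda>l. A i l * t z l * G z l j) summable_on J" if j: "j \<in> I" for j
    proof (rule abs_summable_summable, rule summable_on_comparison_test)
      show "(\<lambda>l. \<bar>(2 * cmod (A i l)) * kernel_bound l j\<bar> / h l) summable_on J"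
        by (rule summable_on_subset_banach[OF weighted_Cauchy_Schwarz(1)[OF h_pos
          weighted_square_summable_cmult[OF row_summable[OF i]] kernel_bound_summable'[OF j]]]) auto
      show "cmod (A i l * t z l * G z l j) \<le> \<bar>(2 * cmod (A i l)) * kernel_bound l j\<bar> / h l"
        if "l \<in> J" for l
      proof -
        have "cmod (A i l * t z l) * cmod (G z l j) \<le> (2 * cmod (A i l)) / h l * kernel_bound l j"
          using that j z h_pos[of l] by (intro mult_mono norm_entry_t norm_G_le) auto
        then show ?thesis using kernel_bound_nonneg by (simp add: norm_mult abs_mult)
      qed
    qed auto
    have "(\<Sum>\<^sub>\<infinity>j\<in>I. A i j * x j) = A i e * xe + A i f * xf + (\<Sum>\<^sub>\<infinity>j\<in>J. A i j * x j)"
      using infsum_split[OF abs_summable_summable[OF entry_times_summable[OF i xs]]] by simp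
    also have "(\<Sum>\<^sub>\<infinity>j\<in>J. A i j * x j)
        = (\<Sum>\<^sub>\<infinity>l\<in>J. (A i l * t z l * G z l e) * xe + (A i l * t z l * G z l f) * xf)"
      by (intro infsum_cong) (simp add: x_def y_def algebra_simps)
    also have "\<dots> = (\<Sum>\<^sub>\<infinity>l\<in>J. A i l * t z l * G z l e) * xe + (\<Sum>\<^sub>\<infinity>l\<in>J. A i l * t z l * G z l f) * xf"
      unfolding infsum_cmult_left'[symmetric] by (intro infsum_add summable_on_cmult_left Gs e f)
    finally show ?thesis
      using G_eq[OF z i e] G_eq[OF z i f] by (simp add: y_def algebra_simps)
  qed
  have "solution z x"
    unfolding solution_def
  proof (intro conjI ballI xs)
    fix i assume i: "i \<in> I"
    show "(d i + z) * x i = (\<Sum>\<^sub>\<infinity>j\<in>I. A i j * x j)"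
    proof (cases "i \<in> J")
      case True
      then show ?thesis
        using sum_eq[OF i] denominator_nonzero[OF True z] by (simp add: x_def t_def)
    next
      case False
      then show ?thesis
        using sum_eq[OF i] xe xf i by (auto simp: d_e d_f y_def)
    qed
  qed
  then show ?thesis by (rule that) simp_all
qed

theorem nontrivial_solution_iff:
  assumes z: "cmod z < c"
  shows "(\<exists>x. (\<exists>i\<in>I. x i \<noteq> 0) \<and> solution z x)
     \<longleftrightarrow> (z - G z e e) * (z - G z f f) = G z e f * G z f e" (is "?L \<longleftrightarrow> ?R")
proof
  assume ?L
  then obtain x i where x: "solution z x" and i: "i \<in> I" "x i \<noteq> 0" by blast
  note red = solution_reduces[OF z x]
  have nz: "x e \<noteq> 0 \<or> x f \<noteq> 0"
  proof (rule ccontr)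
    assume "\<not> ?thesis"
    with red[OF i(1)] i show False
      using denominator_nonzero[of i z] z by auto
  qed
  have xe: "(z - G z e e) * x e = G z e f * x f" and xf: "(z - G z f f) * x f = G z f e * x e"
    using red[OF e] red[OF f] by (simp_all add: d_e d_f algebra_simps)
  \<comment> \<open>Multiplication by the adjugate matrix shows that the determinant annihilates
    both \<open>x e\<close> and \<open>x f\<close>.\<close>
  have "(z - G z e e) * (z - G z f f) * x e = (z - G z f f) * ((z - G z e e) * x e)"
    by (simp only: mult_ac)
  also have "\<dots> = G z e f * ((z - G z f f) * x f)" unfolding xe by (simp only: mult_ac)
  finally have 1: "(z - G z e e) * (z - G z f f) * x e = G z e f * G z f e * x e"
    unfolding xf by (simp only: mult.assoc)
  have "(z - G z e e) * (z - G z f f) * x f = (z - G z e e) * ((z - G z f f) * x f)"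
    by (simp only: mult_ac)
  also have "\<dots> = G z f e * ((z - G z e e) * x e)" unfolding xf by (simp only: mult_ac)
  finally have 2: "(z - G z e e) * (z - G z f f) * x f = G z e f * G z f e * x f"
    unfolding xe by (simp only: mult_ac)
  show ?R using nz 1 2 by (metis mult_cancel_right)
next
  assume R: ?R
  \<comment> \<open>The vector (G z e f, z - G z e e) lies in the kernel of the singular 2 x 2
    matrix. If it is zero, the first equation is void and a solution of the second one is written
    down.\<close>
  have "\<exists>xe xf. (xe \<noteq> 0 \<or> xf \<noteq> 0) \<and> (z - G z e e) * xe = G z e f * xf \<and> (z - G z f f) * xf = G z f e * xe"
  proof (cases "G z e f = 0 \<and> z = G z e e")
    case True
    show ?thesis
    proof (cases "z = G z f f")
      case True2: True
      show ?thesis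
      proof (cases "G z f e = 0")
        case False
        then show ?thesis using True True2 by (intro exI[of _ 0] exI[of _ 1]) auto
      qed (use True True2 in \<open>auto intro!: exI[of _ 1]\<close>)
    next
      case False
      then show ?thesis using True
        by (intro exI[of _ 1] exI[of _ "G z f e / (z - G z f f)"]) auto
    qed
  next
    case False
    then show ?thesis using R
      by (intro exI[of _ "G z e f"] exI[of _ "z - G z e e"]) (auto simp: mult.commute)
  qed
  then obtain xe xf where x: "xe \<noteq> 0 \<or> xf \<noteq> 0" "(z - G z e e) * xe = G z e f * xf"
    "(z - G z f f) * xf = G z f e * xe" by blast
  then have "z * xe = G z e e * xe + G z e f * xf" "z * xf = G z f e * xe + G z f f * xf"
    by (simp_all add: algebra_simps)
  then obtain y where "solution z y" "y e = xe" "y f = xf" by (rule solution_exists[OF z])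
  then show ?L using x(1) e f by (intro exI[of _ y]) auto
qed

text \<open>Reversing a walk and applying \<sigma> preserves its weight. In the Hill case \<sigma>
  is the reflection of the index, in the Dirac case the exchange of components. As \<sigma>
  exchanges e and f, the two diagonal entries of G agree, which is why a single \<alpha> appears in
  the characteristic equation.\<close>

lemma walk_involution:
  assumes z: "cmod z < c" and \<sigma>: "\<And>i. i \<in> I \<Longrightarrow> \<sigma> i \<in> I" "\<And>i. i \<in> I \<Longrightarrow> \<sigma> (\<sigma> i) = i" "\<sigma> e = f"
    and A: "\<And>i j. i \<in> I \<Longrightarrow> j \<in> I \<Longrightarrow> A (\<sigma> j) (\<sigma> i) = A i j" and d: "\<And>i. i \<in> I \<Longrightarrow> d (\<sigma> i) = d i"
    and ij: "i \<in> I" "j \<in> I"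
  shows "walk J A (t z) k (\<sigma> j) (\<sigma> i) = walk J A (t z) k i j"
  using ij
proof (induction k arbitrary: i)
  case (Suc k)
  let ?W = "walk J A (t z)"
  have "\<sigma> f = e" using \<sigma>(2)[OF e] \<sigma>(3) by simp
  have "\<sigma> l \<in> J" if "l \<in> J" for l
    using that \<sigma>(1)[of l] \<sigma>(2)[of l] \<open>\<sigma> f = e\<close> \<sigma>(3) by (metis DiffD1 DiffD2 DiffI insert_iff singletonD)
  then have bij: "bij_betw \<sigma> J J"
    by (intro bij_betw_byWitness[where f' = \<sigma>]) (use \<sigma>(2) in auto)
  have "?W (Suc k) (\<sigma> j) (\<sigma> i) = (\<Sum>\<^sub>\<infinity>l\<in>J. ?W k (\<sigma> j) l * (t z l * A l (\<sigma> i)))"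
    using Suc \<sigma> by (intro walk_Suc' z) auto
  also have "\<dots> = (\<Sum>\<^sub>\<infinity>l\<in>J. ?W k (\<sigma> j) (\<sigma> l) * (t z (\<sigma> l) * A (\<sigma> l) (\<sigma> i)))"
    by (rule infsum_reindex_bij_betw[OF bij, symmetric])
  also have "\<dots> = (\<Sum>\<^sub>\<infinity>l\<in>J. A i l * t z l * ?W k l j)"
  proof (rule infsum_cong)
    fix l assume l: "l \<in> J"
    have "t z (\<sigma> l) = t z l" using l d by (simp add: t_def)
    then show "?W k (\<sigma> j) (\<sigma> l) * (t z (\<sigma> l) * A (\<sigma> l) (\<sigma> i)) = A i l * t z l * ?W k l j"
      using Suc l A by simp
  qed
  finally show ?case by simp
qed (simp add: A)

lemma G_involution:
  assumes z: "cmod z < c" and \<sigma>: "\<And>i. i \<in> I \<Longrightarrow> \<sigma> i \<in> I" "\<And>i. i \<in> I \<Longrightarrow> \<sigma> (\<sigma> i) = i" "\<sigma> e = f"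
    and A: "\<And>i j. i \<in> I \<Longrightarrow> j \<in> I \<Longrightarrow> A (\<sigma> j) (\<sigma> i) = A i j" and d: "\<And>i. i \<in> I \<Longrightarrow> d (\<sigma> i) = d i"
  shows "G z f f = G z e e"
  using walk_involution[OF z \<sigma> A d e e] \<sigma>(3) by (simp add: G_def)

section \<open>Holomorphic dependence on z\<close>

lemma walk_holomorphic:
  assumes "i \<in> I" "j \<in> I" shows "(\<lambda>z. walk J A (t z) k i j) holomorphic_on ball 0 c"
  using assms
proof (induction k arbitrary: i)
  case (Suc k)
  have "(\<lambda>z. \<Sum>\<^sub>\<infinity>l\<in>J. A i l * t z l * walk J A (t z) k l j) holomorphic_on ball 0 c"
  proof (rule holomorphic_on_infsum[OF _ open_ball _ abs_walk_summable[OF Suc.prems, of k]])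
    fix l assume l: "l \<in> J"
    then show "(\<lambda>z. A i l * t z l * walk J A (t z) k l j) holomorphic_on ball 0 c"
      unfolding t_def using denominator_nonzero[OF l] Suc.IH[of l] Suc.prems
      by (auto intro!: holomorphic_intros simp: t_def[abs_def])
    fix z :: complex assume "z \<in> ball 0 c"
    then show "cmod (A i l * t z l * walk J A (t z) k l j) \<le> cmod (A i l) * (2 / h l) * abs_walk k l j"
      using dominated_walk.walk_term_le[OF dominated Suc.prems l] by simp
  qed
  then show ?case by simp
qed simp

lemma G_holomorphic:
  assumes "i \<in> I" "j \<in> I" shows "(\<lambda>z. G z i j) holomorphic_on ball 0 c"
proof (rule holomorphic_uniform_sequence[OF open_ball])
  show "(\<lambda>z. \<Sum>k<n. walk J A (t z) k i j) holomorphic_on ball 0 c" for n :: nat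
    by (intro holomorphic_on_sum walk_holomorphic assms)
  fix w :: complex assume "w \<in> ball 0 c"
  then obtain r where r: "r > 0" "cball w r \<subseteq> ball 0 c"
    using open_contains_cball open_ball by blast
  have "uniform_limit (cball w r) (\<lambda>n z. \<Sum>k<n. walk J A (t z) k i j) (\<lambda>z. G z i j) sequentially"
    unfolding G_def
    by (rule Weierstrass_m_test[OF _ sums_summable[OF walk_bound_sums[of i j]]])
      (use r assms in \<open>auto intro!: norm_walk_le_walk_bound\<close>)
  then show "\<exists>r>0. cball w r \<subseteq> ball 0 c \<and>
      uniform_limit (cball w r) (\<lambda>n z. \<Sum>k<n. walk J A (t z) k i j) (\<lambda>z. G z i j) sequentially"
    using r by blast
qed

end

subsection \<open>The characteristic equation\<close>

text \<open>What the analysis of the roots uses about the functionals. The bounds are relative to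
  the radius of the disc, so that Cauchy's estimate turns them into Lipschitz constants proportional
  to \<theta>.\<close>

definition reduction :: "potential \<Rightarrow> real \<Rightarrow> int \<Rightarrow> bool" where
  "reduction v \<theta> n \<longleftrightarrow>
     alpha v n holomorphic_on ball 0 (disc_radius v n) \<and>
     beta_minus v n holomorphic_on ball 0 (disc_radius v n) \<and>
     beta_plus v n holomorphic_on ball 0 (disc_radius v n) \<and>
     (\<forall>z. cmod z < disc_radius v n \<longrightarrow>
        cmod (alpha v n z) \<le> \<theta> * disc_radius v n \<and>
        cmod (beta_minus v n z) \<le> \<theta> * disc_radius v n \<and>
        cmod (beta_plus v n z) \<le> \<theta> * disc_radius v n \<and>
        (eigenvalue v (bc_of n) (lambda0 v n + z) \<longleftrightarrow>
           (z - alpha v n z)\<^sup>2 = beta_minus v n z * beta_plus v n z))"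

text \<open>The factor 8 is that of the Hill case, where the weight at a resonant index is
  \<open>br 0 * br (2 * n) = 2 * n\<close> and c = n / 4. In the Dirac case the weight is 1 and c =
  1 / 2. The 16 is the product of 8 with the 2 of \<open>kernel_bound_le\<close>.\<close>

lemma (in perturbed_diagonal) norm_G_le_scale:
  assumes "cmod z < c" "i \<in> I" "j \<in> I" "h i \<le> 8 * c" "h j \<le> 8 * c" "\<epsilon> \<le> \<theta> / 16"
  shows "cmod (G z i j) \<le> \<theta> * c"
proof -
  have c: "0 \<le> c" using assms(1) norm_ge_zero[of z] by linarith
  have "cmod (G z i j) \<le> 2 * \<epsilon> * sqrt (h i) * sqrt (h j)"
    using norm_G_le[OF assms(1-3)] kernel_bound_le[OF assms(2,3)] by (rule order_trans)
  also have "\<dots> = 2 * \<epsilon> * (sqrt (h i) * sqrt (h j))" by simp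
  also have "\<dots> \<le> 2 * \<epsilon> * (sqrt (8 * c) * sqrt (8 * c))"
    using assms h_pos[OF assms(2)] h_pos[OF assms(3)] \<epsilon> c
    by (intro mult_left_mono mult_mono real_sqrt_le_mono) auto
  also have "\<dots> = 16 * \<epsilon> * c" using c by simp
  also have "\<dots> \<le> \<theta> * c" using assms(6) c by (intro mult_right_mono) auto
  finally show ?thesis .
qed

text \<open>For j different from n and -n the brackets equal |n - j| and |n + j|, and their product
  is at least n. A perturbation |z| < n / 4 therefore costs less than half of it.\<close>

lemma hill_denominator:
  assumes n: "1 \<le> n" and j: "j \<noteq> n" "j \<noteq> - n" and z: "cmod z < of_int n / 4"
  shows "br (n - j) * br (n + j) / 2 \<le> cmod (of_int (n\<^sup>2 - j\<^sup>2) + z)"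
proof -
  have b: "br (n - j) = \<bar>of_int (n - j)\<bar>" "br (n + j) = \<bar>of_int (n + j)\<bar>"
    using j unfolding br_def by (auto simp: max_def)
  have eq: "br (n - j) * br (n + j) = \<bar>of_int (n\<^sup>2 - j\<^sup>2)\<bar>"
    unfolding b abs_mult[symmetric] of_int_mult[symmetric] by (simp add: power2_eq_square algebra_simps)
  have "n * 1 \<le> \<bar>n - j\<bar> * \<bar>n + j\<bar>"
  proof (cases "0 \<le> j")
    case True
    then have "1 * n \<le> \<bar>n - j\<bar> * \<bar>n + j\<bar>" using n j by (intro mult_mono) auto
    then show ?thesis by simp
  next
    case False
    then show ?thesis using n j by (intro mult_mono) auto
  qed
  then have "real_of_int n \<le> of_int (\<bar>n - j\<bar> * \<bar>n + j\<bar>)"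
    by (simp only: of_int_le_iff mult_1_right)
  then have "of_int n \<le> br (n - j) * br (n + j)" unfolding b by simp
  moreover have "cmod (of_int (n\<^sup>2 - j\<^sup>2)) = br (n - j) * br (n + j)"
    unfolding eq by (simp only: norm_of_int)
  moreover have "cmod (of_int (n\<^sup>2 - j\<^sup>2)) - cmod z \<le> cmod (of_int (n\<^sup>2 - j\<^sup>2) + z)"
    using norm_diff_ineq[of "of_int (n\<^sup>2 - j\<^sup>2)" z] .
  ultimately show ?thesis using z n by linarith
qed

lemma path_weight_hill:
  "path_weight (\<lambda>i j. V (i - j)) (\<lambda>j. 1 / (of_int (n\<^sup>2 - j\<^sup>2) + z)) a js b
     = hill_chain V a js b / prod_list (map (\<lambda>j. of_int (n\<^sup>2 - j\<^sup>2) + z) js)"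
  by (induction js arbitrary: a) auto

text \<open>For fixed n the weight of the abstract system and the weight 1 + j^2 of the function
  space are equivalent. The constants may depend on n, since the comparison only decides which
  sequences are admissible.\<close>

lemma hill_weight_compare:
  assumes n: "1 \<le> n"
  shows "br (n - j) * br (n + j) \<le> 2 * (1 + of_int n)\<^sup>2 * (1 + (of_int j)\<^sup>2)"
    and "1 + (of_int j)\<^sup>2 \<le> (2 + (of_int n)\<^sup>2) * (br (n - j) * br (n + j))"
proof -
  define N where "N = real_of_int n"
  define t where "t = \<bar>real_of_int j\<bar>"
  have N: "1 \<le> N" using n by (simp add: N_def)
  have t: "0 \<le> t" "(of_int j)\<^sup>2 = t\<^sup>2" by (simp_all add: t_def)
  have "br (n - j) \<le> 1 + N + t" "br (n + j) \<le> 1 + N + t"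
    using n unfolding br_def N_def t_def by auto
  then have "br (n - j) * br (n + j) \<le> (1 + N + t) * (1 + N + t)"
    using br_pos[of "n + j"] N t by (intro mult_mono) auto
  also have "\<dots> \<le> 2 * (1 + N)\<^sup>2 + 2 * t\<^sup>2"
    using sum_squares_bound[of "1 + N" t] by (simp add: power2_eq_square algebra_simps)
  also have "\<dots> \<le> 2 * (1 + N)\<^sup>2 * (1 + t\<^sup>2)"
  proof -
    have "1 * t\<^sup>2 \<le> (1 + N)\<^sup>2 * t\<^sup>2" using N by (intro mult_right_mono) (auto simp: one_le_power)
    then show ?thesis by (simp add: algebra_simps)
  qed
  finally show "br (n - j) * br (n + j) \<le> 2 * (1 + of_int n)\<^sup>2 * (1 + (of_int j)\<^sup>2)"
    by (simp only: N_def t(2))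
  let ?h = "br (n - j) * br (n + j)"
  have h1: "1 \<le> ?h" using mult_mono[OF br_ge_1[of "n - j"] br_ge_1[of "n + j"]] br_pos[of "n - j"] by simp
  have "\<bar>real_of_int (n - j)\<bar> * \<bar>real_of_int (n + j)\<bar> \<le> ?h"
    using br_pos[of "n - j"] by (intro mult_mono br_ge_abs) auto
  moreover have "(real_of_int (n - j)) * (real_of_int (n + j)) = N\<^sup>2 - t\<^sup>2"
    unfolding N_def t(2)[symmetric] by (simp add: power2_eq_square algebra_simps)
  then have "\<bar>real_of_int (n - j)\<bar> * \<bar>real_of_int (n + j)\<bar> = \<bar>N\<^sup>2 - t\<^sup>2\<bar>" by (simp only: abs_mult[symmetric])
  ultimately have "t\<^sup>2 \<le> ?h + N\<^sup>2" by linarith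
  moreover have "N\<^sup>2 * 1 \<le> N\<^sup>2 * ?h" using h1 by (intro mult_left_mono) auto
  ultimately have "1 + t\<^sup>2 \<le> (2 + N\<^sup>2) * ?h" using h1 by (simp add: algebra_simps)
  then show "1 + (of_int j)\<^sup>2 \<le> (2 + (of_int n)\<^sup>2) * ?h" by (simp only: N_def t(2))
qed

lemma hill_reduction:
  assumes q: "L2 q" and n: "1 \<le> n" and \<epsilon>: "0 \<le> \<epsilon>" "\<epsilon> \<le> 1/4" "\<epsilon> \<le> \<theta> / 16"
    and HS: "(\<lambda>(i, j). (cmod (hill_coeff C q (i - j)))\<^sup>2 / ((br (n - i) * br (n + i)) * (br (n - j) * br (n + j))))
      summable_on parity_class n \<times> parity_class n"
    and HS_le: "(\<Sum>\<^sub>\<infinity>(i, j)\<in>parity_class n \<times> parity_class n.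
      (cmod (hill_coeff C q (i - j)))\<^sup>2 / ((br (n - i) * br (n + i)) * (br (n - j) * br (n + j)))) \<le> \<epsilon>\<^sup>2"
  shows "reduction (Hill C q) \<theta> n"
proof -
  let ?V = "hill_coeff C q"
  let ?c = "of_int n / 4 :: real"
  interpret P: perturbed_diagonal "parity_class n" n "- n" "\<lambda>i j. ?V (i - j)" "\<lambda>j. of_int (n\<^sup>2 - j\<^sup>2)"
    "\<lambda>j. br (n - j) * br (n + j)" ?c \<epsilon>
  proof
    show "0 < br (n - i) * br (n + i)" for i by (simp add: br_pos)
    show "br (n - i) * br (n + i) / 2 \<le> cmod (of_int (n\<^sup>2 - i\<^sup>2) + z)"
      if "i \<in> parity_class n - {n, - n}" "cmod z < ?c" for i z
      by (rule hill_denominator[OF n]) (use that in auto)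
  qed (use n HS HS_le \<epsilon> in auto)
  have t: "P.t z = (\<lambda>j. 1 / (of_int (n\<^sup>2 - j\<^sup>2) + z))" for z
    by (rule ext) (rule P.t_def)
  have series: "hill_series ?V n z a b = P.G z a b"
    if z: "cmod z < ?c" and ab: "a \<in> parity_class n" "b \<in> parity_class n" for z a b
  proof -
    \<comment> \<open>The series counts lists of length k + 1; the empty list is the separate
      summand \<open>V (a - b)\<close>.\<close>
    have lists: "{js. length js = k + 1 \<and> set js \<subseteq> {j. even (j - n) \<and> j \<noteq> n \<and> j \<noteq> - n}}
        = lists_of_length P.J (Suc k)" for k by auto
    have "(\<lambda>k. walk P.J (\<lambda>i j. ?V (i - j)) (P.t z) (Suc k) a b) sums (P.G z a b - ?V (a - b))"
      by (rule sums_Suc_iff[THEN iffD2]) (use P.G_sums[OF z ab] in simp)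
    then have "(\<lambda>k. \<Sum>\<^sub>\<infinity>js\<in>lists_of_length P.J (Suc k). path_weight (\<lambda>i j. ?V (i - j)) (P.t z) a js b)
        sums (P.G z a b - ?V (a - b))"
      by (simp only: dominated_walk.walk_eq_infsum_lists[OF P.dominated[OF z] ab])
    from sums_unique[OF this]
    have "?V (a - b) + (\<Sum>k. \<Sum>\<^sub>\<infinity>js\<in>lists_of_length P.J (Suc k). path_weight (\<lambda>i j. ?V (i - j)) (P.t z) a js b)
        = ?V (a - b) + (P.G z a b - ?V (a - b))" by (rule arg_cong[OF sym])
    also have "\<dots> = P.G z a b" by (simp only: add_diff_eq add_diff_cancel_left')
    finally show ?thesis
      unfolding hill_series_def lists t path_weight_hill .
  qed
  have mem: "n \<in> parity_class n" "- n \<in> parity_class n" by auto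
  have sym: "P.G z (- n) (- n) = P.G z n n" if "cmod z < ?c" for z
    by (rule P.G_involution[OF that, where \<sigma> = uminus]) auto
  have a: "alpha (Hill C q) n z = P.G z n n" and bm: "beta_minus (Hill C q) n z = P.G z (- n) n"
    and bp: "beta_plus (Hill C q) n z = P.G z n (- n)" if "cmod z < ?c" for z
    using series[OF that] mem sym[OF that] by simp_all
  have ev: "eigenvalue (Hill C q) (bc_of n) (lambda0 (Hill C q) n + z) \<longleftrightarrow>
      (\<exists>x. (\<exists>j\<in>parity_class n. x j \<noteq> 0) \<and> P.solution z x)" (is "?L \<longleftrightarrow> ?R") for z
  proof -
    have dz: "of_int (n\<^sup>2) + z - of_int (j\<^sup>2) = of_int (n\<^sup>2 - j\<^sup>2) + z" for j by simp
    show ?thesis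
    proof
      assume ?L
      then have "is_eigenvalue (*) (hill_op C q (bc_of n)) (of_int (n\<^sup>2) + z)" by simp
      then obtain x where x0: "\<exists>j\<in>parity_class n. x j \<noteq> 0"
        and s: "(\<lambda>j. (1 + (of_int j)\<^sup>2) * (cmod (x j))\<^sup>2) summable_on parity_class n"
        and eq: "\<And>j. j \<in> parity_class n \<Longrightarrow>
          (of_int (n\<^sup>2) + z - of_int (j\<^sup>2)) * x j = (\<Sum>\<^sub>\<infinity>k\<in>parity_class n. ?V (j - k) * x k)"
        by (rule hill_eigenvalue_imp_solution[OF q]) (rule that)
      have "(\<lambda>j. (br (n - j) * br (n + j)) * (cmod (x j))\<^sup>2) summable_on parity_class n"
      proof (rule summable_on_comparison_test[OF summable_on_cmult_right[OF s, of "2 * (1 + of_int n)\<^sup>2"]])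
        fix j
        from mult_right_mono[OF hill_weight_compare(1)[OF n, of j], of "(cmod (x j))\<^sup>2"]
        show "(br (n - j) * br (n + j)) * (cmod (x j))\<^sup>2 \<le> 2 * (1 + of_int n)\<^sup>2 * ((1 + (of_int j)\<^sup>2) * (cmod (x j))\<^sup>2)"
          by (simp add: mult.assoc)
        show "0 \<le> (br (n - j) * br (n + j)) * (cmod (x j))\<^sup>2" by (simp add: br_pos less_imp_le)
      qed
      then have "P.solution z x" unfolding P.solution_def by (intro conjI ballI eq[unfolded dz])
      with x0 show ?R by blast
    next
      assume ?R
      then obtain x where x0: "\<exists>j\<in>parity_class n. x j \<noteq> 0" and sol: "P.solution z x" by blast
      from sol have s: "(\<lambda>j. (br (n - j) * br (n + j)) * (cmod (x j))\<^sup>2) summable_on parity_class n"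
        and eq: "\<And>j. j \<in> parity_class n \<Longrightarrow>
          (of_int (n\<^sup>2 - j\<^sup>2) + z) * x j = (\<Sum>\<^sub>\<infinity>k\<in>parity_class n. ?V (j - k) * x k)"
        unfolding P.solution_def by blast+
      have "(\<lambda>j. (1 + (of_int j)\<^sup>2) * (cmod (x j))\<^sup>2) summable_on parity_class n"
      proof (rule summable_on_comparison_test[OF summable_on_cmult_right[OF s, of "2 + (of_int n)\<^sup>2"]])
        fix j
        from mult_right_mono[OF hill_weight_compare(2)[OF n, of j], of "(cmod (x j))\<^sup>2"]
        show "(1 + (of_int j)\<^sup>2) * (cmod (x j))\<^sup>2 \<le> (2 + (of_int n)\<^sup>2) * ((br (n - j) * br (n + j)) * (cmod (x j))\<^sup>2)"
          by (simp add: mult.assoc)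
      qed simp
      then have "is_eigenvalue (*) (hill_op C q (bc_of n)) (of_int (n\<^sup>2) + z)"
        by (rule solution_imp_hill_eigenvalue[OF q x0]) (rule eq[folded dz])
      then show ?L by simp
    qed
  qed
  have hol: "(\<lambda>z. P.G z i j) holomorphic_on ball 0 ?c" if "i \<in> parity_class n" "j \<in> parity_class n" for i j
    by (rule P.G_holomorphic[OF that])
  have r: "disc_radius (Hill C q) n = ?c" by simp
  have h: "br (n - i) * br (n + i) \<le> 8 * ?c" if "i = n \<or> i = - n" for i
    using that n by (auto simp: br_def)
  show ?thesis
    unfolding reduction_def r
  proof (intro conjI allI impI)
    show "alpha (Hill C q) n holomorphic_on ball 0 ?c"
      by (rule holomorphic_transform[OF hol[OF mem(1) mem(1)]]) (simp add: a del: alpha.simps)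
    show "beta_minus (Hill C q) n holomorphic_on ball 0 ?c"
      by (rule holomorphic_transform[OF hol[OF mem(2) mem(1)]]) (simp add: bm del: beta_minus.simps)
    show "beta_plus (Hill C q) n holomorphic_on ball 0 ?c"
      by (rule holomorphic_transform[OF hol[OF mem(1) mem(2)]]) (simp add: bp del: beta_plus.simps)
    fix z assume z: "cmod z < ?c"
    show "cmod (alpha (Hill C q) n z) \<le> \<theta> * ?c" unfolding a[OF z]
      by (rule P.norm_G_le_scale[OF z mem(1) mem(1) h h \<epsilon>(3)]) auto
    show "cmod (beta_minus (Hill C q) n z) \<le> \<theta> * ?c" unfolding bm[OF z]
      by (rule P.norm_G_le_scale[OF z mem(2) mem(1) h h \<epsilon>(3)]) auto
    show "cmod (beta_plus (Hill C q) n z) \<le> \<theta> * ?c" unfolding bp[OF z]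
      by (rule P.norm_G_le_scale[OF z mem(1) mem(2) h h \<epsilon>(3)]) auto
    show "eigenvalue (Hill C q) (bc_of n) (lambda0 (Hill C q) n + z) \<longleftrightarrow>
           (z - alpha (Hill C q) n z)\<^sup>2 = beta_minus (Hill C q) n z * beta_plus (Hill C q) n z"
      unfolding ev P.nontrivial_solution_iff[OF z] a[OF z] bm[OF z] bp[OF z] sym[OF z]
      by (simp add: power2_eq_square mult.commute)
  qed
qed

section \<open>Alternating walks of the Dirac operator\<close>

primrec alternate :: "bool \<Rightarrow> int list \<Rightarrow> (bool \<times> int) list" where
  "alternate s [] = []"
| "alternate s (j # js) = (s, j) # alternate (\<not> s) js"

lemma alternate_props [simp]:
  "length (alternate s js) = length js" "map snd (alternate s js) = js"
  by (induction js arbitrary: s) auto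

lemma set_alternate: "set (alternate s js) \<subseteq> UNIV \<times> X \<longleftrightarrow> set js \<subseteq> X"
  by (induction js arbitrary: s) auto

text \<open>The kernel vanishes between equal components, so a walk of nonzero weight alternates and
  is determined by its integers and its starting component.\<close>

lemma path_weight_dirac_nonzero:
  "path_weight (dirac_kernel p q) t (s, i) ls y \<noteq> 0 \<Longrightarrow> ls = alternate (\<not> s) (map snd ls)"
proof (induction ls arbitrary: s i)
  case (Cons l ls)
  obtain s1 j where l: "l = (s1, j)" by (cases l)
  from Cons.prems have "dirac_kernel p q (s, i) (s1, j) \<noteq> 0" "path_weight (dirac_kernel p q) t (s1, j) ls y \<noteq> 0"
    by (auto simp: l)
  then have "s1 = (\<not> s)" "ls = alternate (\<not> s1) (map snd ls)"
    using Cons.IH[of s1 j] by (auto simp: dirac_kernel_def split: if_splits)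
  then show ?case by (simp add: l)
qed simp

text \<open>A list of length k gives k + 1 steps, each of which changes the component. Walks thus
  return to their initial component exactly for odd k, which accounts for the odd k in \<alpha> and
  the even k in \<beta>.\<close>

lemma path_weight_dirac:
  "path_weight (dirac_kernel p q) (\<lambda>x. 1 / (of_int (n - snd x) + z)) (s, i) (alternate (\<not> s) js) (s', j)
     = (if (s' = s) = odd (length js)
        then dirac_chain (if s then q else p) (if s then p else q) i js j
          / prod_list (map (\<lambda>j. of_int (n - j) + z) js)
        else 0)"
proof (induction js arbitrary: s i)
  case Nil
  then show ?case by (auto simp: dirac_kernel_def)
next
  case (Cons l js)
  have "path_weight (dirac_kernel p q) (\<lambda>x. 1 / (of_int (n - snd x) + z)) (s, i) (alternate (\<not> s) (l # js)) (s', j)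
      = (if s then q else p) (i + l) * (1 / (of_int (n - l) + z))
        * path_weight (dirac_kernel p q) (\<lambda>x. 1 / (of_int (n - snd x) + z)) (\<not> s, l) (alternate (\<not> \<not> s) js) (s', j)"
    by (simp add: dirac_kernel_def)
  then show ?case unfolding Cons.IH by (cases s; cases s') auto
qed

lemma infsum_component:
  fixes g :: "bool \<times> 'i \<Rightarrow> complex"
  assumes "\<And>s' j. s' \<noteq> s \<Longrightarrow> g (s', j) = 0"
  shows "infsum g (UNIV \<times> E) = (\<Sum>\<^sub>\<infinity>j\<in>E. g (s, j))"
proof -
  have "infsum g (UNIV \<times> E) = infsum g (Pair s ` E)"
  proof (rule infsum_cong_neutral)
    fix p assume p: "p \<in> UNIV \<times> E - Pair s ` E"
    obtain s' j where sj: "p = (s', j)" by (cases p)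
    then have "s' \<noteq> s" using p by auto
    then show "g p = 0" unfolding sj by (rule assms)
  qed auto
  also have "\<dots> = (\<Sum>\<^sub>\<infinity>j\<in>E. g (s, j))" by (subst infsum_reindex) (auto simp: inj_on_def o_def)
  finally show ?thesis .
qed

lemma summable_on_component:
  fixes g :: "bool \<times> 'i \<Rightarrow> real"
  shows "g summable_on (UNIV \<times> E) \<longleftrightarrow> (\<forall>s. (\<lambda>j. g (s, j)) summable_on E)"
proof -
  have r: "g summable_on Pair s ` E \<longleftrightarrow> (\<lambda>j. g (s, j)) summable_on E" for s
    by (subst summable_on_reindex) (auto simp: inj_on_def o_def)
  have u: "UNIV \<times> E = Pair False ` E \<union> Pair True ` E"
    by (auto simp: image_iff)
  show ?thesis
  proof
    assume g: "g summable_on (UNIV \<times> E)"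
    show "\<forall>s. (\<lambda>j. g (s, j)) summable_on E"
      unfolding r[symmetric] by (intro allI summable_on_subset_banach[OF g]) auto
  next
    assume "\<forall>s. (\<lambda>j. g (s, j)) summable_on E"
    then show "g summable_on (UNIV \<times> E)"
      unfolding u r[symmetric] by (intro summable_on_union) auto
  qed
qed

lemma dirac_reduction:
  assumes P: "L2 P" and Q: "L2 Q" and \<epsilon>: "0 \<le> \<epsilon>" "\<epsilon> \<le> 1/4" "\<epsilon> \<le> \<theta> / 16"
    and HS: "(\<lambda>(x, y). (cmod (dirac_kernel (\<lambda>m. fourier_coeff P (- m)) (fourier_coeff Q) x y))\<^sup>2 / (br (n - snd x) * br (n - snd y)))
      summable_on (UNIV \<times> parity_class n) \<times> (UNIV \<times> parity_class n)"
    and HS_le: "(\<Sum>\<^sub>\<infinity>(x, y)\<in>(UNIV \<times> parity_class n) \<times> (UNIV \<times> parity_class n).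
      (cmod (dirac_kernel (\<lambda>m. fourier_coeff P (- m)) (fourier_coeff Q) x y))\<^sup>2 / (br (n - snd x) * br (n - snd y))) \<le> \<epsilon>\<^sup>2"
  shows "reduction (Dirac P Q) \<theta> n"
proof -
  let ?p = "\<lambda>m. fourier_coeff P (- m)" and ?q = "fourier_coeff Q"
  let ?A = "dirac_kernel ?p ?q"
  let ?c = "1 / 2 :: real"
  let ?e = "(False, n)" and ?f = "(True, n)"
  let ?I = "UNIV \<times> parity_class n :: (bool \<times> int) set"
  interpret P: perturbed_diagonal ?I ?e ?f ?A "\<lambda>x. of_int (n - snd x)" "\<lambda>x. br (n - snd x)" ?c \<epsilon>
  proof
    show "0 < br (n - snd i)" for i by (rule br_pos)
    show "br (n - snd i) / 2 \<le> cmod (of_int (n - snd i) + z)"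
      if i: "i \<in> ?I - {?e, ?f}" and z: "cmod z < ?c" for i z
    proof -
      obtain s j where ij: "i = (s, j)" by (cases i)
      have "j \<noteq> n" using i by (cases s) (auto simp: ij)
      then have b: "br (n - j) = \<bar>of_int (n - j)\<bar>" unfolding br_def by (auto simp: max_def)
      have "cmod (of_int (n - j)) - cmod z \<le> cmod (of_int (n - j) + z)" by (rule norm_diff_ineq)
      moreover have "cmod (of_int (n - j)) = br (n - j)" unfolding b by (simp only: norm_of_int)
      ultimately show ?thesis using z br_ge_1[of "n - j"] by (simp only: ij snd_conv)
    qed
  qed (use HS HS_le \<epsilon> in auto)
  have mem: "?e \<in> ?I" "?f \<in> ?I" by auto
  have t: "P.t z = (\<lambda>x. 1 / (of_int (n - snd x) + z))" for z
    by (rule ext) (rule P.t_def)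
  have W: "walk P.J ?A (P.t z) k (s, n) (s', n)
      = (if (s' = s) = odd k then dirac_sum (if s then ?q else ?p) (if s then ?p else ?q) n z k else 0)"
    if z: "cmod z < ?c" for z k s s'
  proof -
    let ?X = "{j. even (j - n) \<and> j \<noteq> n}"
    let ?L = "{js. length js = k \<and> set js \<subseteq> ?X}"
    have J: "P.J = UNIV \<times> ?X" by auto
    have inj: "inj_on (alternate (\<not> s)) ?L" by (rule inj_on_inverseI[where g = "map snd"]) simp
    have m: "(s, n) \<in> ?I" "(s', n) \<in> ?I" by auto
    have "walk P.J ?A (P.t z) k (s, n) (s', n) = (\<Sum>\<^sub>\<infinity>ls\<in>lists_of_length P.J k. path_weight ?A (P.t z) (s, n) ls (s', n))"
      by (rule dominated_walk.walk_eq_infsum_lists[OF P.dominated[OF z] m])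
    also have "\<dots> = (\<Sum>\<^sub>\<infinity>ls\<in>alternate (\<not> s) ` ?L. path_weight ?A (P.t z) (s, n) ls (s', n))"
    proof (rule infsum_cong_neutral)
      fix ls assume ls: "ls \<in> lists_of_length P.J k - alternate (\<not> s) ` ?L"
      show "path_weight ?A (P.t z) (s, n) ls (s', n) = 0"
      proof (rule ccontr)
        assume "path_weight ?A (P.t z) (s, n) ls (s', n) \<noteq> 0"
        then have alt: "ls = alternate (\<not> s) (map snd ls)" by (rule path_weight_dirac_nonzero)
        have len: "length ls = k" and "set ls \<subseteq> UNIV \<times> ?X" using ls unfolding J by blast+
        then have "set (map snd ls) \<subseteq> ?X" by auto
        with len have "map snd ls \<in> ?L" by simp
        then have "alternate (\<not> s) (map snd ls) \<in> alternate (\<not> s) ` ?L" by (rule imageI)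
        then have "ls \<in> alternate (\<not> s) ` ?L" by (simp only: alt[symmetric])
        with ls show False by simp
      qed
    next
      fix ls assume "ls \<in> alternate (\<not> s) ` ?L - lists_of_length P.J k"
      then obtain js where js: "ls = alternate (\<not> s) js" "js \<in> ?L" "ls \<notin> lists_of_length P.J k" by blast
      have "set ls \<subseteq> P.J" unfolding J js(1) set_alternate using js(2) by simp
      with js have False by simp
      then show "path_weight ?A (P.t z) (s, n) ls (s', n) = 0" ..
    qed simp
    also have "\<dots> = (\<Sum>\<^sub>\<infinity>js\<in>?L. path_weight ?A (P.t z) (s, n) (alternate (\<not> s) js) (s', n))"
      by (subst infsum_reindex[OF inj]) (simp add: o_def)
    also have "\<dots> = (if (s' = s) = odd k then dirac_sum (if s then ?q else ?p) (if s then ?p else ?q) n z k else 0)"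
    proof (cases "(s' = s) = odd k")
      case True
      have "(\<Sum>\<^sub>\<infinity>js\<in>?L. path_weight ?A (P.t z) (s, n) (alternate (\<not> s) js) (s', n))
          = dirac_sum (if s then ?q else ?p) (if s then ?p else ?q) n z k"
        unfolding dirac_sum_def t path_weight_dirac by (rule infsum_cong) (use True in simp)
      then show ?thesis by (simp only: if_P[OF True])
    next
      case False
      have "(\<Sum>\<^sub>\<infinity>js\<in>?L. path_weight ?A (P.t z) (s, n) (alternate (\<not> s) js) (s', n)) = 0"
        unfolding t path_weight_dirac by (rule infsum_0) (use False in auto)
      then show ?thesis using False by simp
    qed
    finally show ?thesis .
  qed
  have a: "alpha (Dirac P Q) n z = P.G z ?e ?e" if z: "cmod z < ?c" for z
  proof -
    have "(\<lambda>k. walk P.J ?A (P.t z) k ?e ?e) sums P.G z ?e ?e" by (rule P.G_sums[OF z mem(1) mem(1)])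
    then have "(\<lambda>k. if odd k then dirac_sum ?p ?q n z k else 0) sums P.G z ?e ?e" unfolding W[OF z] by (simp only: if_True if_False simp_thms cong: if_cong)
    then have "(\<lambda>i. if odd (2 * i + 1) then dirac_sum ?p ?q n z (2 * i + 1) else 0) sums P.G z ?e ?e"
      by (rule sums_mono_reindex[THEN iffD2, rotated 2]) (auto simp: strict_mono_def elim: oddE)
    then show ?thesis by (simp add: sums_iff)
  qed
  \<comment> \<open>The term with k = 0 is the Fourier coefficient in front of the series of
    \<beta>, which therefore starts at length 2.\<close>
  have even_part: "f 0 + (\<Sum>i. f (2 * i + 2)) = S"
    if "(\<lambda>k. if even k then f k else 0) sums S" for f and S :: complex
  proof -
    have "(\<lambda>i. if even (2 * i) then f (2 * i) else 0) sums S"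
      using that by (rule sums_mono_reindex[where g = "\<lambda>i. 2 * i", THEN iffD2, rotated 2])
        (auto simp: strict_mono_def elim: evenE)
    then have "(\<lambda>i. f (2 * i)) sums ((S - f 0) + f (2 * 0))" by simp
    then have "(\<lambda>i. f (2 * Suc i)) sums (S - f 0)" by (rule sums_Suc_iff[THEN iffD2])
    then have "(\<Sum>i. f (2 * i + 2)) = S - f 0" by (simp add: sums_iff)
    then show ?thesis by simp
  qed
  have bm: "beta_minus (Dirac P Q) n z = P.G z ?e ?f" if z: "cmod z < ?c" for z
  proof -
    have "(\<lambda>k. walk P.J ?A (P.t z) k ?e ?f) sums P.G z ?e ?f" by (rule P.G_sums[OF z mem])
    then have "(\<lambda>k. if even k then dirac_sum ?p ?q n z k else 0) sums P.G z ?e ?f" unfolding W[OF z] by (simp only: if_True if_False simp_thms cong: if_cong)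
    from even_part[OF this] W[OF z, of 0 False True] show ?thesis by (simp add: dirac_kernel_def)
  qed
  have bp: "beta_plus (Dirac P Q) n z = P.G z ?f ?e" if z: "cmod z < ?c" for z
  proof -
    have "(\<lambda>k. walk P.J ?A (P.t z) k ?f ?e) sums P.G z ?f ?e" by (rule P.G_sums[OF z mem(2) mem(1)])
    then have "(\<lambda>k. if even k then dirac_sum ?q ?p n z k else 0) sums P.G z ?f ?e" unfolding W[OF z] by (simp only: if_True if_False simp_thms cong: if_cong)
    from even_part[OF this] W[OF z, of 0 True False] show ?thesis by (simp add: dirac_kernel_def)
  qed
  have sym: "P.G z ?f ?f = P.G z ?e ?e" if "cmod z < ?c" for z
    by (rule P.G_involution[OF that, where \<sigma> = "\<lambda>(s, j). (\<not> s, j)"])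
      (auto simp: dirac_kernel_def add.commute)
  have compF: "(\<Sum>\<^sub>\<infinity>y\<in>?I. ?A (False, j) y * x y) = (\<Sum>\<^sub>\<infinity>k\<in>parity_class n. fourier_coeff P (- j - k) * x (True, k))" for j x
    by (subst infsum_component[where s = True]) (auto simp: dirac_kernel_def)
  have compT: "(\<Sum>\<^sub>\<infinity>y\<in>?I. ?A (True, j) y * x y) = (\<Sum>\<^sub>\<infinity>k\<in>parity_class n. fourier_coeff Q (j + k) * x (False, k))" for j x
    by (subst infsum_component[where s = False]) (auto simp: dirac_kernel_def)
  have ev: "eigenvalue (Dirac P Q) (bc_of n) (lambda0 (Dirac P Q) n + z) \<longleftrightarrow>
      (\<exists>x. (\<exists>y\<in>?I. x y \<noteq> 0) \<and> P.solution z x)" (is "?L \<longleftrightarrow> ?R") for z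
  proof -
    have dz: "of_int n + z - of_int j = of_int (n - j) + z" for j by simp
    show ?thesis
    proof
      assume ?L
      then have "is_eigenvalue scale2 (dirac_op P Q (bc_of n)) (of_int n + z)" by simp
      then obtain a b where ab0: "\<exists>j\<in>parity_class n. a j \<noteq> 0 \<or> b j \<noteq> 0"
        and sa: "(\<lambda>j. (1 + (of_int j)\<^sup>2) * (cmod (a j))\<^sup>2) summable_on parity_class n"
        and sb: "(\<lambda>j. (1 + (of_int j)\<^sup>2) * (cmod (b j))\<^sup>2) summable_on parity_class n"
        and eqa: "\<And>j. j \<in> parity_class n \<Longrightarrow>
          (of_int n + z - of_int j) * a j = (\<Sum>\<^sub>\<infinity>k\<in>parity_class n. fourier_coeff P (- j - k) * b k)"
        and eqb: "\<And>j. j \<in> parity_class n \<Longrightarrow>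
          (of_int n + z - of_int j) * b j = (\<Sum>\<^sub>\<infinity>k\<in>parity_class n. fourier_coeff Q (j + k) * a k)"
        by (rule dirac_eigenvalue_imp_solution[OF P Q]) (rule that)
      define x where "x y = (if fst y then b (snd y) else a (snd y))" for y
      \<comment> \<open>A crude bound with a constant depending on n is enough, as only summability
        with the weight \<open>br (n - j)\<close> is at stake.\<close>
      have cmp: "br (n - j) \<le> (2 + \<bar>of_int n\<bar>) * (1 + (of_int j)\<^sup>2)" for j
      proof -
        have "\<bar>real_of_int j\<bar> \<le> 1 + (of_int j)\<^sup>2"
          using sum_squares_bound[of 1 "\<bar>real_of_int j\<bar>"] by simp
        moreover have "br (n - j) \<le> 1 + \<bar>of_int n\<bar> + \<bar>of_int j\<bar>" unfolding br_def by auto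
        moreover have "(2 + \<bar>of_int n\<bar>) * (1 + (of_int j)\<^sup>2)
            = 2 + \<bar>of_int n\<bar> + 2 * (real_of_int j)\<^sup>2 + \<bar>of_int n\<bar> * (real_of_int j)\<^sup>2"
          by (simp add: algebra_simps)
        moreover have "0 \<le> \<bar>of_int n\<bar> * (real_of_int j)\<^sup>2" "0 \<le> (real_of_int j)\<^sup>2" by simp_all
        ultimately show ?thesis by linarith
      qed
      have w: "(\<lambda>j. br (n - j) * (cmod (a j))\<^sup>2) summable_on parity_class n"
        if s: "(\<lambda>j. (1 + (of_int j)\<^sup>2) * (cmod (a j))\<^sup>2) summable_on parity_class n" for a :: "int \<Rightarrow> complex"
      proof (rule summable_on_comparison_test[OF summable_on_cmult_right[OF s, of "2 + \<bar>of_int n\<bar>"]])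
        fix j
        from mult_right_mono[OF cmp[of j], of "(cmod (a j))\<^sup>2"]
        show "br (n - j) * (cmod (a j))\<^sup>2 \<le> (2 + \<bar>of_int n\<bar>) * ((1 + (of_int j)\<^sup>2) * (cmod (a j))\<^sup>2)"
          by (simp add: mult.assoc)
        show "0 \<le> br (n - j) * (cmod (a j))\<^sup>2" by (simp add: br_pos less_imp_le)
      qed
      have "(\<lambda>y. br (n - snd y) * (cmod (x y))\<^sup>2) summable_on ?I"
        unfolding summable_on_component
      proof
        fix s show "(\<lambda>j. br (n - snd (s, j)) * (cmod (x (s, j)))\<^sup>2) summable_on parity_class n"
          using w[OF sa] w[OF sb] by (cases s) (simp_all add: x_def)
      qed
      moreover have "(of_int (n - snd y) + z) * x y = (\<Sum>\<^sub>\<infinity>k\<in>?I. ?A y k * x k)" if yI: "y \<in> ?I" for y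
      proof -
        obtain s j where y: "y = (s, j)" "j \<in> parity_class n" using yI by (rule SigmaE) (rule that)
        have "(of_int (n - j) + z) * x (False, j) = (\<Sum>\<^sub>\<infinity>k\<in>?I. ?A (False, j) k * x k)"
          unfolding compF using eqa[OF y(2)] unfolding dz x_def fst_conv snd_conv by simp
        moreover have "(of_int (n - j) + z) * x (True, j) = (\<Sum>\<^sub>\<infinity>k\<in>?I. ?A (True, j) k * x k)"
          unfolding compT using eqb[OF y(2)] unfolding dz x_def fst_conv snd_conv by simp
        ultimately show ?thesis unfolding y(1) snd_conv by (cases s) (simp_all only:)
      qed
      ultimately have "P.solution z x" unfolding P.solution_def by blast
      moreover have "\<exists>y\<in>?I. x y \<noteq> 0"
      proof -
        obtain j where j: "j \<in> parity_class n" "x (False, j) \<noteq> 0 \<or> x (True, j) \<noteq> 0"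
          using ab0 by (auto simp: x_def)
        then have "(False, j) \<in> ?I" "(True, j) \<in> ?I" by auto
        with j(2) show ?thesis by blast
      qed
      ultimately show ?R by blast
    next
      assume ?R
      then obtain x where x0: "\<exists>y\<in>?I. x y \<noteq> 0" and sol: "P.solution z x" by blast
      from sol have s: "(\<lambda>y. br (n - snd y) * (cmod (x y))\<^sup>2) summable_on ?I"
        and eq: "\<And>y. y \<in> ?I \<Longrightarrow> (of_int (n - snd y) + z) * x y = (\<Sum>\<^sub>\<infinity>k\<in>?I. ?A y k * x k)"
        unfolding P.solution_def by blast+
      have s': "(\<lambda>j. (cmod (x (s, j)))\<^sup>2) summable_on parity_class n" for s
      proof (rule summable_on_comparison_test)
        show "(\<lambda>j. br (n - j) * (cmod (x (s, j)))\<^sup>2) summable_on parity_class n"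
          using s[unfolded summable_on_component] by simp
        show "(cmod (x (s, j)))\<^sup>2 \<le> br (n - j) * (cmod (x (s, j)))\<^sup>2" for j
          using mult_right_mono[OF br_ge_1[of "n - j"], of "(cmod (x (s, j)))\<^sup>2"] by simp
      qed simp
      have x0': "\<exists>j\<in>parity_class n. x (False, j) \<noteq> 0 \<or> x (True, j) \<noteq> 0"
      proof -
        from x0 obtain s j where "j \<in> parity_class n" "x (s, j) \<noteq> 0" by auto
        then show ?thesis by (cases s) auto
      qed
      have ea: "(of_int n + z - of_int j) * x (False, j) = (\<Sum>\<^sub>\<infinity>k\<in>parity_class n. fourier_coeff P (- j - k) * x (True, k))"
        and eb: "(of_int n + z - of_int j) * x (True, j) = (\<Sum>\<^sub>\<infinity>k\<in>parity_class n. fourier_coeff Q (j + k) * x (False, k))"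
        if "j \<in> parity_class n" for j
        using eq[of "(False, j)"] eq[of "(True, j)"] that unfolding compF compT dz by simp_all
      have "is_eigenvalue scale2 (dirac_op P Q (bc_of n)) (of_int n + z)"
        by (rule solution_imp_dirac_eigenvalue[OF P Q x0' s' s' ea eb])
      then show ?L by simp
    qed
  qed
  have hol: "(\<lambda>z. P.G z i j) holomorphic_on ball 0 ?c" if "i \<in> ?I" "j \<in> ?I" for i j
    by (rule P.G_holomorphic[OF that])
  have r: "disc_radius (Dirac P Q) n = ?c" by simp
  have h: "br (n - snd (s, n)) \<le> 8 * ?c" for s :: bool by (simp add: br_def)
  show ?thesis
    unfolding reduction_def r
  proof (intro conjI allI impI)
    show "alpha (Dirac P Q) n holomorphic_on ball 0 ?c"
      by (rule holomorphic_transform[OF hol[OF mem(1) mem(1)]]) (simp add: a del: alpha.simps)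
    show "beta_minus (Dirac P Q) n holomorphic_on ball 0 ?c"
      by (rule holomorphic_transform[OF hol[OF mem]]) (simp add: bm del: beta_minus.simps)
    show "beta_plus (Dirac P Q) n holomorphic_on ball 0 ?c"
      by (rule holomorphic_transform[OF hol[OF mem(2) mem(1)]]) (simp add: bp del: beta_plus.simps)
    fix z assume z: "cmod z < ?c"
    show "cmod (alpha (Dirac P Q) n z) \<le> \<theta> * ?c" unfolding a[OF z]
      by (rule P.norm_G_le_scale[OF z mem(1) mem(1) h h \<epsilon>(3)])
    show "cmod (beta_minus (Dirac P Q) n z) \<le> \<theta> * ?c" unfolding bm[OF z]
      by (rule P.norm_G_le_scale[OF z mem h h \<epsilon>(3)])
    show "cmod (beta_plus (Dirac P Q) n z) \<le> \<theta> * ?c" unfolding bp[OF z]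
      by (rule P.norm_G_le_scale[OF z mem(2) mem(1) h h \<epsilon>(3)])
    show "eigenvalue (Dirac P Q) (bc_of n) (lambda0 (Dirac P Q) n + z) \<longleftrightarrow>
           (z - alpha (Dirac P Q) n z)\<^sup>2 = beta_minus (Dirac P Q) n z * beta_plus (Dirac P Q) n z"
      unfolding ev P.nontrivial_solution_iff[OF z] a[OF z] bm[OF z] bp[OF z] sym[OF z]
      by (simp add: power2_eq_square)
  qed
qed

theorem eventually_reduction:
  assumes v: "valid_potential v" and \<theta>: "\<theta> > 0"
  shows "\<exists>N0. \<forall>n\<in>indices v. N0 \<le> \<bar>n\<bar> \<longrightarrow> reduction v \<theta> n"
proof -
  \<comment> \<open>The first entry ensures the geometric decay of the Neumann series, the second
    one is the condition of \<open>norm_G_le_scale\<close>.\<close>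
  define \<epsilon> where "\<epsilon> = min (1/4) (\<theta> / 16)"
  have \<epsilon>: "0 \<le> \<epsilon>" "\<epsilon> \<le> 1/4" "\<epsilon> \<le> \<theta> / 16" "\<epsilon>\<^sup>2 > 0" using \<theta> by (auto simp: \<epsilon>_def min_def)
  show ?thesis
  proof (cases v)
    case (Hill C q)
    then have q: "L2 q" using v by simp
    from hill_HS[OF q \<epsilon>(4), of C] obtain N0 where N0: "\<forall>n. N0 \<le> n \<and> 1 \<le> n \<longrightarrow>
      (\<lambda>(i, j). (cmod (hill_coeff C q (i - j)))\<^sup>2 / ((br (n - i) * br (n + i)) * (br (n - j) * br (n + j))))
        summable_on parity_class n \<times> parity_class n \<and>
      (\<Sum>\<^sub>\<infinity>(i, j)\<in>parity_class n \<times> parity_class n.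
        (cmod (hill_coeff C q (i - j)))\<^sup>2 / ((br (n - i) * br (n + i)) * (br (n - j) * br (n + j)))) \<le> \<epsilon>\<^sup>2" ..
    show ?thesis
    proof (intro exI[of _ N0] ballI impI)
      fix n assume "n \<in> indices v" "N0 \<le> \<bar>n\<bar>"
      then have n: "1 \<le> n" "N0 \<le> n \<and> 1 \<le> n" by (auto simp: Hill)
      from N0[rule_format, OF n(2)] show "reduction v \<theta> n"
        unfolding Hill by (intro hill_reduction[OF q n(1) \<epsilon>(1-3)]) (elim conjE, assumption)+
    qed
  next
    case (Dirac P Q)
    then have L: "L2 P" "L2 Q" using v by simp_all
    from dirac_HS[OF L \<epsilon>(4)] obtain N0 where N0: "\<forall>n. N0 \<le> \<bar>n\<bar> \<longrightarrow>
      (\<lambda>(x, y). (cmod (dirac_kernel (\<lambda>m. fourier_coeff P (- m)) (fourier_coeff Q) x y))\<^sup>2 / (br (n - snd x) * br (n - snd y)))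
        summable_on (UNIV \<times> parity_class n) \<times> (UNIV \<times> parity_class n) \<and>
      (\<Sum>\<^sub>\<infinity>(x, y)\<in>(UNIV \<times> parity_class n) \<times> (UNIV \<times> parity_class n).
        (cmod (dirac_kernel (\<lambda>m. fourier_coeff P (- m)) (fourier_coeff Q) x y))\<^sup>2 / (br (n - snd x) * br (n - snd y))) \<le> \<epsilon>\<^sup>2" ..
    show ?thesis
    proof (intro exI[of _ N0] ballI impI)
      fix n assume n: "n \<in> indices v" "N0 \<le> \<bar>n\<bar>"
      from N0[rule_format, OF n(2)] show "reduction v \<theta> n"
        unfolding Dirac by (intro dirac_reduction[OF L \<epsilon>(1-3)]) (elim conjE, assumption)+
    qed
  qed
qed

subsection \<open>The two roots\<close>

text \<open>Cauchy's estimate on circles of radius R / 2 around points of the half disc bounds the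
  derivative by 2 * B / R.\<close>

lemma holomorphic_bounded_Lipschitz:
  assumes f: "f holomorphic_on ball a R" and B: "\<And>z. z \<in> ball a R \<Longrightarrow> cmod (f z) \<le> B" and R: "0 < R"
    and zw: "z \<in> ball a (R / 2)" "w \<in> ball a (R / 2)"
  shows "cmod (f z - f w) \<le> (2 * B / R) * cmod (z - w)"
proof (rule field_differentiable_bound[where S = "ball a (R / 2)" and f' = "deriv f"])
  fix x assume x: "x \<in> ball a (R / 2)"
  have sub: "cball x (R / 2) \<subseteq> ball a R"
  proof
    fix y assume "y \<in> cball x (R / 2)"
    then show "y \<in> ball a R" using x dist_triangle[of a y x] by (simp add: dist_commute)
  qed
  have "x \<in> ball a R" using x R by simp
  then show "(f has_field_derivative deriv f x) (at x within ball a (R / 2))"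
    using f holomorphic_derivI[OF f open_ball] by (blast intro: has_field_derivative_at_within)
  have "cmod ((deriv ^^ 1) f x) \<le> fact 1 * B / (R / 2) ^ 1"
  proof (rule Cauchy_inequality)
    show "f holomorphic_on ball x (R / 2)"
      by (rule holomorphic_on_subset[OF f order_trans[OF ball_subset_cball sub]])
    show "continuous_on (cball x (R / 2)) f"
      by (rule continuous_on_subset[OF holomorphic_on_imp_continuous_on[OF f] sub])
    show "cmod (f y) \<le> B" if "cmod (x - y) = R / 2" for y
      by (rule B, rule subsetD[OF sub]) (use that in \<open>simp add: dist_norm\<close>)
  qed (use R in simp)
  then show "cmod (deriv f x) \<le> 2 * B / R" by (simp add: field_simps)
qed (use zw in auto)

text \<open>Division by \<open>\<beta> z0\<close> moves nearby values close to 1, away from the cut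
  of the principal root, whatever the argument of \<open>\<beta> z0\<close> is; the constant factor
  restores the square.\<close>

definition sqrt_branch :: "(complex \<Rightarrow> complex) \<Rightarrow> complex \<Rightarrow> complex \<Rightarrow> complex" where
  "sqrt_branch \<beta> z0 z = csqrt (\<beta> z / \<beta> z0) * csqrt (\<beta> z0)"

lemma sqrt_branch_square: "\<beta> z0 \<noteq> 0 \<Longrightarrow> (sqrt_branch \<beta> z0 z)\<^sup>2 = \<beta> z"
  by (simp add: sqrt_branch_def power_mult_distrib)

text \<open>The principal root has nonnegative real part, so in u - 1 = (csqrt u - 1) (csqrt u + 1)
  the second factor has modulus at least 1.\<close>

lemma norm_csqrt_minus_1_le: "cmod (csqrt u - 1) \<le> cmod (u - 1)"
proof -
  have "u - 1 = (csqrt u - 1) * (csqrt u + 1)"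
    using power2_csqrt[of u] by (simp add: algebra_simps power2_eq_square)
  then have "cmod (u - 1) = cmod (csqrt u - 1) * cmod (csqrt u + 1)" by (simp add: norm_mult)
  moreover have "1 \<le> cmod (csqrt u + 1)"
  proof -
    have "0 \<le> Re (csqrt u)" using Re_csqrt[of u] by auto
    then have "1 \<le> Re (csqrt u + 1)" by simp
    then show ?thesis using complex_Re_le_cmod[of "csqrt u + 1"] by linarith
  qed
  ultimately show ?thesis using mult_left_mono[of 1 "cmod (csqrt u + 1)" "cmod (csqrt u - 1)"] by simp
qed

lemma small_factor_zero:
  fixes x :: real assumes "x \<le> k * x" "k < 1" "0 \<le> x" shows "x = 0"
proof -
  have "(1 - k) * x \<le> 0" using assms(1) by (simp add: algebra_simps)
  then have "x \<le> 0" using assms(2) by (simp add: mult_le_0_iff)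
  then show ?thesis using assms(3) by simp
qed

lemma sqrt_mult_le_mean:
  fixes a b :: real assumes "0 \<le> a" "0 \<le> b" "x\<^sup>2 = a * b" shows "x \<le> (a + b) / 2"
proof (rule power2_le_imp_le)
  have "0 \<le> (a - b)\<^sup>2" by simp
  then show "x\<^sup>2 \<le> ((a + b) / 2)\<^sup>2" unfolding assms(3) by (simp add: power2_eq_square field_simps)
qed (use assms in simp)

text \<open>The situation for a single n, with \<kappa> in the role of a constant times \<eta>_n.
  The threshold 1/100 leaves ample room in the numerical estimates below; the assumption
  \<open>roots\<close> combines the characteristic equation with the location of the two
  eigenvalues.\<close>

locale root_pair =
  fixes \<alpha> \<beta>m \<beta>p :: "complex \<Rightarrow> complex" and c \<theta> \<kappa> :: real and zp zm zs :: complex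
  assumes c: "0 < c" and \<theta>: "0 \<le> \<theta>" "\<theta> \<le> 1/100" and \<kappa>: "0 \<le> \<kappa>" "\<kappa> \<le> 1/100"
    and hol: "\<alpha> holomorphic_on ball 0 c" "\<beta>m holomorphic_on ball 0 c" "\<beta>p holomorphic_on ball 0 c"
    and bound: "\<And>z. cmod z < c \<Longrightarrow> cmod (\<alpha> z) \<le> \<theta> * c" "\<And>z. cmod z < c \<Longrightarrow> cmod (\<beta>m z) \<le> \<theta> * c"
      "\<And>z. cmod z < c \<Longrightarrow> cmod (\<beta>p z) \<le> \<theta> * c"
    and roots: "\<And>z. cmod z < c \<and> (z - \<alpha> z)\<^sup>2 = \<beta>m z * \<beta>p z \<longleftrightarrow> z = zm \<or> z = zp"
    and zs: "zs = (zp + zm) / 2"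
    and nz: "\<beta>m zs \<noteq> 0" "\<beta>p zs \<noteq> 0"
    and \<kappa>_bound: "\<And>z. cmod (z - zs) \<le> 2 * (cmod (\<beta>m zs) + cmod (\<beta>p zs)) \<Longrightarrow>
        cmod (\<beta>m z - \<beta>m zs) \<le> \<kappa> * cmod (\<beta>m zs) \<and> cmod (\<beta>p z - \<beta>p zs) \<le> \<kappa> * cmod (\<beta>p zs)"
begin

definition S :: real where "S = cmod (\<beta>m zs) + cmod (\<beta>p zs)"
definition D :: "complex set" where "D = {z. cmod (z - zs) \<le> 2 * S}"
definition s :: "complex \<Rightarrow> complex" where "s z = sqrt_branch \<beta>m zs z * sqrt_branch \<beta>p zs z"
text \<open>Positivity of the real parts is an open condition that keeps both ratios off the cut, so
  \<open>U\<close> is a neighborhood of \<open>D\<close> on which the branches are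
  holomorphic.\<close>

definition U :: "complex set" where
  "U = {z \<in> ball 0 c. 0 < Re (\<beta>m z / \<beta>m zs) \<and> 0 < Re (\<beta>p z / \<beta>p zs)}"

lemma S_pos: "0 < S" using nz by (simp add: S_def add_pos_pos)

lemma root_small:
  assumes "z = zm \<or> z = zp" shows "cmod z \<le> 2 * \<theta> * c" "cmod z < c" "(z - \<alpha> z)\<^sup>2 = \<beta>m z * \<beta>p z"
proof -
  show z: "cmod z < c" "(z - \<alpha> z)\<^sup>2 = \<beta>m z * \<beta>p z" using roots[of z] assms by auto
  then have "(cmod (z - \<alpha> z))\<^sup>2 = cmod (\<beta>m z) * cmod (\<beta>p z)" by (simp flip: norm_mult norm_power)
  then have "cmod (z - \<alpha> z) \<le> (cmod (\<beta>m z) + cmod (\<beta>p z)) / 2" by (intro sqrt_mult_le_mean) auto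
  also have "\<dots> \<le> \<theta> * c" using bound[OF z(1)] by simp
  finally show "cmod z \<le> 2 * \<theta> * c"
    using bound(1)[OF z(1)] norm_triangle_ineq[of "z - \<alpha> z" "\<alpha> z"] by simp
qed

lemma zs_small: "cmod zs \<le> 2 * \<theta> * c"
proof -
  have "cmod zs = cmod (zp + zm) / 2" by (simp add: zs norm_divide)
  also have "\<dots> \<le> (cmod zp + cmod zm) / 2" by (intro divide_right_mono norm_triangle_ineq) simp
  finally show ?thesis using root_small(1)[of zp] root_small(1)[of zm] by simp
qed

lemma \<theta>c: "\<theta> * c \<le> c / 100" using mult_right_mono[OF \<theta>(2), of c] c by simp

lemma S_le: "S \<le> 2 * \<theta> * c"
proof -
  have "cmod zs < c" using zs_small \<theta>c c by linarith
  then show ?thesis using bound(2,3)[of zs] by (simp add: S_def)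
qed

lemma D_in_ball: "z \<in> D \<Longrightarrow> z \<in> ball 0 (c / 2)"
proof -
  assume "z \<in> D"
  then have "cmod z \<le> cmod zs + 2 * S" using norm_triangle_sub[of z zs] by (simp add: D_def)
  also have "\<dots> < c / 2" using zs_small S_le \<theta>c c by linarith
  finally show ?thesis by simp
qed

lemma lip:
  assumes "f = \<alpha> \<or> f = \<beta>m \<or> f = \<beta>p" "z \<in> ball 0 (c / 2)" "w \<in> ball 0 (c / 2)"
  shows "cmod (f z - f w) \<le> 2 * \<theta> * cmod (z - w)"
proof -
  have "cmod (f z - f w) \<le> (2 * (\<theta> * c) / c) * cmod (z - w)"
    by (rule holomorphic_bounded_Lipschitz[OF _ _ c assms(2,3)]) (use assms(1) hol bound in auto)
  then show ?thesis using c by simp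
qed

lemma root_half: assumes "z = zm \<or> z = zp" shows "z \<in> ball 0 (c / 2)"
proof -
  have "cmod z < c / 2" using root_small(1)[OF assms] \<theta>c c by linarith
  then show ?thesis by simp
qed

lemma root_dist: assumes "z = zm \<or> z = zp" shows "cmod (z - zs) = cmod (zp - zm) / 2"
proof -
  have "zp - zs = (zp - zm) / 2" "zm - zs = - ((zp - zm) / 2)" by (simp_all add: zs field_simps)
  then have "cmod (zp - zs) = cmod (zp - zm) / 2" "cmod (zm - zs) = cmod (zp - zm) / 2"
    by (simp_all only: norm_minus_cancel norm_divide norm_numeral)
  then show ?thesis using assms by blast
qed

text \<open>At a root, |z - \<alpha> z| is the geometric mean of |\<beta>m z| and |\<beta>p z|,
  hence at most their arithmetic mean, which differs little from S / 2. The resulting inequality g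
  \<le> S + 4 \<theta> g gives 21/20 with room to spare, and it places the roots well inside the
  disc of radius 2 S.\<close>

lemma gap: "cmod (zp - zm) \<le> (21 / 20) * S"
proof -
  define g where "g = cmod (zp - zm)"
  have dist: "cmod (z - zs) = g / 2" if "z = zm \<or> z = zp" for z
    unfolding g_def by (rule root_dist[OF that])
  have zsb: "zs \<in> ball 0 (c / 2)" by (rule D_in_ball) (simp add: D_def S_pos less_imp_le)
  have r: "cmod (z - \<alpha> z) \<le> S / 2 + \<theta> * g" if z: "z = zm \<or> z = zp" for z
  proof -
    have b: "cmod (f z) \<le> cmod (f zs) + \<theta> * g" if "f = \<beta>m \<or> f = \<beta>p" for f
    proof -
      have "cmod (f z - f zs) \<le> 2 * \<theta> * (g / 2)"
        using lip[of f z zs] that root_half[OF z] zsb dist[OF z] by auto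
      then show ?thesis using norm_triangle_sub[of "f z" "f zs"] by simp
    qed
    have "(cmod (z - \<alpha> z))\<^sup>2 = cmod (\<beta>m z) * cmod (\<beta>p z)"
      using root_small(3)[OF z] by (simp flip: norm_mult norm_power)
    then have "cmod (z - \<alpha> z) \<le> (cmod (\<beta>m z) + cmod (\<beta>p z)) / 2" by (intro sqrt_mult_le_mean) auto
    also have "\<dots> \<le> ((cmod (\<beta>m zs) + \<theta> * g) + (cmod (\<beta>p zs) + \<theta> * g)) / 2"
      using b[of \<beta>m] b[of \<beta>p] by (intro divide_right_mono add_mono) simp_all
    also have "\<dots> = S / 2 + \<theta> * g" unfolding S_def by (simp add: add_divide_distrib)
    finally show ?thesis .
  qed
  have "zp - zm = (zp - \<alpha> zp) - (zm - \<alpha> zm) + (\<alpha> zp - \<alpha> zm)" by simp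
  then have "g \<le> cmod (zp - \<alpha> zp) + cmod (zm - \<alpha> zm) + cmod (\<alpha> zp - \<alpha> zm)"
    unfolding g_def by (metis add_mono norm_triangle_ineq4 norm_triangle_le order_refl)
  also have "\<dots> \<le> (S / 2 + \<theta> * g) + (S / 2 + \<theta> * g) + 2 * \<theta> * g"
    using r[of zp] r[of zm] lip[of \<alpha> zp zm] root_half[of zp] root_half[of zm] by (auto simp: g_def)
  also have "\<dots> = S + 4 * (\<theta> * g)" by simp
  finally have "g \<le> S + 4 * (\<theta> * g)" .
  moreover have "\<theta> * g \<le> g / 100" using mult_right_mono[OF \<theta>(2), of g] by (simp add: g_def)
  ultimately show ?thesis unfolding g_def[symmetric] using S_pos by linarith
qed

lemma root_near:
  assumes "z = zm \<or> z = zp" shows "cmod (z - zs) \<le> (21 / 40) * S" "z \<in> D"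
proof -
  show "cmod (z - zs) \<le> (21 / 40) * S" using gap root_dist[OF assms] by simp
  then show "z \<in> D" using S_pos by (simp add: D_def)
qed

lemma ratio_near_1:
  assumes "z \<in> D" shows "cmod (\<beta>m z / \<beta>m zs - 1) \<le> \<kappa>" "cmod (\<beta>p z / \<beta>p zs - 1) \<le> \<kappa>"
proof -
  have eq: "f z / f zs - 1 = (f z - f zs) / f zs" if "f zs \<noteq> 0" for f :: "complex \<Rightarrow> complex"
    using that by (simp add: diff_divide_distrib)
  have "cmod (z - zs) \<le> 2 * (cmod (\<beta>m zs) + cmod (\<beta>p zs))" using assms by (simp add: D_def S_def)
  from \<kappa>_bound[OF this] show "cmod (\<beta>m z / \<beta>m zs - 1) \<le> \<kappa>" "cmod (\<beta>p z / \<beta>p zs - 1) \<le> \<kappa>"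
    using nz by (simp_all add: eq norm_divide pos_divide_le_eq)
qed

lemma D_subset_U: "D \<subseteq> U"
proof
  fix z assume z: "z \<in> D"
  have pos: "0 < Re w" if "cmod (w - 1) \<le> \<kappa>" for w
    using that abs_Re_le_cmod[of "w - 1"] \<kappa> by simp
  have "z \<in> ball 0 c" using D_in_ball[OF z] c by simp
  then show "z \<in> U" unfolding U_def using ratio_near_1[OF z] pos by blast
qed

lemma U_open: "open U"
proof -
  have c1: "continuous_on (ball 0 c) (\<lambda>z. Re (\<beta>m z / \<beta>m zs))" "continuous_on (ball 0 c) (\<lambda>z. Re (\<beta>p z / \<beta>p zs))"
    using nz hol by (auto intro!: continuous_intros holomorphic_on_imp_continuous_on holomorphic_intros)
  have "open (ball 0 c \<inter> (\<lambda>z. Re (\<beta>m z / \<beta>m zs)) -` {0<..})" "open (ball 0 c \<inter> (\<lambda>z. Re (\<beta>p z / \<beta>p zs)) -` {0<..})"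
    by (rule continuous_open_preimage[OF c1(1)] continuous_open_preimage[OF c1(2)], auto)+
  then have "open ((ball 0 c \<inter> (\<lambda>z. Re (\<beta>m z / \<beta>m zs)) -` {0<..}) \<inter> (ball 0 c \<inter> (\<lambda>z. Re (\<beta>p z / \<beta>p zs)) -` {0<..}))"
    by (rule open_Int)
  moreover have "U = (ball 0 c \<inter> (\<lambda>z. Re (\<beta>m z / \<beta>m zs)) -` {0<..}) \<inter> (ball 0 c \<inter> (\<lambda>z. Re (\<beta>p z / \<beta>p zs)) -` {0<..})"
    unfolding U_def by auto
  ultimately show ?thesis by simp
qed

lemma branch_holomorphic: "sqrt_branch \<beta>m zs holomorphic_on U" "sqrt_branch \<beta>p zs holomorphic_on U"
proof -
  have U: "U \<subseteq> ball 0 c" by (auto simp: U_def)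
  have *: "(\<lambda>z. csqrt (f z / f zs) * csqrt (f zs)) holomorphic_on U"
    if f: "f holomorphic_on ball 0 c" "f zs \<noteq> 0" and pos: "\<And>z. z \<in> U \<Longrightarrow> 0 < Re (f z / f zs)" for f
  proof -
    have "(\<lambda>z. f z / f zs) holomorphic_on U"
      using holomorphic_on_subset[OF f(1) U] f(2) by (intro holomorphic_intros)
    moreover have "f z / f zs \<notin> \<real>\<^sub>\<le>\<^sub>0" if "z \<in> U" for z
      using pos[OF that] by (auto simp: complex_nonpos_Reals_iff)
    ultimately have "(\<lambda>z. csqrt (f z / f zs)) holomorphic_on U" by (rule holomorphic_on_csqrt')
    then show ?thesis by (rule holomorphic_on_mult[OF _ holomorphic_on_const])
  qed
  show "sqrt_branch \<beta>m zs holomorphic_on U" "sqrt_branch \<beta>p zs holomorphic_on U"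
    unfolding sqrt_branch_def[abs_def] by (rule *; use hol nz in \<open>simp add: U_def\<close>)+
qed

lemma s_holomorphic: "s holomorphic_on U"
  unfolding s_def[abs_def] by (intro holomorphic_intros branch_holomorphic)

lemma s_square: "(s z)\<^sup>2 = \<beta>m z * \<beta>p z"
  using nz by (simp add: s_def power_mult_distrib sqrt_branch_square)

lemma norm_s_zs: "cmod (s zs) \<le> S / 2" and s_zs_nonzero: "s zs \<noteq> 0"
proof -
  have "(cmod (s zs))\<^sup>2 = cmod (\<beta>m zs) * cmod (\<beta>p zs)" using s_square[of zs] by (simp flip: norm_mult norm_power)
  then have "cmod (s zs) \<le> (cmod (\<beta>m zs) + cmod (\<beta>p zs)) / 2" by (intro sqrt_mult_le_mean) auto
  then show "cmod (s zs) \<le> S / 2" by (simp add: S_def)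
  show "s zs \<noteq> 0" using s_square[of zs] nz by auto
qed

lemma s_near:
  assumes z: "z \<in> D" shows "cmod (s z - s zs) \<le> 3 * \<kappa> * cmod (s zs)"
proof -
  define u where "u = csqrt (\<beta>m z / \<beta>m zs) - 1"
  define v where "v = csqrt (\<beta>p z / \<beta>p zs) - 1"
  have uv: "cmod u \<le> \<kappa>" "cmod v \<le> \<kappa>"
    unfolding u_def v_def using norm_csqrt_minus_1_le ratio_near_1[OF z] order_trans by blast+
  have "s z = (1 + u) * (1 + v) * s zs"
    using nz by (simp add: s_def sqrt_branch_def u_def v_def mult_ac)
  then have eq: "s z - s zs = (u + v + u * v) * s zs" by (simp add: algebra_simps)
  have "cmod (u * v) \<le> \<kappa> * 1" unfolding norm_mult using uv \<kappa> by (intro mult_mono) auto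
  then have "cmod (u + v + u * v) \<le> 3 * \<kappa>"
    using uv norm_triangle_ineq[of "u + v" "u * v"] norm_triangle_ineq[of u v] by linarith
  then show ?thesis unfolding eq norm_mult by (rule mult_right_mono) simp
qed

lemma s_near': assumes "z \<in> D" shows "cmod (s z - s zs) \<le> (3 / 2) * \<kappa> * S"
proof -
  have "3 * \<kappa> * cmod (s zs) \<le> 3 * \<kappa> * (S / 2)" using \<kappa> norm_s_zs by (intro mult_left_mono) auto
  then show ?thesis using s_near[OF assms] by simp
qed

text \<open>Cauchy's estimate is applied to s - s zs on the whole disc of radius 2 S, and therefore
  yields a Lipschitz bound on the disc of half that radius.\<close>

lemma s_lip:
  assumes "cmod (z - zs) < S" "cmod (w - zs) < S"
  shows "cmod (s z - s w) \<le> (3 / 2) * \<kappa> * cmod (z - w)"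
proof -
  have sub: "ball zs (2 * S) \<subseteq> D" by (auto simp: D_def dist_norm norm_minus_commute)
  have "cmod ((s z - s zs) - (s w - s zs)) \<le> (2 * ((3 / 2) * \<kappa> * S) / (2 * S)) * cmod (z - w)"
  proof (rule holomorphic_bounded_Lipschitz)
    show "(\<lambda>z. s z - s zs) holomorphic_on ball zs (2 * S)"
      using holomorphic_on_subset[OF s_holomorphic order_trans[OF sub D_subset_U]] by (intro holomorphic_intros)
    show "cmod (s x - s zs) \<le> (3 / 2) * \<kappa> * S" if "x \<in> ball zs (2 * S)" for x
      using s_near' sub that by blast
  qed (use S_pos assms in \<open>simp_all add: dist_norm norm_minus_commute\<close>)
  then show ?thesis using S_pos by simp
qed

text \<open>In the outer part of \<open>D\<close> the variation of s is controlled in supremum norm,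
  without a Lipschitz bound. This first gives |w - z| \<le> S / 20, which brings w into the inner
  disc of \<open>s_lip\<close>; there the difference of the two equations is a contraction and
  forces w = z.\<close>

lemma unique_root:
  assumes z: "z = zm \<or> z = zp" and w: "w \<in> D" and \<sigma>: "cmod \<sigma> = 1"
    and eqz: "z - \<alpha> z = \<sigma> * s z" and eqw: "w - \<alpha> w = \<sigma> * s w"
  shows "w = z"
proof -
  have zD: "z \<in> D" by (rule root_near[OF z])
  have "w - z = (\<alpha> w - \<alpha> z) + \<sigma> * (s w - s z)" using eqz eqw by (simp add: algebra_simps)
  then have "cmod (w - z) \<le> cmod (\<alpha> w - \<alpha> z) + cmod (s w - s z)"
    using norm_triangle_ineq[of "\<alpha> w - \<alpha> z" "\<sigma> * (s w - s z)"] \<sigma> by (simp add: norm_mult)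
  also have "cmod (\<alpha> w - \<alpha> z) \<le> 2 * \<theta> * cmod (w - z)"
    using D_in_ball[OF w] D_in_ball[OF zD] by (intro lip) auto
  finally have le: "cmod (w - z) \<le> 2 * \<theta> * cmod (w - z) + cmod (s w - s z)" by simp
  have t: "2 * \<theta> * cmod (w - z) \<le> 2 * (1/100) * cmod (w - z)" using \<theta> by (intro mult_right_mono) auto
  have "cmod (s w - s z) \<le> cmod (s w - s zs) + cmod (s z - s zs)"
    using norm_triangle_ineq4[of "s w - s zs" "s z - s zs"] by simp
  also have "\<dots> \<le> 3 * \<kappa> * S" using s_near'[OF w] s_near'[OF zD] by simp
  also have "\<dots> \<le> 3 * (1/100) * S" using \<kappa> S_pos by (intro mult_right_mono) auto
  finally have "cmod (w - z) \<le> S / 20" using le t S_pos by linarith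
  moreover have "cmod (w - zs) \<le> cmod (w - z) + cmod (z - zs)"
    using norm_triangle_ineq[of "w - z" "z - zs"] by simp
  ultimately have "cmod (w - zs) < S" "cmod (z - zs) < S" using root_near(1)[OF z] S_pos by linarith+
  from s_lip[OF this] have "cmod (s w - s z) \<le> (3 / 2) * (1 / 100) * cmod (w - z)"
    using mult_right_mono[of "(3 / 2) * \<kappa>" "(3 / 2) * (1 / 100)" "cmod (w - z)"] \<kappa> by simp
  with le t have "cmod (w - z) \<le> (1 / 2) * cmod (w - z)" using norm_ge_zero[of "w - z"] by linarith
  from small_factor_zero[OF this] show ?thesis by simp
qed

lemma root_sign:
  assumes "z = zm \<or> z = zp" shows "z - \<alpha> z = s z \<or> z - \<alpha> z = - s z"
  using root_small(3)[OF assms] s_square[of z] by (metis power2_eq_iff)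

text \<open>
  A double root \<open>z\<close> would satisfy one of the two equations only. Brouwer's theorem, applied near
  the reflected point \<open>z - 2 \<sigma> s z\<close>, yields a root of the other one.
\<close>

lemma roots_distinct: "zp \<noteq> zm"
proof
  assume eq: "zp = zm"
  then have z0: "zs = zp" by (simp add: zs)
  obtain \<sigma> :: complex where \<sigma>: "\<sigma> = 1 \<or> \<sigma> = -1" and e0: "zs - \<alpha> zs = \<sigma> * s zs"
    using root_sign[of zp] z0 by (metis mult_1 mult_minus1)
  have n\<sigma>: "cmod \<sigma> = 1" using \<sigma> by auto
  \<comment> \<open>By \<open>e0\<close> this is \<open>T zs\<close>, the first iterate of the map
    whose fixed points solve the opposite equation.\<close>
  define w0 where "w0 = zs - 2 * \<sigma> * s zs"
  define T where "T z = \<alpha> z - \<sigma> * s z" for z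
  have "cmod (w0 - zs) = 2 * cmod (s zs)" by (simp add: w0_def norm_mult n\<sigma>)
  then have w0: "cmod (w0 - zs) \<le> S" using norm_s_zs by simp
  have near: "cmod (z - zs) \<le> (5/4) * S" if "z \<in> cball w0 (S / 4)" for z
  proof -
    have "cmod (z - w0) \<le> S / 4" using that by (simp add: dist_norm norm_minus_commute)
    then show ?thesis using w0 norm_triangle_ineq[of "z - w0" "w0 - zs"] by simp
  qed
  have sub: "cball w0 (S / 4) \<subseteq> D" using near S_pos by (fastforce simp: D_def)
  have zsD: "zs \<in> D" using S_pos by (simp add: D_def)
  have "\<exists>z\<in>cball w0 (S / 4). T z = z"
  proof (rule brouwer)
    have "D \<subseteq> ball 0 c" using D_subset_U by (auto simp: U_def)
    then show "continuous_on (cball w0 (S / 4)) T"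
      unfolding T_def using sub D_subset_U
      by (intro continuous_intros holomorphic_on_imp_continuous_on
          holomorphic_on_subset[OF hol(1)] holomorphic_on_subset[OF s_holomorphic]) auto
    show "T \<in> cball w0 (S / 4) \<rightarrow> cball w0 (S / 4)"
    proof
      fix z assume z: "z \<in> cball w0 (S / 4)"
      then have zD: "z \<in> D" using sub by blast
      have "T z - w0 = (\<alpha> z - \<alpha> zs) - \<sigma> * (s z - s zs)"
        using e0 by (simp add: T_def w0_def algebra_simps)
      then have "cmod (T z - w0) \<le> cmod (\<alpha> z - \<alpha> zs) + cmod (s z - s zs)"
        using norm_triangle_ineq4[of "\<alpha> z - \<alpha> zs" "\<sigma> * (s z - s zs)"] n\<sigma> by (simp add: norm_mult)
      also have "\<dots> \<le> 2 * \<theta> * cmod (z - zs) + (3/2) * \<kappa> * S"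
        using D_in_ball[OF zD] D_in_ball[OF zsD] by (intro add_mono lip s_near'[OF zD]) auto
      also have "\<dots> \<le> 2 * (1/100) * ((5/4) * S) + (3/2) * (1/100) * S"
        using near[OF z] \<theta> \<kappa> S_pos by (intro add_mono mult_mono mult_right_mono) auto
      also have "\<dots> \<le> S / 4" using S_pos by simp
      finally show "T z \<in> cball w0 (S / 4)" by (simp add: dist_norm norm_minus_commute)
    qed
  qed (use S_pos in auto)
  then obtain w where w: "w \<in> cball w0 (S / 4)" "\<alpha> w - \<sigma> * s w = w" unfolding T_def by blast
  have ww: "w - \<alpha> w = - (\<sigma> * s w)" using w(2) by (simp add: algebra_simps)
  have "\<sigma>\<^sup>2 = 1" using \<sigma> by auto
  then have "(w - \<alpha> w)\<^sup>2 = \<beta>m w * \<beta>p w" unfolding ww by (simp add: power_mult_distrib s_square)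
  moreover have "cmod w < c" using D_in_ball[of w] sub w(1) c by auto
  \<comment> \<open>As the two roots are assumed to coincide, w must be the double root
    \<open>zs\<close>, which then satisfies both equations; subtracting them gives
    \<open>s zs = 0\<close>.\<close>
  ultimately have "w = zs" using roots[of w] eq z0 by auto
  with ww e0 have "\<sigma> * s zs = 0" by simp
  with \<sigma> s_zs_nonzero show False by auto
qed

text \<open>The principal roots fix the product \<open>s\<close> without regard to which eigenvalue
  is called \<open>zp\<close>; this sign assigns \<open>zp\<close> to the equation with
  plus.\<close>

definition \<sigma> :: complex where "\<sigma> = (if zp - \<alpha> zp = s zp then 1 else -1)"

lemma root_equations: "zp - \<alpha> zp = \<sigma> * s zp" "zm - \<alpha> zm = - (\<sigma> * s zm)" and \<sigma>_cases: "\<sigma> = 1 \<or> \<sigma> = -1"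
proof -
  show \<sigma>: "\<sigma> = 1 \<or> \<sigma> = -1" by (simp add: \<sigma>_def)
  show p: "zp - \<alpha> zp = \<sigma> * s zp" using root_sign[of zp] by (auto simp: \<sigma>_def)
  show "zm - \<alpha> zm = - (\<sigma> * s zm)"
  proof (rule ccontr)
    assume "\<not> ?thesis"
    then have m: "zm - \<alpha> zm = \<sigma> * s zm" using root_sign[of zm] \<sigma> by auto
    have "zm = zp" by (rule unique_root[OF _ _ _ p m]) (use \<sigma> root_near(2)[of zm] in auto)
    with roots_distinct show False by simp
  qed
qed

lemma plus_root: "{z \<in> D. z - \<alpha> z = \<sigma> * s z} = {zp}"
proof -
  have "w = zp" if "w \<in> D" "w - \<alpha> w = \<sigma> * s w" for w
    by (rule unique_root[OF _ that(1) _ root_equations(1) that(2)]) (use \<sigma>_cases in auto)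
  then show ?thesis using root_equations(1) root_near(2)[of zp] by blast
qed

lemma minus_root: "{z \<in> D. z - \<alpha> z = - (\<sigma> * s z)} = {zm}"
proof -
  have "w = zm" if "w \<in> D" "w - \<alpha> w = - (\<sigma> * s w)" for w
    by (rule unique_root[of zm w "- \<sigma>"]) (use \<sigma>_cases that root_equations(2) in auto)
  then show ?thesis using root_equations(2) root_near(2)[of zm] by blast
qed

text \<open>The error has to be small relative to |s zs|, the geometric mean, which may be much
  smaller than S when the two values of \<beta> differ in size. Therefore the relative estimate
  \<open>s_near\<close> enters, and the Lipschitz bound of \<alpha> is applied to the gap itself
  rather than to the diameter of \<open>D\<close>.\<close>

lemma gap_asymptotics: "cmod ((zp - zm) / (2 * (\<sigma> * s zs)) - 1) \<le> 3 * \<theta> + 3 * \<kappa>"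
proof -
  define g where "g = cmod (zp - zm)"
  define r where "r = cmod (s zs)"
  have r: "0 < r" using s_zs_nonzero by (simp add: r_def)
  have n\<sigma>: "cmod \<sigma> = 1" "\<sigma> \<noteq> 0" using \<sigma>_cases by auto
  have "(zp - zm) - 2 * (\<sigma> * s zs) = (\<alpha> zp - \<alpha> zm) + \<sigma> * ((s zp - s zs) + (s zm - s zs))"
  proof -
    have "zp - zm = (zp - \<alpha> zp) - (zm - \<alpha> zm) + (\<alpha> zp - \<alpha> zm)" by simp
    then show ?thesis unfolding root_equations(1,2) by (simp add: algebra_simps)
  qed
  then have "cmod ((zp - zm) - 2 * (\<sigma> * s zs)) \<le> cmod (\<alpha> zp - \<alpha> zm) + cmod ((s zp - s zs) + (s zm - s zs))"
    using norm_triangle_ineq[of "\<alpha> zp - \<alpha> zm" "\<sigma> * ((s zp - s zs) + (s zm - s zs))"] n\<sigma> by (simp add: norm_mult)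
  also have "cmod ((s zp - s zs) + (s zm - s zs)) \<le> 3 * \<kappa> * r + 3 * \<kappa> * r"
    unfolding r_def using s_near[OF root_near(2)] by (intro norm_triangle_le add_mono) auto
  also have "cmod (\<alpha> zp - \<alpha> zm) \<le> 2 * \<theta> * g"
    unfolding g_def using root_half by (intro lip) auto
  finally have le: "cmod ((zp - zm) - 2 * (\<sigma> * s zs)) \<le> 2 * (\<theta> * g) + 6 * (\<kappa> * r)" by simp
  have "g \<le> cmod ((zp - zm) - 2 * (\<sigma> * s zs)) + cmod (2 * (\<sigma> * s zs))"
    unfolding g_def using norm_triangle_ineq[of "(zp - zm) - 2 * (\<sigma> * s zs)" "2 * (\<sigma> * s zs)"] by simp
  also have "cmod (2 * (\<sigma> * s zs)) = 2 * r" by (simp add: norm_mult n\<sigma> r_def)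
  finally have "g \<le> 2 * (\<theta> * g) + 6 * (\<kappa> * r) + 2 * r" using le by simp
  moreover have "\<theta> * g \<le> (1/100) * g" "\<kappa> * r \<le> (1/100) * r"
    using \<theta> \<kappa> r by (intro mult_right_mono; simp add: g_def)+
  \<comment> \<open>An a priori bound on the gap by a multiple of |s zs|, which turns the term 2
    \<theta> g into a relative error.\<close>
  ultimately have "g \<le> 3 * r" using r by linarith
  then have "\<theta> * g \<le> \<theta> * (3 * r)" using \<theta> by (intro mult_left_mono)
  with le have le': "cmod ((zp - zm) - 2 * (\<sigma> * s zs)) \<le> (3 * \<theta> + 3 * \<kappa>) * (2 * r)"
    by (simp add: algebra_simps)
  have "(zp - zm) / (2 * (\<sigma> * s zs)) - 1 = ((zp - zm) - 2 * (\<sigma> * s zs)) / (2 * (\<sigma> * s zs))"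
    using n\<sigma> s_zs_nonzero by (simp add: diff_divide_distrib)
  then have "cmod ((zp - zm) / (2 * (\<sigma> * s zs)) - 1) = cmod ((zp - zm) - 2 * (\<sigma> * s zs)) / (2 * r)"
    by (simp only: norm_divide) (simp add: norm_mult n\<sigma> r_def)
  also have "\<dots> \<le> 3 * \<theta> + 3 * \<kappa>" using le' r by (simp add: pos_divide_le_eq)
  finally show ?thesis .
qed

end

theorem theorem11:
  fixes v :: potential and b :: bc and \<Delta> :: "int set" and \<eta> :: "int \<Rightarrow> real"
    and lm lp zm zp zs \<gamma> :: "int \<Rightarrow> complex" and \<rho> :: "int \<Rightarrow> real"
    and D :: "int \<Rightarrow> complex set"
  assumes "valid_potential v"
    and "infinite \<Delta>" and "\<Delta> \<subseteq> indices v" and "\<And>n. n \<in> \<Delta> \<Longrightarrow> bc_of n = b"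
    and "\<forall>\<^sub>F n in at_infinity_in \<Delta>. eigenvalue_pair v n (lm n) (lp n)"
    and "\<And>n. \<gamma> n = lp n - lm n"
    and "\<And>n. zm n = lm n - lambda0 v n" and "\<And>n. zp n = lp n - lambda0 v n"
    and "\<And>n. zs n = (zp n + zm n) / 2"
    and "\<And>n. \<rho> n = 2 * (cmod (beta_minus v n (zs n)) + cmod (beta_plus v n (zs n)))"
    and "\<And>n. D n = {z. cmod (z - zs n) \<le> \<rho> n}"
    and "\<And>n. n \<in> \<Delta> \<Longrightarrow> \<eta> n > 0" and "(\<eta> \<longlongrightarrow> 0) (at_infinity_in \<Delta>)"
    and "\<forall>\<^sub>F n in at_infinity_in \<Delta>. beta_minus v n (zs n) \<noteq> 0 \<and> beta_plus v n (zs n) \<noteq> 0"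
    and "\<exists>K. \<forall>\<^sub>F n in at_infinity_in \<Delta>. \<forall>z\<in>D n.
           cmod (beta_minus v n z - beta_minus v n (zs n)) \<le> K * \<eta> n * cmod (beta_minus v n (zs n)) \<and>
           cmod (beta_plus v n z - beta_plus v n (zs n)) \<le> K * \<eta> n * cmod (beta_plus v n (zs n))"
  shows "\<exists>sm sp :: int \<Rightarrow> complex \<Rightarrow> complex.
           (\<forall>\<^sub>F n in at_infinity_in \<Delta>.
              (\<exists>U. open U \<and> D n \<subseteq> U \<and> sm n holomorphic_on U \<and> sp n holomorphic_on U \<and>
                   (\<forall>z\<in>U. (sm n z)\<^sup>2 = beta_minus v n z \<and> (sp n z)\<^sup>2 = beta_plus v n z)) \<and>
              {z \<in> D n. z - alpha v n z = sm n z * sp n z} = {zp n} \<and>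
              {z \<in> D n. z - alpha v n z = - (sm n z * sp n z)} = {zm n}) \<and>
           ((\<lambda>n. \<gamma> n / (2 * sm n (zs n) * sp n (zs n))) \<longlongrightarrow> 1) (at_infinity_in \<Delta>)"
proof -
  let ?F = "at_infinity_in \<Delta>"
  let ?\<alpha> = "alpha v" and ?\<beta>m = "beta_minus v" and ?\<beta>p = "beta_plus v"
  obtain K0 where K0: "\<forall>\<^sub>F n in ?F. \<forall>z\<in>D n.
           cmod (?\<beta>m n z - ?\<beta>m n (zs n)) \<le> K0 * \<eta> n * cmod (?\<beta>m n (zs n)) \<and>
           cmod (?\<beta>p n z - ?\<beta>p n (zs n)) \<le> K0 * \<eta> n * cmod (?\<beta>p n (zs n))"
    using assms(15) by blast
  \<comment> \<open>The absolute value makes the constant nonnegative, as \<kappa> in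
    \<open>root_pair\<close> has to be.\<close>
  define K where "K = \<bar>K0\<bar>"
  have in\<Delta>: "\<forall>\<^sub>F n in ?F. n \<in> \<Delta>" unfolding eventually_at_infinity_in by blast
  have K\<eta>: "((\<lambda>n. K * \<eta> n) \<longlongrightarrow> 0) ?F" using tendsto_mult_left[OF assms(13), of K] by simp
  have rp: "\<forall>\<^sub>F n in ?F. root_pair (?\<alpha> n) (?\<beta>m n) (?\<beta>p n) (disc_radius v n) \<theta> (K * \<eta> n) (zp n) (zm n) (zs n)"
    if \<theta>: "0 < \<theta>" "\<theta> \<le> 1/100" for \<theta>
  proof -
    from eventually_reduction[OF assms(1) \<theta>(1)]
    have red: "\<forall>\<^sub>F n in ?F. reduction v \<theta> n" unfolding eventually_at_infinity_in using assms(3) by blast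
    have small: "\<forall>\<^sub>F n in ?F. K * \<eta> n < 1/100" by (rule order_tendstoD(2)[OF K\<eta>]) simp
    show ?thesis
      using in\<Delta> red small K0 assms(5) assms(14)
    proof eventually_elim
      case (elim n)
      have \<eta>: "0 < \<eta> n" by (rule assms(12)[OF elim(1)])
      have c: "0 < disc_radius v n" using elim(1) assms(3) by (cases v) auto
      have KK: "K0 * \<eta> n * x \<le> K * \<eta> n * x" if "0 \<le> x" for x
        using \<eta> that by (intro mult_right_mono) (auto simp: K_def)
      note r = elim(2)[unfolded reduction_def]
      \<comment> \<open>The characteristic equation, valid throughout the disc, meets the
        description of the eigenvalues in that disc as the pair \<open>lm n\<close>,
        \<open>lp n\<close>.\<close>
      have ev: "cmod z < disc_radius v n \<and> (z - ?\<alpha> n z)\<^sup>2 = ?\<beta>m n z * ?\<beta>p n z \<longleftrightarrow> z = zm n \<or> z = zp n" for z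
      proof -
        have "cmod z < disc_radius v n \<and> (z - ?\<alpha> n z)\<^sup>2 = ?\<beta>m n z * ?\<beta>p n z
          \<longleftrightarrow> cmod z < disc_radius v n \<and> eigenvalue v (bc_of n) (lambda0 v n + z)"
          using r by blast
        also have "\<dots> \<longleftrightarrow> lambda0 v n + z \<in> {\<mu>. cmod (\<mu> - lambda0 v n) < disc_radius v n \<and> eigenvalue v (bc_of n) \<mu>}"
          by simp
        also have "\<dots> \<longleftrightarrow> lambda0 v n + z \<in> {lm n, lp n}"
          using elim(5) unfolding eigenvalue_pair_def by simp
        also have "\<dots> \<longleftrightarrow> z = zm n \<or> z = zp n"
          unfolding assms(7,8) by (auto simp: algebra_simps)
        finally show ?thesis .
      qed
      show ?case
      proof
        show "cmod (?\<beta>m n z - ?\<beta>m n (zs n)) \<le> K * \<eta> n * cmod (?\<beta>m n (zs n))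
            \<and> cmod (?\<beta>p n z - ?\<beta>p n (zs n)) \<le> K * \<eta> n * cmod (?\<beta>p n (zs n))"
          if "cmod (z - zs n) \<le> 2 * (cmod (?\<beta>m n (zs n)) + cmod (?\<beta>p n (zs n)))" for z
        proof -
          have "z \<in> D n" using that by (simp add: assms(10,11))
          with elim(4) KK[OF norm_ge_zero] show ?thesis by (meson order_trans)
        qed
        show "0 \<le> K * \<eta> n" using \<eta> by (simp add: K_def)
        show "K * \<eta> n \<le> 1/100" using elim(3) by simp
        show "zs n = (zp n + zm n) / 2" by (rule assms(9))
      qed (use c \<theta> r ev elim(6) in auto)
    qed
  qed
  \<comment> \<open>The sign and the branches are defined outside of the locale: they do not depend
    on \<theta>, so the same branches serve for every accuracy in the limit.\<close>
  define \<sigma> where "\<sigma> n = (if zp n - ?\<alpha> n (zp n) = sqrt_branch (?\<beta>m n) (zs n) (zp n) * sqrt_branch (?\<beta>p n) (zs n) (zp n)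
      then 1 else - 1 :: complex)" for n
  define sm where "sm n z = \<sigma> n * sqrt_branch (?\<beta>m n) (zs n) z" for n z
  define sp where "sp n = sqrt_branch (?\<beta>p n) (zs n)" for n
  have main: "(\<exists>U. open U \<and> D n \<subseteq> U \<and> sm n holomorphic_on U \<and> sp n holomorphic_on U \<and>
                   (\<forall>z\<in>U. (sm n z)\<^sup>2 = ?\<beta>m n z \<and> (sp n z)\<^sup>2 = ?\<beta>p n z)) \<and>
              {z \<in> D n. z - ?\<alpha> n z = sm n z * sp n z} = {zp n} \<and>
              {z \<in> D n. z - ?\<alpha> n z = - (sm n z * sp n z)} = {zm n}"
    and gap: "cmod (\<gamma> n / (2 * sm n (zs n) * sp n (zs n)) - 1) \<le> 3 * \<theta> + 3 * (K * \<eta> n)"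
    if "root_pair (?\<alpha> n) (?\<beta>m n) (?\<beta>p n) (disc_radius v n) \<theta> (K * \<eta> n) (zp n) (zm n) (zs n)" for n \<theta>
  proof -
    interpret R: root_pair "?\<alpha> n" "?\<beta>m n" "?\<beta>p n" "disc_radius v n" \<theta> "K * \<eta> n" "zp n" "zm n" "zs n"
      by (rule that)
    have \<sigma>: "R.\<sigma> = \<sigma> n" unfolding R.\<sigma>_def R.s_def \<sigma>_def ..
    have D: "R.D = D n" unfolding R.D_def R.S_def assms(10,11) ..
    have ss: "sm n z * sp n z = R.\<sigma> * R.s z" for z unfolding sm_def sp_def R.s_def \<sigma> by (rule mult.assoc)
    have sq: "(sm n z)\<^sup>2 = ?\<beta>m n z" "(sp n z)\<^sup>2 = ?\<beta>p n z" for z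
      using R.\<sigma>_cases R.nz by (auto simp: sm_def sp_def \<sigma> power_mult_distrib sqrt_branch_square)
    have h: "sm n holomorphic_on R.U" "sp n holomorphic_on R.U"
      unfolding sm_def[abs_def] sp_def by (intro holomorphic_intros R.branch_holomorphic)+
    show "(\<exists>U. open U \<and> D n \<subseteq> U \<and> sm n holomorphic_on U \<and> sp n holomorphic_on U \<and>
                   (\<forall>z\<in>U. (sm n z)\<^sup>2 = ?\<beta>m n z \<and> (sp n z)\<^sup>2 = ?\<beta>p n z)) \<and>
              {z \<in> D n. z - ?\<alpha> n z = sm n z * sp n z} = {zp n} \<and>
              {z \<in> D n. z - ?\<alpha> n z = - (sm n z * sp n z)} = {zm n}"
      using R.plus_root R.minus_root R.U_open R.D_subset_U h sq unfolding ss D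
      by (intro conjI exI[of _ R.U] ballI)
    have "\<gamma> n = zp n - zm n" by (simp add: assms(6-8))
    then show "cmod (\<gamma> n / (2 * sm n (zs n) * sp n (zs n)) - 1) \<le> 3 * \<theta> + 3 * (K * \<eta> n)"
      using R.gap_asymptotics unfolding ss[symmetric] by (simp add: mult.assoc)
  qed
  show ?thesis
  proof (rule exI[of _ sm], rule exI[of _ sp], rule conjI)
    show "\<forall>\<^sub>F n in ?F. (\<exists>U. open U \<and> D n \<subseteq> U \<and> sm n holomorphic_on U \<and> sp n holomorphic_on U \<and>
                   (\<forall>z\<in>U. (sm n z)\<^sup>2 = ?\<beta>m n z \<and> (sp n z)\<^sup>2 = ?\<beta>p n z)) \<and>
              {z \<in> D n. z - ?\<alpha> n z = sm n z * sp n z} = {zp n} \<and>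
              {z \<in> D n. z - ?\<alpha> n z = - (sm n z * sp n z)} = {zm n}"
      by (rule eventually_mono[OF rp[of "1/100"]]) (simp, simp, rule main)
    show "((\<lambda>n. \<gamma> n / (2 * sm n (zs n) * sp n (zs n))) \<longlongrightarrow> 1) ?F"
    proof (rule tendstoI)
      fix e :: real assume e: "e > 0"
      \<comment> \<open>With this choice and \<open>K * \<eta> n < e / 12\<close> the error 3
        \<theta> + 3 K \<eta>_n stays below e / 2.\<close>
      define \<theta> where "\<theta> = min (1/100) (e / 12)"
      have \<theta>: "0 < \<theta>" "\<theta> \<le> 1/100" "3 * \<theta> \<le> e / 4" using e by (auto simp: \<theta>_def min_def)
      have "\<forall>\<^sub>F n in ?F. K * \<eta> n < e / 12" by (rule order_tendstoD(2)[OF K\<eta>]) (use e in simp)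
      with rp[OF \<theta>(1,2)]
      show "\<forall>\<^sub>F n in ?F. dist (\<gamma> n / (2 * sm n (zs n) * sp n (zs n))) 1 < e"
      proof eventually_elim
        case (elim n)
        from gap[OF elim(1)] elim(2) \<theta>(3) e show ?case unfolding dist_norm by linarith
      qed
    qed
  qed
qed

end
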